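(* (a) The number of simplicial chambers in $\mathrm{I}(\mathfrak{sl}_n,V\oplus\bigwedge^2)$ is $$2\binom{n-1}{\lfloor (n-1)/2\rfloor}-\delta_{n,1}-\delta_{n,2}-2\delta_{n,3}-2\delta_{n,4}.$$ It follows that the generating function (in the variable $x$) for the number of simplicial chambers of $\mathrm{I}(\mathfrak{sl}_n,V\oplus\bigwedge^2)$ is $$\frac{4x^5+2x^4+3x^2+\sqrt{1-4x^2}-1}{1-2x}.$$ Suppose now that $C$ is a chamber of $\mathrm{I}(\mathfrak{gl}_n,V\oplus\bigwedge^2)$ with characteristic vector $s=(s_1,\dots,s_n)\in\{-1,1\}^n$, that $n\ge3$, and that $C\cap\mathfrak h_s$ is a chamber of $\mathrm{I}(\mathfrak{sl}_n,V\oplus\bigwedge^2)$. Let $\ell_+$ (resp. $\ell_-$, $\ell_0$) denote the number of positive (resp. negative, null) levels for $C$, and let $e_k$ denote the extreme ray of $C$ at level $k$. (b) Let $1\le i\le\lfloor n/2\rfloor$. The ray $\vec v(i,i)$ lies in $C\cap\mathfrak h_s$ if and only if $\vec v(i,i)$ is an extreme ray of $C$. This occurs if and only if $2i$ is a null level for $C$. (c) Let $(p_1,p_2)\in\mathfrak B$. The ray $\vec v(p_1,p_2)$ lies in $C\cap\mathfrak h_s$ if and only if $\vec v(p_1)$ and $\vec v(p_2)$ are extreme rays of $C$. This occurs if and only if the equality $\sigma(e_{\ell_i})=\sigma(p_i)$ holds for $i=1,2$, where $\ell_i=\ell(p_i)$. (d) The number of extreme rays of $C\cap\mathfrak h_s$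 in $\mathrm{I}(\mathfrak{sl}_n,V\oplus\bigwedge^2)$ is $\ell_+\cdot\ell_-+\ell_0$. In particular, $C\cap\mathfrak h_s$ is simplicial if and only if $\min\{\ell_+,\ell_-\}=1$.
   Context: Let $\mathfrak h=\mathbb{R}^n$ with coordinates $x_1,\dots,x_n$, $\mathfrak h_s=\{x_1+\cdots+x_n=0\}$, $W=\{x_1\ge\cdots\ge x_n\}$, $W_s=W\cap\mathfrak h_s$. The weights are $x_i$ ($1\le i\le n$) and $x_i+x_j$ ($1\le i<j\le n$). $\mathrm{I}(\mathfrak{gl}_n,V\oplus\bigwedge^2)$ (resp. $\mathrm{I}(\mathfrak{sl}_n,V\oplus\bigwedge^2)$) is the arrangement of kernels of the weights in $\mathfrak h$ (resp. $\mathfrak h_s$), considered only inside $W$ (resp. $W_s$). A chamber is the closure of a connected component of the set of points in the interior of $W$ (resp. of $W_s$ relative to $\mathfrak h_s$) at which no weight not identically zero on $\mathfrak h$ (resp. $\mathfrak h_s$) vanishes. A face is a face, in the sense of convex polyhedral cones, of a chamber; an extreme ray is a face that is a half-line; vectors are identified with the half-lines they generate. A chamber of the $\mathfrak{sl}_n$ geometry is simplicial if it is the non-negative span of $n-1$ linearly independent vectors. $\delta_{i,j}$ is the Kronecker delta. For $S=\{a_1>\cdots>a_k\}\subseteq\{1,\dots,n\}$, $C(S)$ is the set of points of $W$ such that, for all $1\le i\le j\le n$, $x_i+x_j\ge0$ if $i\le k$ and $j\le a_i+i-1$, and $x_i+x_j\le0$ otherwise; it is known that $S\mapsto C(S)$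 is a bijection from subsets of $\{1,\dots,n\}$ to chambers of $\mathrm{I}(\mathfrak{gl}_n,V\oplus\bigwedge^2)$. The characteristic vector of $C(S)$ is $(s_1,\dots,s_n)$ with $s_i=1$ if $i\in S$ and $s_i=-1$ otherwise. An index $1\le i\le n$ is a null (resp. positive, negative) level for $C(S)$ if $s_{n-i+1}+\cdots+s_n$ is zero (resp. positive, negative). The extreme rays of $C(S)$ are generated by $e_1,\dots,e_n$, where $e_\ell=(1,\dots,1,0,\dots,0,-1,\dots,-1)$ has $\pi_\ell$ ones, $n-\ell$ zeros and $\ell-\pi_\ell$ entries $-1$, with $\pi_\ell=|S\cap[n-\ell+1,\infty)|$; $e_\ell$ is the extreme ray at level $\ell$. $\mathbb{E}^*_n=\{(a,b)\in\mathbb{N}^2:1\le a+b\le n\}$ with the componentwise order, where $\mathbb N$ includes $0$. For $p=(a,b)$, the level is $\ell(p)=a+b$, the signature is $\sigma(p)=a-b$, and $\vec v(p)\in\mathfrak h$ is the vector with $a$ ones, then $n-a-b$ zeros, then $b$ entries $-1$. For a vector in $\mathfrak h$, $\sigma(x_1,\dots,x_n)=x_1+\cdots+x_n$. $\mathfrak B=\{(p,q)\in(\mathbb{E}^*_n)^2:p<q,\ \sigma(p)\sigma(q)<0\}$, and for $(p,q)\in\mathfrak B$, $\vec v(p,q)=|\sigma(q)|\vec v(p)+|\sigma(p)|\vec v(q)$. The square root is the power series with constant term $1$.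
   Formalization: The generating function is taken over n ≥ 2 only: the displayed closed form has coefficient 0 at x, whereas the count formula (and the definition) gives 1 simplicial chamber for n = 1; the count formula itself is stated for all n ≥ 1. *)

theory Defs
  imports "HOL-Analysis.Analysis" "HOL-Analysis.Finite_Function_Topology"
    "HOL-Computational_Algebra.Computational_Algebra"
begin

text \<open>
  Since the rank \<open>n\<close> has to vary inside the statement, \<open>\<real>\<^sup>n\<close> is rendered as the subspace
  of those finitely supported functions that vanish outside \<open>{1..n}\<close>. The library makes
  \<open>(nat, real) poly_mapping\<close> a real normed vector space (with the sum norm), which induces
  the Euclidean topology on each of these finite-dimensional subspaces.
\<close>

type_synonym vec0 = "(nat, real) poly_mapping"

abbreviation coord :: "vec0 \<Rightarrow> nat \<Rightarrow> real" where
  "coord \<equiv> Poly_Mapping.lookup"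

definition hgl :: "nat \<Rightarrow> vec0 set" where
  "hgl n = {x. Poly_Mapping.keys x \<subseteq> {1..n}}"

definition sigv :: "nat \<Rightarrow> vec0 \<Rightarrow> real" where
  "sigv n x = (\<Sum>i=1..n. coord x i)"

definition hsl :: "nat \<Rightarrow> vec0 set" where
  "hsl n = {x \<in> hgl n. sigv n x = 0}"

definition Wgl :: "nat \<Rightarrow> vec0 set" where
  "Wgl n = {x \<in> hgl n. \<forall>i\<in>{1..<n}. coord x i \<ge> coord x (i + 1)}"

definition Wsl :: "nat \<Rightarrow> vec0 set" where
  "Wsl n = Wgl n \<inter> hsl n"

definition weights :: "nat \<Rightarrow> (vec0 \<Rightarrow> real) set" where
  "weights n = {(\<lambda>x. coord x i) | i. 1 \<le> i \<and> i \<le> n}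
             \<union> {(\<lambda>x. coord x i + coord x j) | i j. 1 \<le> i \<and> i < j \<and> j \<le> n}"

text \<open>
  Weights that vanish identically on the ambient space \<open>V\<close> are disregarded
  (for instance \<open>x\<^sub>1 + x\<^sub>2\<close> on \<open>hsl 2\<close>, or \<open>x\<^sub>1\<close> on \<open>hsl 1 = {0}\<close>).
\<close>

definition regular_points :: "vec0 set \<Rightarrow> vec0 set \<Rightarrow> (vec0 \<Rightarrow> real) set \<Rightarrow> vec0 set" where
  "regular_points V W \<Lambda> =
     {x \<in> top_of_set V interior_of W. \<forall>f\<in>\<Lambda>. (\<exists>y\<in>V. f y \<noteq> 0) \<longrightarrow> f x \<noteq> 0}"

definition chambers :: "vec0 set \<Rightarrow> vec0 set \<Rightarrow> (vec0 \<Rightarrow> real) set \<Rightarrow> vec0 set set" where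
  "chambers V W \<Lambda> = closure ` components (regular_points V W \<Lambda>)"

definition gl_chambers :: "nat \<Rightarrow> vec0 set set" where
  "gl_chambers n = chambers (hgl n) (Wgl n) (weights n)"

definition sl_chambers :: "nat \<Rightarrow> vec0 set set" where
  "sl_chambers n = chambers (hsl n) (Wsl n) (weights n)"

definition ray :: "vec0 \<Rightarrow> vec0 set" where
  "ray v = {t *\<^sub>R v | t. t \<ge> 0}"

definition extreme_ray :: "vec0 set \<Rightarrow> vec0 set \<Rightarrow> bool" where
  "extreme_ray F C \<longleftrightarrow> F face_of C \<and> (\<exists>v. v \<noteq> 0 \<and> F = ray v)"

text \<open>
  For finite \<open>B\<close>, \<open>convex_cone hull B\<close> is the set of non-negative linear combinations of \<open>B\<close>;
  in particular \<open>convex_cone hull {} = {0}\<close>, so the unique chamber for \<open>n = 1\<close> is simplicial.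
\<close>

definition simplicial :: "nat \<Rightarrow> vec0 set \<Rightarrow> bool" where
  "simplicial n K \<longleftrightarrow>
     (\<exists>B. finite B \<and> card B = n - 1 \<and> independent B \<and> K = convex_cone hull B)"

definition num_simplicial :: "nat \<Rightarrow> nat" where
  "num_simplicial n = card {K \<in> sl_chambers n. simplicial n K}"

text \<open>
  The generating function starts at \<open>n = 2\<close>. The closed form asserted for it has vanishing
  coefficient at \<open>x\<close>, whereas \<open>num_simplicial 1 = 1\<close> by the degenerate chamber \<open>{0}\<close>.
\<close>

definition simplicial_gf :: "real fps" where
  "simplicial_gf = Abs_fps (\<lambda>n. if n \<ge> 2 then real (num_simplicial n) else 0)"

text \<open>\<open>ith_largest S i\<close> is \<open>a\<^sub>i\<close> for \<open>S = {a\<^sub>1 > \<dots> > a\<^sub>k}\<close> and \<open>1 \<le> i \<le> k\<close>.\<close>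

definition ith_largest :: "nat set \<Rightarrow> nat \<Rightarrow> nat" where
  "ith_largest S i = rev (sorted_list_of_set S) ! (i - 1)"

definition chamber_of :: "nat \<Rightarrow> nat set \<Rightarrow> vec0 set" where
  "chamber_of n S = {x \<in> Wgl n. \<forall>i j. 1 \<le> i \<and> i \<le> j \<and> j \<le> n \<longrightarrow>
     (if i \<le> card S \<and> j \<le> ith_largest S i + i - 1
      then coord x i + coord x j \<ge> 0
      else coord x i + coord x j \<le> 0)}"

definition char_vec :: "nat set \<Rightarrow> nat \<Rightarrow> int" where
  "char_vec S i = (if i \<in> S then 1 else - 1)"

definition level_sum :: "nat \<Rightarrow> (nat \<Rightarrow> int) \<Rightarrow> nat \<Rightarrow> int" where
  "level_sum n s i = (\<Sum>k=n-i+1..n. s k)"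

definition null_level :: "nat \<Rightarrow> (nat \<Rightarrow> int) \<Rightarrow> nat \<Rightarrow> bool" where
  "null_level n s i \<longleftrightarrow> 1 \<le> i \<and> i \<le> n \<and> level_sum n s i = 0"

definition positive_level :: "nat \<Rightarrow> (nat \<Rightarrow> int) \<Rightarrow> nat \<Rightarrow> bool" where
  "positive_level n s i \<longleftrightarrow> 1 \<le> i \<and> i \<le> n \<and> level_sum n s i > 0"

definition negative_level :: "nat \<Rightarrow> (nat \<Rightarrow> int) \<Rightarrow> nat \<Rightarrow> bool" where
  "negative_level n s i \<longleftrightarrow> 1 \<le> i \<and> i \<le> n \<and> level_sum n s i < 0"

text \<open>The order \<open><\<close> on \<open>nat \<times> nat\<close> below is the componentwise one of
  \<^theory>\<open>HOL-Library.Product_Order\<close>.\<close>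

definition Estar :: "nat \<Rightarrow> (nat \<times> nat) set" where
  "Estar n = {(a, b). 1 \<le> a + b \<and> a + b \<le> n}"

definition level :: "nat \<times> nat \<Rightarrow> nat" where
  "level p = fst p + snd p"

definition sig :: "nat \<times> nat \<Rightarrow> int" where
  "sig p = int (fst p) - int (snd p)"

definition vvec :: "nat \<Rightarrow> nat \<times> nat \<Rightarrow> vec0" where
  "vvec n p = (\<Sum>i=1..fst p. Poly_Mapping.single i 1)
            - (\<Sum>i=n - snd p + 1..n. Poly_Mapping.single i 1)"

definition BB :: "nat \<Rightarrow> ((nat \<times> nat) \<times> (nat \<times> nat)) set" where
  "BB n = {(p, q). p \<in> Estar n \<and> q \<in> Estar n \<and> p < q \<and> sig p * sig q < 0}"

definition vvec2 :: "nat \<Rightarrow> nat \<times> nat \<Rightarrow> nat \<times> nat \<Rightarrow> vec0" where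
  "vvec2 n p q = real_of_int \<bar>sig q\<bar> *\<^sub>R vvec n p + real_of_int \<bar>sig p\<bar> *\<^sub>R vvec n q"

definition level_ray :: "nat \<Rightarrow> nat set \<Rightarrow> nat \<Rightarrow> vec0" where
  "level_ray n S l = (let \<pi> = card (S \<inter> {n - l + 1..}) in vvec n (\<pi>, l - \<pi>))"

end

theory Submission
  imports Defs
begin

text \<open>
  A chamber of the general linear geometry is a simplicial cone, and everything about the chambers
  of the special linear geometry is read off from its coordinates. Order the coordinates of a point
  by decreasing absolute value, and let the \<open>r\<close>-th one have the sign \<open>s\<^sub>n\<^sub>-\<^sub>r\<^sub>+\<^sub>1\<close>. Since the point is
  itself weakly decreasing, the positive entries occur from the front and the negative ones from the
  back, so the sign sequence determines the position \<open>place r\<close> of the \<open>r\<close>-th largest absolute value.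
  The inequalities defining \<open>C(S)\<close> then say exactly that these absolute values
  \<open>height 1 x \<ge> \<dots> \<ge> height n x \<ge> 0\<close> are decreasing, and their successive differences \<open>gap l x\<close> are
  the coordinates dual to the rays \<open>e\<^sub>l\<close> (\<open>chamber_of_eq_orthant\<close>).

  On this cone the sum of the entries is the linear form \<open>\<Sum>l. gap l x * \<sigma>(e\<^sub>l)\<close>, and \<open>\<sigma>(e\<^sub>l)\<close> is the
  level sum. A hyperplane section of a simplicial cone has as extreme rays the rays on which the form
  vanishes together with one combination for each pair of rays of opposite signs
  (\<open>card_extreme_rays_slice\<close>); this gives \<open>\<ell>\<^sub>+ \<ell>\<^sub>- + \<ell>\<^sub>0\<close>. A simplicial section must have \<open>n - 1\<close> extreme
  rays, and \<open>\<ell>\<^sub>+ \<ell>\<^sub>- + \<ell>\<^sub>0 = \<ell>\<^sub>+ + \<ell>\<^sub>- + \<ell>\<^sub>0 - 1\<close> factors as \<open>(\<ell>\<^sub>+ - 1) (\<ell>\<^sub>- - 1) = 0\<close>; conversely, if only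
  one ray has one of the two signs, the combinations and the rays on which the
  form vanishes are linearly independent (\<open>simplicial_slice_iff\<close>).
  For the rays \<open>v(p, q)\<close> with \<open>p < q\<close>, the point is that no weight takes opposite strict signs on
  \<open>v(p)\<close> and \<open>v(q)\<close>, so a positive combination lies in a chamber only if both vectors do (\<open>vvec_split\<close>).

  For \<open>n \<ge> 3\<close> the regular points of the special linear geometry are the points of the Weyl
  chamber with distinct nonzero absolute values; they fall into disjoint convex open cells, one for each sign sequence that has both a
  positive and a negative level, and the chambers are the closures of these cells
  (\<open>sl_chambers_eq\<close>). Counting simplicial chambers is thus counting \<open>\<plusminus>1\<close> walks of length \<open>n\<close> that are
  positive at exactly one time, or negative at exactly one time. The walks that are positive at exactly
  one time turn out to be as many as the walks of length \<open>n - 1\<close> that are never positive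
  (\<open>single_pos_walks_eq\<close>), and there are \<open>binomial (n - 1) \<lfloor>(n - 1) / 2\<rfloor>\<close> of the latter
  (\<open>nonpos_walks_central\<close>). Both conditions hold at once only for two walks each when \<open>n = 3\<close> and
  \<open>n = 4\<close>. Finally, the power series with coefficients \<open>binomial n (n / 2)\<close> for even \<open>n\<close> is the inverse of
  \<open>sqrt (1 - 4x\<^sup>2)\<close> because of a first-order differential equation, which gives the generating function.
\<close>

section \<open>Rays and faces\<close>

lemma ray_self: "v \<in> ray v"
  unfolding ray_def by (rule CollectI, rule exI[of _ 1]) simp

lemma ray_scaleR: assumes "c > 0" shows "ray (c *\<^sub>R v) = ray v"
proof -
  have "t *\<^sub>R v = (t / c) *\<^sub>R (c *\<^sub>R v)" for t using assms by simp
  moreover have "t / c \<ge> 0 \<longleftrightarrow> t \<ge> 0" for t using assms by (simp add: zero_le_divide_iff)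
  ultimately show ?thesis unfolding ray_def using assms
    by (smt (verit) Collect_cong mult_nonneg_nonneg scaleR_scaleR)
qed

lemma ray_subset_conic: "conic K \<Longrightarrow> ray v \<subseteq> K \<longleftrightarrow> v \<in> K"
  using ray_self by (auto simp: ray_def conic_def)

lemma convex_ray: "convex (ray v)"
proof -
  have "ray v = (\<lambda>t. t *\<^sub>R v) ` {0..}" by (auto simp: ray_def)
  moreover have "linear (\<lambda>t. t *\<^sub>R v)" by (simp add: linear_scaleR_left)
  ultimately show ?thesis by (simp add: convex_linear_image)
qed

text \<open>
  Both \<open>v - \<epsilon> u\<close> and \<open>v + \<epsilon> u\<close> lie in the cone and \<open>v\<close> is their midpoint, so a face containing \<open>v\<close>
  contains them and hence the direction \<open>u\<close>. This is how an extreme ray is identified: one extracts from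
  \<open>v\<close> a small multiple of a candidate generator.
\<close>
lemma ray_face_eq:
  assumes face: "ray v face_of K" and "v \<noteq> 0"
    and pointed: "\<And>x. x \<in> K \<Longrightarrow> - x \<in> K \<Longrightarrow> x = 0"
    and conic: "convex_cone K"
    and u: "u \<in> K" "u \<noteq> 0" and eps: "\<epsilon> > 0" "v - \<epsilon> *\<^sub>R u \<in> K"
  shows "ray u = ray v"
proof -
  have vK: "v \<in> K" using face ray_self unfolding face_of_def by blast
  have plus: "v + \<epsilon> *\<^sub>R u \<in> K"
    using conic vK u eps by (simp add: convex_cone_add convex_cone_scaleR)
  have ne: "v - \<epsilon> *\<^sub>R u \<noteq> v + \<epsilon> *\<^sub>R u"
  proof
    assume "v - \<epsilon> *\<^sub>R u = v + \<epsilon> *\<^sub>R u"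
    then have "2 *\<^sub>R (\<epsilon> *\<^sub>R u) = 0" by (simp add: scaleR_2 algebra_simps)
    then show False using eps u by simp
  qed
  have "v = (1 - 1/2) *\<^sub>R (v - \<epsilon> *\<^sub>R u) + (1/2) *\<^sub>R (v + \<epsilon> *\<^sub>R u)"
    by (simp add: algebra_simps flip: scaleR_add_left)
  then have "v \<in> open_segment (v - \<epsilon> *\<^sub>R u) (v + \<epsilon> *\<^sub>R u)"
    unfolding in_segment using ne by (intro conjI exI[of _ "1/2"]) auto
  then have "v + \<epsilon> *\<^sub>R u \<in> ray v"
    using face plus eps(2) ray_self unfolding face_of_def by blast
  then obtain c where c: "v + \<epsilon> *\<^sub>R u = c *\<^sub>R v" by (auto simp: ray_def)
  then have "\<epsilon> *\<^sub>R u = (c - 1) *\<^sub>R v" by (simp add: algebra_simps)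
  then have "(1 / \<epsilon>) *\<^sub>R (\<epsilon> *\<^sub>R u) = (1 / \<epsilon>) *\<^sub>R ((c - 1) *\<^sub>R v)" by simp
  then have ud: "u = ((c - 1) / \<epsilon>) *\<^sub>R v" using eps by simp
  define d where "d = (c - 1) / \<epsilon>"
  have u_eq: "u = d *\<^sub>R v" using ud d_def by simp
  have "d > 0"
  proof (rule ccontr)
    assume "\<not> d > 0"
    then have "- u \<in> K" using vK conic u_eq convex_cone_scaleR[OF conic, of "- d" v] by simp
    then show False using pointed u by blast
  qed
  then show ?thesis using u_eq ray_scaleR by simp
qed

section \<open>Hyperplane sections of simplicial cones\<close>

text \<open>
  A simplicial cone is handled through the coordinates \<open>T\<close> dual to its generators \<open>e\<close>. The space \<open>V\<close> is
  a parameter because the ambient type is infinite-dimensional, and because hyperplane sections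
  and the spans of independent sets are treated as further instances.
\<close>
locale simplicial_cone =
  fixes V :: "vec0 set" and I :: "'i set" and e :: "'i \<Rightarrow> vec0" and T :: "'i \<Rightarrow> vec0 \<Rightarrow> real"
  assumes finI: "finite I" and subV: "subspace V"
    and linT: "\<And>i. i \<in> I \<Longrightarrow> linear (T i)"
    and eV: "\<And>i. i \<in> I \<Longrightarrow> e i \<in> V"
    and dual: "\<And>i j. i \<in> I \<Longrightarrow> j \<in> I \<Longrightarrow> T i (e j) = of_bool (i = j)"
    and expand: "\<And>x. x \<in> V \<Longrightarrow> x = (\<Sum>i\<in>I. T i x *\<^sub>R e i)"
begin

definition orthant :: "vec0 set" where "orthant = {x \<in> V. \<forall>i\<in>I. T i x \<ge> 0}"

definition supp :: "vec0 \<Rightarrow> 'i set" where "supp x = {i \<in> I. T i x \<noteq> 0}"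

lemma T_lin:
  assumes "i \<in> I"
  shows "T i (x + y) = T i x + T i y" "T i (x - y) = T i x - T i y"
    "T i (c *\<^sub>R x) = c * T i x" "T i 0 = 0" "T i (- x) = - T i x"
  using linT[OF assms] by (simp_all add: linear_add linear_diff linear_scale linear_0 linear_neg)

lemma eqI_T:
  assumes "x \<in> V" "y \<in> V" "\<And>i. i \<in> I \<Longrightarrow> T i x = T i y" shows "x = y"
proof -
  have "x = (\<Sum>i\<in>I. T i x *\<^sub>R e i)" by (rule expand) fact
  also have "\<dots> = (\<Sum>i\<in>I. T i y *\<^sub>R e i)" using assms by (intro sum.cong) auto
  also have "\<dots> = y" by (rule expand[symmetric]) fact
  finally show ?thesis .
qed

lemma convex_cone_orthant: "convex_cone orthant"
  unfolding orthant_def convex_cone_iff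
  using subV by (auto simp: T_lin subspace_def)

lemma e_in_orthant: "i \<in> I \<Longrightarrow> e i \<in> orthant"
  by (auto simp: orthant_def eV dual)

lemma sum_in_cone:
  assumes "convex_cone K" "finite A" "\<And>i. i \<in> A \<Longrightarrow> c i \<ge> 0 \<and> b i \<in> K"
  shows "(\<Sum>i\<in>A. c i *\<^sub>R b i) \<in> K"
  using assms(2,3)
proof (induction A)
  case empty
  then show ?case using assms(1) by (simp add: convex_cone_contains_0)
next
  case (insert x F)
  then show ?case using assms(1) by (simp add: convex_cone_add convex_cone_scaleR)
qed

lemma orthant_eq_hull: "orthant = convex_cone hull (e ` I)"
proof (rule antisym)
  show "orthant \<subseteq> convex_cone hull (e ` I)"
  proof
    fix x assume x: "x \<in> orthant"
    then have "x = (\<Sum>i\<in>I. T i x *\<^sub>R e i)" using expand orthant_def by blast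
    also have "\<dots> \<in> convex_cone hull (e ` I)"
      using x finI convex_cone_convex_cone_hull by (intro sum_in_cone) (auto simp: orthant_def hull_inc)
    finally show "x \<in> convex_cone hull (e ` I)" .
  qed
  show "convex_cone hull (e ` I) \<subseteq> orthant"
    using convex_cone_orthant e_in_orthant by (intro hull_minimal) auto
qed

lemma inj_on_e: "inj_on e I"
  by (rule inj_onI) (metis dual of_bool_eq_iff)

lemma independent_e: "independent (e ` I)"
proof (rule independent_if_scalars_zero)
  show "finite (e ` I)" using finI by simp
  fix f x assume 0: "(\<Sum>x\<in>e ` I. f x *\<^sub>R x) = 0" and "x \<in> e ` I"
  then obtain i where i: "i \<in> I" "x = e i" by auto
  have "0 = T i (\<Sum>x\<in>e ` I. f x *\<^sub>R x)" using 0 i T_lin by simp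
  also have "\<dots> = T i (\<Sum>j\<in>I. f (e j) *\<^sub>R e j)" using inj_on_e by (simp add: sum.reindex)
  also have "\<dots> = (\<Sum>j\<in>I. f (e j) * T i (e j))"
    using i by (simp add: linear_sum[OF linT] T_lin)
  also have "\<dots> = (\<Sum>j\<in>I. if j = i then f (e j) else 0)"
    using i by (intro sum.cong) (auto simp: dual)
  also have "\<dots> = f x" using i finI by simp
  finally show "f x = 0" by simp
qed

lemma simplicial_orthant: "card I = n - 1 \<Longrightarrow> simplicial n orthant"
  unfolding simplicial_def
  using finI inj_on_e independent_e orthant_eq_hull by (intro exI[of _ "e ` I"]) (simp add: card_image)

definition slice :: "(vec0 \<Rightarrow> real) \<Rightarrow> vec0 set" where
  "slice \<phi> = {x \<in> orthant. \<phi> x = 0}"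

lemma convex_cone_slice: assumes "linear \<phi>" shows "convex_cone (slice \<phi>)"
  using convex_cone_orthant assms
  unfolding slice_def convex_cone_iff
  by (auto simp: linear_add linear_scale linear_0)

lemma slice_pointed: "x \<in> slice \<phi> \<Longrightarrow> - x \<in> slice \<phi> \<Longrightarrow> x = 0"
  using subV by (intro eqI_T) (force simp: slice_def orthant_def T_lin subspace_0)+

lemma linear_on_V:
  assumes "linear \<phi>" "x \<in> V" shows "\<phi> x = (\<Sum>i\<in>I. T i x * \<phi> (e i))"
proof -
  have "\<phi> x = \<phi> (\<Sum>i\<in>I. T i x *\<^sub>R e i)" using expand[OF assms(2)] by simp
  then show ?thesis using assms(1) by (simp add: linear_sum linear_scale)
qed

text \<open>
  If \<open>x\<close> is a strict convex combination of \<open>a\<close> and \<open>b\<close> in the cone, a coordinate that vanishes at \<open>x\<close>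
  vanishes at \<open>a\<close> and \<open>b\<close>. So a vector generates a face as soon as it is determined up to scaling by
  its support.
\<close>
lemma slice_face:
  assumes "linear \<phi>" "v \<in> slice \<phi>"
    and "\<And>w. w \<in> slice \<phi> \<Longrightarrow> supp w \<subseteq> supp v \<Longrightarrow> w \<in> ray v"
  shows "ray v face_of slice \<phi>"
  unfolding face_of_def
proof (intro conjI ballI impI)
  have conic: "conic (slice \<phi>)" using convex_cone_slice[OF assms(1)] by (simp add: convex_cone_def)
  then show "ray v \<subseteq> slice \<phi>" using assms(2) by (simp add: ray_subset_conic)
  show "convex (ray v)" by (rule convex_ray)
  fix a b x assume a: "a \<in> slice \<phi>" and b: "b \<in> slice \<phi>" and x: "x \<in> ray v"
    and seg: "x \<in> open_segment a b"
  obtain u where u: "0 < u" "u < 1" "x = (1 - u) *\<^sub>R a + u *\<^sub>R b"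
    using seg by (auto simp: in_segment)
  obtain t where t: "x = t *\<^sub>R v" using x by (auto simp: ray_def)
  have "T i a = 0 \<and> T i b = 0" if "i \<in> I" "T i v = 0" for i
  proof -
    have "(1 - u) * T i a + u * T i b = 0"
      using u(3) t that by (metis T_lin(1,3) mult_zero_right)
    moreover have "(1 - u) * T i a \<ge> 0" "u * T i b \<ge> 0"
      using a b u that by (auto simp: slice_def orthant_def)
    ultimately have "(1 - u) * T i a = 0" "u * T i b = 0" by linarith+
    then show ?thesis using u by simp
  qed
  then have "supp a \<subseteq> supp v" "supp b \<subseteq> supp v" by (auto simp: supp_def)
  then show "a \<in> ray v" "b \<in> ray v" using assms(3) a b by auto
qed

text \<open>
  A generator of the ray in which the hyperplane \<open>\<phi> = 0\<close> meets the two-dimensional face spanned by \<open>e i\<close> and \<open>e j\<close>,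
  provided that \<open>\<phi>\<close> has opposite signs on these generators.
\<close>
definition edge :: "(vec0 \<Rightarrow> real) \<Rightarrow> 'i \<Rightarrow> 'i \<Rightarrow> vec0" where
  "edge \<phi> i j = \<bar>\<phi> (e j)\<bar> *\<^sub>R e i + \<bar>\<phi> (e i)\<bar> *\<^sub>R e j"

lemma T_edge:
  assumes "i \<in> I" "j \<in> I" "k \<in> I"
  shows "T k (edge \<phi> i j) = \<bar>\<phi> (e j)\<bar> * of_bool (k = i) + \<bar>\<phi> (e i)\<bar> * of_bool (k = j)"
  using assms by (simp add: edge_def T_lin dual)

lemma edge_in_slice:
  assumes "linear \<phi>" "i \<in> I" "j \<in> I" "\<phi> (e i) > 0" "\<phi> (e j) < 0"
  shows "edge \<phi> i j \<in> slice \<phi>"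
proof -
  have "edge \<phi> i j \<in> V"
    unfolding edge_def using assms subV eV by (intro subspace_add subspace_scale)
  moreover have "\<phi> (edge \<phi> i j) = 0" using assms
    by (simp only: edge_def linear_add linear_scale) (simp add: algebra_simps)
  ultimately show ?thesis using assms by (simp add: slice_def orthant_def T_edge)
qed

lemma supp_e: "i \<in> I \<Longrightarrow> supp (e i) = {i}"
  by (auto simp: supp_def dual)

lemma supp_edge: "i \<in> I \<Longrightarrow> j \<in> I \<Longrightarrow> \<phi> (e i) > 0 \<Longrightarrow> \<phi> (e j) < 0 \<Longrightarrow> supp (edge \<phi> i j) = {i, j}"
  by (cases "i = j") (auto simp: supp_def T_edge)

lemma supp_ray: assumes "ray u = ray v" shows "supp u = supp v"
proof -
  have "supp x \<subseteq> supp y" if "x \<in> ray y" for x y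
    using that by (auto simp: ray_def supp_def T_lin)
  then show ?thesis using assms ray_self by blast
qed

lemma supp_0: "supp 0 = {}"
  by (auto simp: supp_def T_lin)

lemma extreme_ray_e:
  assumes "linear \<phi>" "i \<in> I" "\<phi> (e i) = 0"
  shows "extreme_ray (ray (e i)) (slice \<phi>)"
  unfolding extreme_ray_def
proof (intro conjI exI[of _ "e i"] refl)
  show "e i \<noteq> 0" using supp_e[OF assms(2)] supp_0 by force
  show "ray (e i) face_of slice \<phi>"
  proof (rule slice_face)
    fix w assume w: "w \<in> slice \<phi>" "supp w \<subseteq> supp (e i)"
    have "w = T i w *\<^sub>R e i"
      using w assms(2) eV subV
      by (intro eqI_T) (auto simp: slice_def orthant_def T_lin dual supp_e supp_def subspace_scale)
    then show "w \<in> ray (e i)" using w assms(2) by (auto simp: ray_def slice_def orthant_def)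
  qed (use assms e_in_orthant in \<open>auto simp: slice_def\<close>)
qed

lemma extreme_ray_edge:
  assumes "linear \<phi>" "i \<in> I" "j \<in> I" "\<phi> (e i) > 0" "\<phi> (e j) < 0"
  shows "extreme_ray (ray (edge \<phi> i j)) (slice \<phi>)"
  unfolding extreme_ray_def
proof (intro conjI exI[of _ "edge \<phi> i j"] refl)
  show "edge \<phi> i j \<noteq> 0" using supp_edge[of i j \<phi>] assms supp_0 by force
  show "ray (edge \<phi> i j) face_of slice \<phi>"
  proof (rule slice_face)
    fix w assume w: "w \<in> slice \<phi>" "supp w \<subseteq> supp (edge \<phi> i j)"
    have wV: "w \<in> V" and w0: "\<phi> w = 0" using w by (auto simp: slice_def orthant_def)
    have z: "T k w = 0" if "k \<in> I" "k \<noteq> i" "k \<noteq> j" for k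
      using w(2) that supp_edge[of i j \<phi>] assms by (auto simp: supp_def)
    have ij: "i \<noteq> j" using assms by auto
    have "0 = (\<Sum>k\<in>I. T k w * \<phi> (e k))" using linear_on_V[OF assms(1) wV] w0 by simp
    also have "\<dots> = (\<Sum>k\<in>{i, j}. T k w * \<phi> (e k))"
      using assms finI z by (intro sum.mono_neutral_right) auto
    also have "\<dots> = T i w * \<phi> (e i) + T j w * \<phi> (e j)" using ij by simp
    finally have bal: "T i w * \<phi> (e i) = T j w * - \<phi> (e j)" by simp
    have "w = (T j w / \<phi> (e i)) *\<^sub>R edge \<phi> i j"
    proof (rule eqI_T)
      show "(T j w / \<phi> (e i)) *\<^sub>R edge \<phi> i j \<in> V"
        using assms edge_in_slice subV by (simp add: slice_def orthant_def subspace_scale)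
      fix k assume "k \<in> I"
      then show "T k w = T k ((T j w / \<phi> (e i)) *\<^sub>R edge \<phi> i j)"
        using assms z bal ij by (cases "k = i"; cases "k = j") (auto simp: T_lin T_edge field_simps)
    qed fact
    moreover have "T j w / \<phi> (e i) \<ge> 0" using w assms by (simp add: slice_def orthant_def)
    ultimately show "w \<in> ray (edge \<phi> i j)" unfolding ray_def by blast
  qed (use assms edge_in_slice in auto)
qed

text \<open>
  Let \<open>v\<close> generate an extreme ray. If its support contains a generator on which \<open>\<phi>\<close> vanishes, a multiple of
  that generator can be subtracted from \<open>v\<close> inside the section. Otherwise \<open>\<phi> v = 0\<close> forces the support to
  contain generators of both signs, and a multiple of their combination can be subtracted.
\<close>
lemma extreme_ray_slice_cases:
  assumes "linear \<phi>" "extreme_ray F (slice \<phi>)"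
  shows "(\<exists>i\<in>I. \<phi> (e i) = 0 \<and> F = ray (e i)) \<or>
    (\<exists>i\<in>I. \<exists>j\<in>I. \<phi> (e i) > 0 \<and> \<phi> (e j) < 0 \<and> F = ray (edge \<phi> i j))"
proof -
  obtain v where v: "v \<noteq> 0" "F = ray v" "ray v face_of slice \<phi>"
    using assms(2) by (auto simp: extreme_ray_def)
  have vK: "v \<in> slice \<phi>" using v(3) ray_self unfolding face_of_def by blast
  then have vV: "v \<in> V" and v0: "\<phi> v = 0" and vpos: "\<And>i. i \<in> I \<Longrightarrow> T i v \<ge> 0"
    by (auto simp: slice_def orthant_def)
  have eq: "ray u = F" if "u \<in> slice \<phi>" "u \<noteq> 0" "\<epsilon> > 0" "\<And>i. i \<in> I \<Longrightarrow> T i v \<ge> \<epsilon> * T i u" for u \<epsilon>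
  proof -
    have "v - \<epsilon> *\<^sub>R u \<in> slice \<phi>"
      using that vK assms(1) subV
      by (auto simp: slice_def orthant_def T_lin linear_diff linear_scale subspace_diff subspace_scale)
    then show ?thesis
      using ray_face_eq[OF v(3) v(1) _ convex_cone_slice[OF assms(1)] that(1,2,3)] slice_pointed v(2)
      by blast
  qed
  show ?thesis
  proof (cases "\<exists>i\<in>I. \<phi> (e i) = 0 \<and> T i v > 0")
    case True
    then obtain i where i: "i \<in> I" "\<phi> (e i) = 0" "T i v > 0" by blast
    have "ray (e i) = F"
      using i vpos e_in_orthant supp_e[OF i(1)] supp_0
      by (intro eq[of _ "T i v"]) (auto simp: slice_def dual)
    then show ?thesis using i by blast
  next
    case False
    have nonzero: "T i v > 0 \<Longrightarrow> \<phi> (e i) \<noteq> 0" if "i \<in> I" for i using False that by blast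
    obtain m where m: "m \<in> I" "T m v > 0"
      using eqI_T[OF vV, of 0] v(1) subV vpos by (metis T_lin(4) order_le_less subspace_0)
    have sum0: "(\<Sum>i\<in>I. T i v * \<phi> (e i)) = 0" using linear_on_V[OF assms(1) vV] v0 by simp
    have "\<exists>i\<in>I. T i v > 0 \<and> \<phi> (e i) > 0"
    proof (rule ccontr)
      assume c: "\<not> ?thesis"
      then have le: "\<forall>i\<in>I. T i v * \<phi> (e i) \<le> 0"
        using vpos by (metis linorder_not_le mult_nonneg_nonpos order_le_less mult_zero_left)
      have "\<phi> (e m) < 0" using c m nonzero by force
      then have "T m v * \<phi> (e m) < 0" using m by (simp add: mult_pos_neg)
      then have "(\<Sum>i\<in>I. T i v * \<phi> (e i)) < (\<Sum>i\<in>I. 0)"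
        using le m(1) finI \<open>T m v * \<phi> (e m) < 0\<close> by (intro sum_strict_mono_ex1) blast+
      then show False using sum0 by simp
    qed
    then obtain i where i: "i \<in> I" "T i v > 0" "\<phi> (e i) > 0" by blast
    have "\<exists>j\<in>I. T j v > 0 \<and> \<phi> (e j) < 0"
    proof (rule ccontr)
      assume c: "\<not> ?thesis"
      then have le: "\<forall>i\<in>I. 0 \<le> T i v * \<phi> (e i)"
        using vpos by (metis linorder_not_le mult_nonneg_nonneg order_le_less mult_zero_left)
      have "T i v * \<phi> (e i) > 0" using i by simp
      then have "(\<Sum>i\<in>I. 0) < (\<Sum>i\<in>I. T i v * \<phi> (e i))"
        using le i(1) finI \<open>T i v * \<phi> (e i) > 0\<close> by (intro sum_strict_mono_ex1) blast+
      then show False using sum0 by simp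
    qed
    then obtain j where j: "j \<in> I" "T j v > 0" "\<phi> (e j) < 0" by blast
    \<comment> \<open>The largest multiple of the combination whose coordinates do not exceed those of \<open>v\<close>.\<close>
    define \<epsilon> where "\<epsilon> = min (T i v / - \<phi> (e j)) (T j v / \<phi> (e i))"
    have eps: "\<epsilon> > 0" "\<epsilon> * - \<phi> (e j) \<le> T i v" "\<epsilon> * \<phi> (e i) \<le> T j v"
      using i j by (auto simp: \<epsilon>_def min_def field_simps)
    have "ray (edge \<phi> i j) = F"
    proof (rule eq)
      show "edge \<phi> i j \<in> slice \<phi>" using edge_in_slice assms i j by blast
      show "edge \<phi> i j \<noteq> 0" using supp_edge[of i j \<phi>] supp_0 i j by force
      fix k assume "k \<in> I"
      then show "T k v \<ge> \<epsilon> * T k (edge \<phi> i j)"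
        using eps i j vpos by (cases "k = i"; cases "k = j") (auto simp: T_edge)
    qed (rule eps)
    then show ?thesis using i j by blast
  qed
qed

text \<open>
  The rays in question are pairwise distinct because their generators have distinct supports.
\<close>
lemma card_extreme_rays_slice:
  assumes "linear \<phi>"
  shows "card {F. extreme_ray F (slice \<phi>)} =
    card {i \<in> I. \<phi> (e i) > 0} * card {i \<in> I. \<phi> (e i) < 0} + card {i \<in> I. \<phi> (e i) = 0}"
proof -
  let ?P = "{i \<in> I. \<phi> (e i) > 0}" and ?N = "{i \<in> I. \<phi> (e i) < 0}" and ?Z = "{i \<in> I. \<phi> (e i) = 0}"
  let ?A = "(\<lambda>i. ray (e i)) ` ?Z" and ?B = "(\<lambda>(i, j). ray (edge \<phi> i j)) ` (?P \<times> ?N)"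
  have "{F. extreme_ray F (slice \<phi>)} = ?A \<union> ?B"
  proof (intro equalityI subsetI)
    fix F assume "F \<in> {F. extreme_ray F (slice \<phi>)}"
    then show "F \<in> ?A \<union> ?B" using extreme_ray_slice_cases[OF assms, of F] by force
  qed (use extreme_ray_e[OF assms] extreme_ray_edge[OF assms] in auto)
  moreover have "?A \<inter> ?B = {}"
  proof (rule ccontr)
    assume "?A \<inter> ?B \<noteq> {}"
    then obtain i j k where h: "i \<in> ?Z" "j \<in> ?P" "k \<in> ?N" "ray (e i) = ray (edge \<phi> j k)" by auto
    then have "{i} = {j, k}" using supp_ray[OF h(4)] by (simp add: supp_e supp_edge)
    then show False using h by auto
  qed
  moreover have "inj_on (\<lambda>i. ray (e i)) ?Z"
  proof (rule inj_onI)
    fix i j assume h: "i \<in> ?Z" "j \<in> ?Z" "ray (e i) = ray (e j)"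
    then show "i = j" using supp_ray[OF h(3)] by (simp add: supp_e)
  qed
  moreover have "inj_on (\<lambda>(i, j). ray (edge \<phi> i j)) (?P \<times> ?N)"
  proof (rule inj_onI, clarify)
    fix i j i' j' assume h: "i \<in> I" "\<phi> (e i) > 0" "j \<in> I" "\<phi> (e j) < 0"
      "i' \<in> I" "\<phi> (e i') > 0" "j' \<in> I" "\<phi> (e j') < 0" and r: "ray (edge \<phi> i j) = ray (edge \<phi> i' j')"
    then have "{i, j} = {i', j'}" using supp_ray[OF r] by (simp add: supp_edge)
    then show "i = i' \<and> j = j'" using h by (auto simp: doubleton_eq_iff)
  qed
  ultimately show ?thesis using finI
    by (simp add: card_Un_disjoint card_image card_cartesian_product)
qed

text \<open>
  If \<open>p\<close> is the only generator on which \<open>\<phi>\<close> is positive, the equation \<open>\<phi> x = 0\<close> expresses the coordinate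
  \<open>T p\<close> as a non-negative combination of the others. These remaining coordinates, rescaled, are dual to the
  extreme rays of the section, which is therefore a simplicial cone in the hyperplane.
\<close>
lemma simplicial_slice:
  assumes "linear \<phi>" "p \<in> I" "{i \<in> I. \<phi> (e i) > 0} = {p}" "card I = n"
  shows "simplicial n (slice \<phi>)"
proof -
  define b where "b i = (if \<phi> (e i) = 0 then e i else edge \<phi> p i)" for i
  define T' where "T' i x = (if \<phi> (e i) = 0 then T i x else T i x / \<phi> (e p))" for i x
  define V' where "V' = {x \<in> V. \<phi> x = 0}"
  have pp: "\<phi> (e p) > 0" using assms by auto
  have neg: "\<phi> (e i) < 0" if "i \<in> I" "i \<noteq> p" "\<phi> (e i) \<noteq> 0" for i
    using assms(3) that by (metis (mono_tags, lifting) linorder_neqE mem_Collect_eq singletonD)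
  have bV: "b i \<in> V'" if "i \<in> I" "i \<noteq> p" for i
    using edge_in_slice[OF assms(1,2) that(1) pp] neg[OF that] that eV
    by (auto simp: b_def V'_def slice_def orthant_def)
  \<comment> \<open>The equation of the hyperplane, solved for the coordinate at \<open>p\<close>.\<close>
  have balance: "T p x = (\<Sum>i\<in>I - {p}. T' i x * - \<phi> (e i))" if "x \<in> V'" for x
  proof -
    have "0 = (\<Sum>i\<in>I. T i x * \<phi> (e i))" using that linear_on_V[OF assms(1)] by (auto simp: V'_def)
    also have "\<dots> = T p x * \<phi> (e p) + (\<Sum>i\<in>I - {p}. T i x * \<phi> (e i))"
      using assms(2) finI by (simp add: sum.remove)
    finally have "T p x * \<phi> (e p) = (\<Sum>i\<in>I - {p}. T i x * - \<phi> (e i))"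
      by (simp add: sum_negf)
    then have "T p x = (\<Sum>i\<in>I - {p}. T i x * - \<phi> (e i)) / \<phi> (e p)"
      using pp by (simp add: field_simps)
    also have "\<dots> = (\<Sum>i\<in>I - {p}. T' i x * - \<phi> (e i))"
      unfolding sum_divide_distrib using pp by (intro sum.cong) (auto simp: T'_def)
    finally show ?thesis .
  qed
  interpret S: simplicial_cone V' "I - {p}" b T'
  proof (rule simplicial_cone.intro)
    show "finite (I - {p})" using finI by simp
    show subV': "subspace V'" using subV assms(1)
      by (auto simp: V'_def subspace_def linear_add linear_scale linear_0)
    fix i assume i: "i \<in> I - {p}"
    have "T' i (x + y) = T' i x + T' i y" "T' i (c *\<^sub>R x) = c *\<^sub>R T' i x" for x y c
      using i by (auto simp: T'_def T_lin add_divide_distrib)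
    then show "linear (T' i)" by (intro linearI)
    show "b i \<in> V'" using bV i by auto
    show "T' i (b j) = of_bool (i = j)" if "j \<in> I - {p}" for j
      using i that pp assms(2) neg[of j] by (auto simp: T'_def b_def T_edge dual)
  next
    fix x assume x: "x \<in> V'"
    show "x = (\<Sum>i\<in>I - {p}. T' i x *\<^sub>R b i)"
    proof (rule eqI_T)
      show "x \<in> V" using x by (simp add: V'_def)
      show "(\<Sum>i\<in>I - {p}. T' i x *\<^sub>R b i) \<in> V"
        using bV subV by (intro subspace_sum subspace_scale) (auto simp: V'_def)
      fix k assume k: "k \<in> I"
      have Tk: "T k (\<Sum>i\<in>I - {p}. T' i x *\<^sub>R b i) = (\<Sum>i\<in>I - {p}. T' i x * T k (b i))"
        using k by (simp add: linear_sum[OF linT] T_lin)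
      show "T k x = T k (\<Sum>i\<in>I - {p}. T' i x *\<^sub>R b i)"
      proof (cases "k = p")
        case True
        have "T' i x * - \<phi> (e i) = T' i x * T p (b i)" if "i \<in> I - {p}" for i
          using that assms(2) neg[of i] by (auto simp: b_def T_edge dual)
        then have "(\<Sum>i\<in>I - {p}. T' i x * - \<phi> (e i)) = (\<Sum>i\<in>I - {p}. T' i x * T p (b i))"
          by (intro sum.cong) auto
        then show ?thesis using Tk True balance[OF x] by metis
      next
        case False
        have "T' i x * T k (b i) = (if i = k then T k x else 0)" if "i \<in> I - {p}" for i
          using that k False assms(2) pp by (auto simp: b_def T'_def T_edge dual)
        then have "(\<Sum>i\<in>I - {p}. T' i x * T k (b i)) = (\<Sum>i\<in>I - {p}. if i = k then T k x else 0)"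
          by (intro sum.cong) auto
        also have "\<dots> = T k x" using False k finI by simp
        finally show ?thesis using Tk by simp
      qed
    qed
  qed
  have "slice \<phi> = S.orthant"
  proof (intro set_eqI iffI)
    fix x assume "x \<in> slice \<phi>"
    then show "x \<in> S.orthant" using pp
      unfolding S.orthant_def by (auto simp: slice_def orthant_def V'_def T'_def)
  next
    fix x assume x: "x \<in> S.orthant"
    then have xV: "x \<in> V'" and x0: "\<And>i. i \<in> I - {p} \<Longrightarrow> T' i x \<ge> 0"
      unfolding S.orthant_def by blast+
    have "T' i x * - \<phi> (e i) \<ge> 0" if "i \<in> I - {p}" for i
      using x0[OF that] neg[of i] that by (cases "\<phi> (e i) = 0") (auto simp: mult_le_0_iff)
    then have "T p x \<ge> 0" unfolding balance[OF xV] by (intro sum_nonneg)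
    moreover have "T i x \<ge> 0" if "i \<in> I" "i \<noteq> p" for i
      using x0[of i] that pp by (auto simp: T'_def zero_le_divide_iff split: if_splits)
    ultimately show "x \<in> slice \<phi>" using xV by (auto simp: slice_def orthant_def V'_def)
  qed
  then show ?thesis using S.simplicial_orthant assms(2,4) by simp
qed

end

text \<open>
  The cone spanned by an independent set is its own section by the zero form, so the count of extreme rays
  of a section applies.
\<close>
lemma card_extreme_rays_simplicial:
  assumes "simplicial n K" shows "card {F. extreme_ray F K} = n - 1"
proof -
  obtain B where B: "finite B" "card B = n - 1" "independent B" "K = convex_cone hull B"
    using assms by (auto simp: simplicial_def)
  have "\<exists>g :: vec0 \<Rightarrow> real. linear g \<and> (\<forall>x\<in>B. g x = of_bool (b = x))" for b
    using linear_independent_extend[OF B(3)] .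
  then obtain T :: "vec0 \<Rightarrow> vec0 \<Rightarrow> real"
    where T: "\<And>b. linear (T b)" "\<And>b x. x \<in> B \<Longrightarrow> T b x = of_bool (b = x)"
    by metis
  interpret simplicial_cone "span B" B id T
  proof (rule simplicial_cone.intro)
    fix x assume "x \<in> span B"
    then obtain f where x: "x = (\<Sum>b\<in>B. f b *\<^sub>R b)"
      using span_finite[OF B(1)] by auto
    have "T c x = f c" if "c \<in> B" for c
    proof -
      have "T c x = (\<Sum>b\<in>B. f b * T c b)" unfolding x by (simp add: linear_sum[OF T(1)] linear_scale[OF T(1)])
      also have "\<dots> = (\<Sum>b\<in>B. if b = c then f c else 0)" using T(2) by (intro sum.cong) auto
      also have "\<dots> = f c" using that B(1) by simp
      finally show ?thesis .
    qed
    then show "x = (\<Sum>b\<in>B. T b x *\<^sub>R id b)" using x by (simp cong: sum.cong)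
  qed (use B T(2) in \<open>auto simp: span_base intro: T(1)\<close>)
  \<comment> \<open>For the zero form all generators are null, and there are no positive or negative ones.\<close>
  have "slice (\<lambda>x. 0) = K" using orthant_eq_hull B(4) by (simp add: slice_def)
  then show ?thesis using card_extreme_rays_slice[of "\<lambda>x. 0"] B(2) by (simp add: linear_zero)
qed

text \<open>
  A simplicial section has \<open>card I - 1\<close> extreme rays. With \<open>a + 1\<close> positive, \<open>b + 1\<close> negative and \<open>c\<close> null
  generators this reads \<open>(a + 1) (b + 1) + c = a + b + 1 + c\<close>, so that \<open>a b = 0\<close>.
\<close>
lemma (in simplicial_cone) simplicial_slice_iff:
  assumes "linear \<phi>" "i \<in> I" "\<phi> (e i) > 0" "j \<in> I" "\<phi> (e j) < 0"
  shows "simplicial (card I) (slice \<phi>) \<longleftrightarrow>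
    min (card {i \<in> I. \<phi> (e i) > 0}) (card {i \<in> I. \<phi> (e i) < 0}) = 1"
proof -
  let ?P = "{i \<in> I. \<phi> (e i) > 0}" and ?N = "{i \<in> I. \<phi> (e i) < 0}" and ?Z = "{i \<in> I. \<phi> (e i) = 0}"
  have fin: "finite ?P" "finite ?N" "finite ?Z" using finI by auto
  have "I = ?P \<union> ?N \<union> ?Z" by auto
  then have "card I = card (?P \<union> ?N \<union> ?Z)" by simp
  also have "\<dots> = card (?P \<union> ?N) + card ?Z" using fin by (intro card_Un_disjoint) auto
  also have "card (?P \<union> ?N) = card ?P + card ?N" using fin by (intro card_Un_disjoint) auto
  finally have cardI: "card I = card ?P + card ?N + card ?Z" .
  have pos: "card ?P > 0" "card ?N > 0" using fin assms by (auto simp: card_gt_0_iff)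
  show ?thesis
  proof
    assume "simplicial (card I) (slice \<phi>)"
    then have "card ?P * card ?N + card ?Z = card I - 1"
      using card_extreme_rays_simplicial card_extreme_rays_slice[OF assms(1)] by metis
    then have eq: "card ?P * card ?N + 1 = card ?P + card ?N" using cardI pos by linarith
    obtain a b where ab: "card ?P = Suc a" "card ?N = Suc b" using pos by (metis gr0_implies_Suc)
    have "a * b = 0" using eq unfolding ab by simp
    then show "min (card ?P) (card ?N) = 1" unfolding ab by auto
  next
    assume "min (card ?P) (card ?N) = 1"
    then consider "card ?P = 1" | "card ?N = 1" by (auto simp: min_def split: if_splits)
    then show "simplicial (card I) (slice \<phi>)"
    proof cases
      case 1
      then obtain p where "?P = {p}" by (auto simp: card_1_singleton_iff)
      then show ?thesis using simplicial_slice[OF assms(1), of p] by blast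
    next
      case 2
      then obtain p where p: "?N = {p}" by (auto simp: card_1_singleton_iff)
      \<comment> \<open>A form and its negative have the same zeros, which exchanges the two signs.\<close>
      have "slice (\<lambda>x. - \<phi> x) = slice \<phi>" by (simp add: slice_def)
      moreover have "linear (\<lambda>x. - \<phi> x)" using assms(1) by (simp add: linear_compose_neg)
      ultimately show ?thesis using simplicial_slice[of "\<lambda>x. - \<phi> x" p "card I"] p by auto
    qed
  qed
qed

section \<open>The chambers of the general linear geometry as simplicial cones\<close>

lemma coord_scaleR [simp]: "coord (c *\<^sub>R x) i = c * coord x i"
proof -
  have "finite {i. c *\<^sub>R coord x i \<noteq> 0}"
    by (rule finite_subset[OF _ finite_keys[of x]]) (auto simp: in_keys_iff)
  then show ?thesis by (simp add: scaleR_poly_mapping_def)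
qed

lemma coord_sum: "coord (\<Sum>a\<in>A. f a) i = (\<Sum>a\<in>A. coord (f a) i)"
  by (induction A rule: infinite_finite_induct) (simp_all add: lookup_add)

lemma linear_coord: "linear (\<lambda>x. coord x i)"
  by (rule linearI) (simp_all add: lookup_add)

lemma linear_sigv: "linear (sigv n)"
  unfolding sigv_def by (rule linearI) (simp_all add: lookup_add sum.distrib sum_distrib_left)

lemma hgl_iff: "x \<in> hgl n \<longleftrightarrow> (\<forall>i. i \<notin> {1..n} \<longrightarrow> coord x i = 0)"
  unfolding hgl_def by (auto simp: in_keys_iff subset_iff)

lemma subspace_hgl: "subspace (hgl n)"
  unfolding subspace_def by (simp add: hgl_iff lookup_add)

lemma coord_vvec:
  "coord (vvec n (a, b)) i = of_bool (1 \<le> i \<and> i \<le> a) - of_bool (n - b + 1 \<le> i \<and> i \<le> n)"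
  by (simp add: vvec_def lookup_minus coord_sum lookup_single when_def of_bool_def)

lemma vvec_in_hgl: "p \<in> Estar n \<Longrightarrow> vvec n p \<in> hgl n"
  unfolding hgl_iff Estar_def by (cases p) (auto simp: coord_vvec)

lemma sigv_vvec: assumes "p \<in> Estar n" shows "sigv n (vvec n p) = real_of_int (sig p)"
proof -
  obtain a b where p: "p = (a, b)" "a + b \<le> n" using assms by (auto simp: Estar_def)
  have "sigv n (vvec n p) =
      (\<Sum>i=1..n. of_bool (i \<le> a)) - (\<Sum>i=1..n. of_bool (n - b + 1 \<le> i))"
    unfolding sigv_def p coord_vvec sum_subtractf by (intro arg_cong2[of _ _ _ _ "(-)"] sum.cong) auto
  also have "(\<Sum>i=1..n. of_bool (i \<le> a)) = real a"
  proof -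
    have "{i \<in> {1..n}. i \<le> a} = {1..a}" using p by auto
    then show ?thesis by (simp add: of_bool_def sum.If_cases Int_def)
  qed
  also have "(\<Sum>i=1..n. of_bool (n - b + 1 \<le> i)) = real b"
  proof -
    have "{i \<in> {1..n}. n - b + 1 \<le> i} = {n - b + 1..n}" by auto
    then show ?thesis using p by (simp add: of_bool_def sum.If_cases Int_def)
  qed
  finally show ?thesis by (simp add: p sig_def)
qed

lemma vvec_in_Wgl: assumes "p \<in> Estar n" shows "vvec n p \<in> Wgl n"
proof -
  obtain a b where p: "p = (a, b)" "a + b \<le> n" using assms by (auto simp: Estar_def)
  have "coord (vvec n p) i \<ge> coord (vvec n p) (i + 1)" if "i \<in> {1..<n}" for i
    unfolding p(1) coord_vvec using that p(2) by auto
  then show ?thesis using vvec_in_hgl[OF assms] by (simp add: Wgl_def)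
qed

text \<open>
  The element \<open>a\<close> of \<open>S\<close> is the \<open>i\<close>-th largest one exactly when \<open>i\<close> elements of \<open>S\<close> are at least \<open>a\<close>; this
  replaces sorted lists by cardinalities.
\<close>
lemma ith_largest_eq:
  assumes "finite S" "a \<in> S" shows "ith_largest S (card (S \<inter> {a..})) = a"
proof -
  let ?L = "sorted_list_of_set S"
  have L: "sorted ?L" "distinct ?L" "set ?L = S" "length ?L = card S"
    using assms by auto
  obtain k where k: "k < card S" "?L ! k = a" using assms L by (metis in_set_conv_nth)
  have "S \<inter> {a..} = (\<lambda>i. ?L ! i) ` {k..<card S}"
  proof (intro set_eqI iffI)
    fix b assume b: "b \<in> S \<inter> {a..}"
    then obtain i where i: "i < card S" "?L ! i = b" using L by (metis IntD1 in_set_conv_nth)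
    have "k \<le> i"
    proof (rule ccontr)
      assume "\<not> k \<le> i"
      then have "b < a"
        using sorted_wrt_nth_less[OF strict_sorted_list_of_set[of S], of i k] i k L by simp
      then show False using b by simp
    qed
    then show "b \<in> (\<lambda>i. ?L ! i) ` {k..<card S}" using i by auto
  next
    fix b assume "b \<in> (\<lambda>i. ?L ! i) ` {k..<card S}"
    then obtain i where i: "k \<le> i" "i < card S" "b = ?L ! i" by auto
    then have "b \<in> S" using L by (metis nth_mem)
    moreover have "a \<le> b" using i k L by (metis sorted_nth_mono)
    ultimately show "b \<in> S \<inter> {a..}" by simp
  qed
  moreover have "inj_on (\<lambda>i. ?L ! i) {k..<card S}"
    using L by (intro inj_on_nth) auto
  ultimately have "card (S \<inter> {a..}) = card S - k" by (simp add: card_image)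
  then show ?thesis using k L by (simp add: ith_largest_def rev_nth)
qed

text \<open>
  The set \<open>S\<close> encodes a walk: its \<open>r\<close>-th step is up or down according to \<open>s\<^sub>n\<^sub>-\<^sub>r\<^sub>+\<^sub>1\<close>, the sign of the entry
  with the \<open>r\<close>-th largest absolute value. After \<open>l\<close> steps the walk has made \<open>npos l\<close> steps up and \<open>nneg l\<close>
  steps down, which are the numbers of ones and minus ones in \<open>e\<^sub>l\<close>.
\<close>
locale sign_pattern =
  fixes n :: nat and S :: "nat set"
  assumes S_sub: "S \<subseteq> {1..n}"
begin

definition up :: "nat \<Rightarrow> bool" where "up r \<longleftrightarrow> n - r + 1 \<in> S"

definition step_sign :: "nat \<Rightarrow> real" where "step_sign r = (if up r then 1 else - 1)"

definition npos :: "nat \<Rightarrow> nat" where "npos l = card (S \<inter> {n - l + 1..})"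

definition nneg :: "nat \<Rightarrow> nat" where "nneg l = l - npos l"

text \<open>
  The position of the entry with the \<open>r\<close>-th largest absolute value: positive entries of a decreasing
  vector come from the front and negative ones from the back.
\<close>
definition place :: "nat \<Rightarrow> nat" where "place r = (if up r then npos r else n + 1 - nneg r)"

text \<open>
  The \<open>r\<close>-th largest absolute value of a point of the chamber. The value \<open>0\<close> at \<open>r = n + 1\<close> makes
  \<open>gap n\<close> equal to the smallest absolute value.
\<close>
definition height :: "nat \<Rightarrow> vec0 \<Rightarrow> real" where
  "height r x = (if r \<le> n then step_sign r * coord x (place r) else 0)"

definition gap :: "nat \<Rightarrow> vec0 \<Rightarrow> real" where "gap l x = height l x - height (l + 1) x"

lemma finS: "finite S"
  using S_sub finite_subset by blast

lemma npos_0: "npos 0 = 0"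
proof -
  have "S \<inter> {n - 0 + 1..} = {}" using S_sub by auto
  then show ?thesis unfolding npos_def by (metis card.empty)
qed

lemma npos_Suc: assumes "r < n" shows "npos (Suc r) = npos r + of_bool (up (Suc r))"
proof -
  have a: "n - Suc r + 1 = n - r" using assms by simp
  have "{n - r..} = insert (n - r) {n - r + 1..}" by auto
  then have "npos (Suc r) = card (S \<inter> insert (n - r) {n - r + 1..})" unfolding npos_def a by simp
  also have "\<dots> = npos r + of_bool (up (Suc r))"
    using finS unfolding npos_def up_def a by (cases "n - r \<in> S") (simp_all add: Int_insert_right)
  finally show ?thesis .
qed

lemma npos_le: "r \<le> n \<Longrightarrow> npos r \<le> r"
  by (induction r) (auto simp: npos_0 npos_Suc)

lemma nneg_Suc: "r < n \<Longrightarrow> nneg (Suc r) = nneg r + of_bool (\<not> up (Suc r))"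
  using npos_Suc[of r] npos_le[of r] by (auto simp: nneg_def)

lemma npos_nneg: "r \<le> n \<Longrightarrow> npos r + nneg r = r"
  using npos_le by (simp add: nneg_def)

lemma npos_mono: "r \<le> r' \<Longrightarrow> r' \<le> n \<Longrightarrow> npos r \<le> npos r'"
  by (induction r' rule: dec_induct) (auto simp: npos_Suc)

lemma nneg_mono: "r \<le> r' \<Longrightarrow> r' \<le> n \<Longrightarrow> nneg r \<le> nneg r'"
  by (induction r' rule: dec_induct) (auto simp: nneg_Suc)

lemma npos_strict: assumes "r < r'" "r' \<le> n" "up r'" shows "npos r < npos r'"
proof -
  obtain q where q: "r' = Suc q" using assms(1) by (cases r') auto
  then show ?thesis using npos_mono[of r q] npos_Suc[of q] assms by auto
qed

lemma nneg_strict: assumes "r < r'" "r' \<le> n" "\<not> up r'" shows "nneg r < nneg r'"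
proof -
  obtain q where q: "r' = Suc q" using assms(1) by (cases r') auto
  then show ?thesis using nneg_mono[of r q] nneg_Suc[of q] assms by auto
qed

lemma npos_n: "npos n = card S"
proof -
  have "S \<inter> {n - n + 1..} = S" using S_sub by auto
  then show ?thesis by (simp add: npos_def)
qed

lemma place_up: "up r \<Longrightarrow> r \<in> {1..n} \<Longrightarrow> place r = npos r \<and> 1 \<le> npos r \<and> npos r \<le> npos n"
  using npos_strict[of 0 r] npos_mono[of r n] by (auto simp: place_def)

lemma place_down:
  "\<not> up r \<Longrightarrow> r \<in> {1..n} \<Longrightarrow> place r + nneg r = n + 1 \<and> 1 \<le> nneg r \<and> nneg r \<le> nneg n"
  using nneg_strict[of 0 r] nneg_mono[of r n] npos_nneg[of n] by (auto simp: place_def)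

lemma place_in: "r \<in> {1..n} \<Longrightarrow> place r \<in> {1..n}"
  using place_up[of r] place_down[of r] npos_nneg[of n] by (cases "up r") auto

lemma up_iff_place: "r \<in> {1..n} \<Longrightarrow> up r \<longleftrightarrow> place r \<le> npos n"
  using place_up[of r] place_down[of r] npos_nneg[of n] by (cases "up r") auto

lemma place_less_up:
  assumes "r \<in> {1..n}" "r' \<in> {1..n}" "up r" "up r'" shows "place r < place r' \<longleftrightarrow> r < r'"
  using place_up[of r] place_up[of r'] npos_strict[of r r'] npos_mono[of r' r] assms
  by (cases "r < r'") auto

lemma place_less_down:
  assumes "r \<in> {1..n}" "r' \<in> {1..n}" "\<not> up r" "\<not> up r'" shows "place r < place r' \<longleftrightarrow> r' < r"
  using place_down[of r] place_down[of r'] nneg_strict[of r' r] nneg_mono[of r r'] assms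
  by (cases "r' < r") auto

lemma inj_on_place: "inj_on place {1..n}"
proof (rule inj_onI)
  fix r r' assume r: "r \<in> {1..n}" "r' \<in> {1..n}" "place r = place r'"
  then have "up r \<longleftrightarrow> up r'" by (simp add: up_iff_place)
  then show "r = r'"
    using place_less_up[of r r'] place_less_up[of r' r] place_less_down[of r r'] place_less_down[of r' r] r
    by (metis less_irrefl linorder_neqE_nat)
qed

lemma bij_place: "bij_betw place {1..n} {1..n}"
  using inj_on_place place_in
  by (simp add: bij_betw_def endo_inj_surj image_subset_iff)

lemma place_surj: assumes "j \<in> {1..n}" obtains r where "r \<in> {1..n}" "j = place r"
  using bij_place assms by (metis bij_betw_imp_surj_on imageE)

lemma level_ray_eq: "level_ray n S l = vvec n (npos l, nneg l)"
  by (simp add: level_ray_def npos_def nneg_def Let_def)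

lemma level_in_Estar: "l \<in> {1..n} \<Longrightarrow> (npos l, nneg l) \<in> Estar n"
  using npos_nneg[of l] by (auto simp: Estar_def)

lemma level_ray_in_hgl: "l \<in> {1..n} \<Longrightarrow> level_ray n S l \<in> hgl n"
  using level_in_Estar vvec_in_hgl level_ray_eq by simp

text \<open>
  The nonzero entries of \<open>e\<^sub>l\<close> occupy precisely the places of the first \<open>l\<close> steps, with the signs of these
  steps.
\<close>
lemma height_level_ray:
  assumes l: "l \<in> {1..n}" and r: "r \<in> {1..n}"
  shows "height r (level_ray n S l) = of_bool (r \<le> l)"
proof (cases "up r")
  case True
  have "npos r \<le> npos l \<longleftrightarrow> r \<le> l"
    using npos_mono[of r l] npos_strict[of l r] True l r by (meson atLeastAtMost_iff leD leI)
  moreover have "npos n + nneg l \<le> n" using npos_nneg[of n] nneg_mono[of l n] l by simp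
  ultimately show ?thesis using True r place_up[OF True r]
    by (auto simp: height_def step_sign_def level_ray_eq coord_vvec)
next
  case False
  have "nneg r \<le> nneg l \<longleftrightarrow> r \<le> l"
    using nneg_mono[of r l] nneg_strict[of l r] False l r by (meson atLeastAtMost_iff leD leI)
  moreover have "npos l + nneg r \<le> n"
    using npos_nneg[of n] npos_mono[of l n] place_down[OF False r] l by simp
  ultimately show ?thesis using False r place_down[OF False r]
    by (auto simp: height_def step_sign_def level_ray_eq coord_vvec)
qed

lemma sum_gap:
  assumes "r \<le> n" shows "(\<Sum>l=r..n. gap l x) = height r x"
proof -
  have "(\<Sum>l=r..n. gap l x) = - (\<Sum>l=r..n. height (Suc l) x - height l x)"
    by (simp add: gap_def sum_negf[symmetric])
  also have "\<dots> = - (height (Suc n) x - height r x)" using assms by (subst sum_Suc_diff) auto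
  finally show ?thesis by (simp add: height_def)
qed

lemma coord_place: "r \<in> {1..n} \<Longrightarrow> coord x (place r) = step_sign r * height r x"
  by (auto simp: height_def step_sign_def)

lemma linear_ht: "linear (height r)"
  by (rule linearI) (auto simp: height_def lookup_add algebra_simps)

lemma linear_gap: "linear (gap l)"
  unfolding gap_def by (intro linear_compose_sub linear_ht)

text \<open>
  The gaps telescope to the heights, and the heights recover the entries since \<open>place\<close> is a permutation.
\<close>
sublocale simplicial_cone "hgl n" "{1..n}" "level_ray n S" gap
proof (rule simplicial_cone.intro)
  show "gap i (level_ray n S j) = of_bool (i = j)" if "i \<in> {1..n}" "j \<in> {1..n}" for i j
  proof (cases "i = n")
    case True
    then have "gap i (level_ray n S j) = height i (level_ray n S j)" by (simp add: gap_def height_def)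
    then show ?thesis using that True by (simp add: height_level_ray)
  next
    case False
    then show ?thesis using that by (auto simp: gap_def height_level_ray)
  qed
next
  fix x assume x: "x \<in> hgl n"
  let ?s = "\<Sum>l = 1..n. gap l x *\<^sub>R level_ray n S l"
  have sV: "?s \<in> hgl n"
    by (intro subspace_sum subspace_scale subspace_hgl level_ray_in_hgl)
  show "x = ?s"
  proof (rule poly_mapping_eqI)
    fix i
    show "coord x i = coord ?s i"
    proof (cases "i \<in> {1..n}")
      case True
      then obtain r where r: "r \<in> {1..n}" "i = place r" by (rule place_surj)
      have "coord ?s i = step_sign r * height r ?s" using r by (simp add: coord_place)
      also have "height r ?s = (\<Sum>l=1..n. gap l x * of_bool (r \<le> l))"
        using r by (simp add: linear_sum[OF linear_ht] linear_scale[OF linear_ht] height_level_ray)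
      also have "\<dots> = (\<Sum>l=r..n. gap l x)"
        using r by (intro sum.mono_neutral_cong_right) auto
      also have "\<dots> = height r x" using r by (simp add: sum_gap)
      finally show ?thesis using r coord_place by metis
    next
      case False
      then show ?thesis using x sV by (simp add: hgl_iff)
    qed
  qed
qed (use subspace_hgl linear_gap level_ray_in_hgl in auto)

text \<open>
  The index condition in the definition of \<open>C(S)\<close> looks asymmetric, but it only asks for the sign of that one
  of the two entries which comes earlier in the walk. If the entry at \<open>place r\<close> is positive, the bound
  on the second index is \<open>n - nneg r\<close>, and a negative entry at \<open>place r'\<close> stays within it
  exactly when the walk has made more down steps by time \<open>r'\<close> than by time \<open>r\<close>.
\<close>
lemma chamber_condition:
  assumes "r \<in> {1..n}" "r' \<in> {1..n}" "place r \<le> place r'"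
  shows "place r \<le> card S \<and> place r' \<le> ith_largest S (place r) + place r - 1 \<longleftrightarrow> up (min r r')"
proof (cases "up r")
  case True
  have pr: "place r = npos r" "npos r \<le> npos n" "1 \<le> npos r" using place_up[OF True assms(1)] by auto
  have "n - r + 1 \<in> S" using True by (simp add: up_def)
  then have "ith_largest S (place r) = n - r + 1"
    using ith_largest_eq[OF finS, of "n - r + 1"] unfolding pr(1) npos_def by simp
  moreover have "npos r + nneg r = r" using npos_nneg assms by simp
  ultimately have cond: "ith_largest S (place r) + place r - 1 = n - nneg r" "nneg r \<le> n"
    using assms(1) pr by auto
  show ?thesis
  proof (cases "up r'")
    case r': True
    have "nneg r \<le> nneg n" using nneg_mono[of r n] assms by simp
    then have "place r' \<le> n - nneg r" using place_up[OF r' assms(2)] npos_nneg[of n] by auto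
    then show ?thesis using r' True cond pr npos_n by (simp add: min_def)
  next
    case r': False
    have "place r' \<le> n - nneg r \<longleftrightarrow> nneg r < nneg r'"
      using place_down[OF r' assms(2)] cond(2) by auto
    also have "\<dots> \<longleftrightarrow> r < r'"
      using nneg_strict[of r r'] nneg_mono[of r' r] r' assms by (meson atLeastAtMost_iff leD leI)
    also have "\<dots> \<longleftrightarrow> up (min r r')"
      using True r' by (metis linorder_less_linear min.absorb3 min.absorb4 order_less_asym)
    finally show ?thesis using cond pr npos_n by simp
  qed
next
  case False
  then have "\<not> place r \<le> npos n" "\<not> up r'" using up_iff_place[OF assms(1)] up_iff_place[OF assms(2)] assms(3) by auto
  then show ?thesis using False npos_n by (simp add: min_def)
qed

lemma chamber_of_iff:
  "x \<in> chamber_of n S \<longleftrightarrow> x \<in> Wgl n \<and>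
     (\<forall>r\<in>{1..n}. \<forall>r'\<in>{1..n}. step_sign (min r r') * (coord x (place r) + coord x (place r')) \<ge> 0)"
proof (intro iffI conjI ballI)
  assume x: "x \<in> chamber_of n S"
  then show "x \<in> Wgl n" by (simp add: chamber_of_def)
  fix r r' assume r: "r \<in> {1..n}" "r' \<in> {1..n}"
  have "step_sign (min r r') * (coord x (place r) + coord x (place r')) \<ge> 0"
    if r: "r \<in> {1..n}" "r' \<in> {1..n}" "place r \<le> place r'" for r r'
  proof -
    have "1 \<le> place r" "place r' \<le> n" using place_in r by auto
    then have "if up (min r r') then coord x (place r) + coord x (place r') \<ge> 0
      else coord x (place r) + coord x (place r') \<le> 0"
      using x r(3) unfolding chamber_of_def chamber_condition[OF r, symmetric] by blast
    then show ?thesis by (auto simp: step_sign_def split: if_splits)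
  qed
  from this[of r r'] this[of r' r] r
  show "step_sign (min r r') * (coord x (place r) + coord x (place r')) \<ge> 0"
    by (cases "place r \<le> place r'") (simp_all add: add.commute min.commute)
next
  assume x: "x \<in> Wgl n \<and>
     (\<forall>r\<in>{1..n}. \<forall>r'\<in>{1..n}. step_sign (min r r') * (coord x (place r) + coord x (place r')) \<ge> 0)"
  have "if i \<le> card S \<and> j \<le> ith_largest S i + i - 1 then coord x i + coord x j \<ge> 0
      else coord x i + coord x j \<le> 0" if ij: "1 \<le> i" "i \<le> j" "j \<le> n" for i j
  proof -
    have "i \<in> {1..n}" "j \<in> {1..n}" using ij by auto
    then obtain r r' where r: "r \<in> {1..n}" "i = place r" "r' \<in> {1..n}" "j = place r'"
      by (metis place_surj)
    then have "step_sign (min r r') * (coord x i + coord x j) \<ge> 0" using x by auto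
    then show ?thesis using chamber_condition[of r r'] r ij by (auto simp: step_sign_def split: if_splits)
  qed
  then show "x \<in> chamber_of n S" using x by (simp add: chamber_of_def)
qed

lemma height_antimono:
  assumes "\<And>l. l \<in> {1..n} \<Longrightarrow> gap l x \<ge> 0" "1 \<le> r" "r \<le> r'"
  shows "height r' x \<le> height r x"
  using assms(3,2)
proof (induction r' rule: dec_induct)
  case (step m)
  then show ?case using assms(1)[of m] by (cases "m \<le> n") (auto simp: gap_def height_def)
qed simp

lemma height_nonneg:
  assumes "\<And>l. l \<in> {1..n} \<Longrightarrow> gap l x \<ge> 0" "1 \<le> r" shows "height r x \<ge> 0"
  using height_antimono[OF assms, of "max r (n + 1)"] by (simp add: height_def)

lemma orthant_decreasing:
  assumes x: "x \<in> orthant" and ij: "1 \<le> i" "i < j" "j \<le> n"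
  shows "coord x i \<ge> coord x j"
proof -
  have gap: "\<And>l. l \<in> {1..n} \<Longrightarrow> gap l x \<ge> 0" using x unfolding orthant_def by blast
  have "i \<in> {1..n}" "j \<in> {1..n}" using ij by auto
  then obtain r r' where r: "r \<in> {1..n}" "i = place r" "r' \<in> {1..n}" "j = place r'"
    by (metis place_surj)
  have nn: "height r x \<ge> 0" "height r' x \<ge> 0" using height_nonneg[of x] gap r by auto
  have "up r' \<Longrightarrow> up r" using up_iff_place r ij by simp
  then consider "up r" "up r'" | "up r" "\<not> up r'" | "\<not> up r" "\<not> up r'" by blast
  then show ?thesis
  proof cases
    case 1
    then have "r < r'" using place_less_up[of r r'] r ij by simp
    then show ?thesis using 1 r height_antimono[of x r r'] gap by (simp add: coord_place step_sign_def)
  next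
    case 2
    then show ?thesis using r nn by (simp add: coord_place step_sign_def)
  next
    case 3
    then have "r' < r" using place_less_down[of r r'] r ij by simp
    then show ?thesis using 3 r height_antimono[of x r' r] gap by (simp add: coord_place step_sign_def)
  qed
qed

text \<open>
  A weight \<open>x\<^sub>i + x\<^sub>j\<close> has the sign of the entry that is larger in absolute value; so decreasing heights give
  all the sign conditions. Conversely, consecutive steps of the same direction have adjacent places, where
  monotonicity of \<open>x\<close> compares the heights, and for steps of opposite directions the difference of the heights
  is, up to sign, a weight.
\<close>
lemma chamber_of_eq_orthant: "chamber_of n S = orthant"
proof (intro set_eqI iffI)
  fix x assume x: "x \<in> orthant"
  then have xV: "x \<in> hgl n" and gap: "\<And>l. l \<in> {1..n} \<Longrightarrow> gap l x \<ge> 0" unfolding orthant_def by blast+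
  have "x \<in> Wgl n" using xV orthant_decreasing[OF x] by (auto simp: Wgl_def)
  moreover have "step_sign (min r r') * (coord x (place r) + coord x (place r')) \<ge> 0"
    if r: "r \<in> {1..n}" "r' \<in> {1..n}" for r r'
  proof -
    have "step_sign r * (coord x (place r) + coord x (place r')) \<ge> 0"
      if r: "r \<in> {1..n}" "r' \<in> {1..n}" "r \<le> r'" for r r'
      using height_nonneg[of x r] height_nonneg[of x r'] height_antimono[of x r r'] gap r by (auto simp: coord_place step_sign_def)
    from this[of r r'] this[of r' r] r show ?thesis
      by (cases "r \<le> r'") (simp_all add: min_def add.commute)
  qed
  ultimately show "x \<in> chamber_of n S" by (simp add: chamber_of_iff)
next
  fix x assume "x \<in> chamber_of n S"
  then have W: "x \<in> Wgl n" and c: "\<And>r r'. r \<in> {1..n} \<Longrightarrow> r' \<in> {1..n} \<Longrightarrow>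
      step_sign (min r r') * (coord x (place r) + coord x (place r')) \<ge> 0"
    by (auto simp: chamber_of_iff)
  have "gap l x \<ge> 0" if l: "l \<in> {1..n}" for l
  proof (cases "l = n")
    case True
    then show ?thesis using c[OF l l] by (auto simp: gap_def height_def step_sign_def)
  next
    case False
    have l1: "Suc l \<in> {1..n}" and ln: "l < n" using l False by auto
    have W': "coord x i \<ge> coord x (i + 1)" if "1 \<le> i" "i + 1 \<le> n" for i
      using W that by (auto simp: Wgl_def)
    consider "up l" "up (Suc l)" | "\<not> up l" "\<not> up (Suc l)" | "up l \<longleftrightarrow> \<not> up (Suc l)" by blast
    then show ?thesis
    proof cases
      case 1
      then have "place (Suc l) = place l + 1" using npos_Suc[OF ln] by (simp add: place_def)
      then show ?thesis using W'[of "place l"] place_in[OF l] place_in[OF l1] 1 ln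
        by (simp add: gap_def height_def step_sign_def)
    next
      case 2
      then have "place l = place (Suc l) + 1"
        using nneg_Suc[OF ln] place_down[OF _ l] place_down[OF _ l1] by simp
      then show ?thesis using W'[of "place (Suc l)"] place_in[OF l] place_in[OF l1] 2 ln
        by (simp add: gap_def height_def step_sign_def)
    next
      case 3
      then have "gap l x = step_sign l * (coord x (place l) + coord x (place (Suc l)))"
        using ln by (auto simp: gap_def height_def step_sign_def)
      then show ?thesis using c[OF l l1] by (simp add: min_def)
    qed
  qed
  then show "x \<in> orthant" using W unfolding orthant_def Wgl_def by blast
qed

lemma level_sum_eq:
  assumes "l \<in> {1..n}" shows "level_sum n (char_vec S) l = int (npos l) - int (nneg l)"
proof -
  have "level_sum n (char_vec S) l = int (npos l) - int (nneg l)" if "l \<le> n" for l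
    using that
  proof (induction l)
    case 0
    then show ?case by (simp add: level_sum_def npos_0 nneg_def)
  next
    case (Suc l)
    then have "{n - Suc l + 1..n} = insert (n - l) {n - l + 1..n}" by auto
    then have "level_sum n (char_vec S) (Suc l) = char_vec S (n - l) + level_sum n (char_vec S) l"
      by (simp add: level_sum_def)
    moreover have "char_vec S (n - l) = of_bool (up (Suc l)) - of_bool (\<not> up (Suc l))"
      using Suc.prems by (simp add: char_vec_def up_def Suc_diff_Suc)
    ultimately show ?case using Suc by (simp add: npos_Suc nneg_Suc)
  qed
  then show ?thesis using assms by simp
qed

lemma sigv_level_ray:
  assumes "l \<in> {1..n}" shows "sigv n (level_ray n S l) = real_of_int (level_sum n (char_vec S) l)"
  unfolding level_ray_eq sigv_vvec[OF level_in_Estar[OF assms]] level_sum_eq[OF assms] by (simp add: sig_def)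

end

section \<open>The distinguished rays of a chamber\<close>

text \<open>
  The arithmetic behind nested vectors: \<open>a\<close>, \<open>b\<close> are two entries of \<open>v(p)\<close> and \<open>c\<close>, \<open>d\<close> the corresponding
  entries of \<open>v(q)\<close>, which agree with the former wherever these are nonzero. The two sums then never
  have strictly opposite signs, so a positive combination of them cannot hide a violation.
\<close>
lemma sign_split:
  fixes \<alpha> \<beta> s a b c d :: real
  assumes "\<alpha> > 0" "\<beta> > 0" "s = 1 \<or> s = - 1"
    and "a \<in> {- 1, 0, 1}" "b \<in> {- 1, 0, 1}" "c \<in> {- 1, 0, 1}" "d \<in> {- 1, 0, 1}"
    and "a \<noteq> 0 \<Longrightarrow> c = a" "b \<noteq> 0 \<Longrightarrow> d = b"
    and "s * ((\<alpha> * a + \<beta> * c) + (\<alpha> * b + \<beta> * d)) \<ge> 0"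
  shows "s * (a + b) \<ge> 0" "s * (c + d) \<ge> 0"
  using assms by auto

context sign_pattern begin

lemma vvec_split:
  assumes pq: "p \<in> Estar n" "q \<in> Estar n" "p < q" and "\<alpha> > 0" "\<beta> > 0"
    and x: "\<alpha> *\<^sub>R vvec n p + \<beta> *\<^sub>R vvec n q \<in> chamber_of n S"
  shows "vvec n p \<in> chamber_of n S" "vvec n q \<in> chamber_of n S"
proof -
  obtain a b c d where p: "p = (a, b)" "a + b \<le> n" and q: "q = (c, d)" "c + d \<le> n"
    using assms by (auto simp: Estar_def)
  have le: "a \<le> c" "b \<le> d" using pq(3) unfolding p q by (auto simp: less_le)
  have vals: "coord (vvec n p) i \<in> {- 1, 0, 1}" "coord (vvec n q) i \<in> {- 1, 0, 1}" for i
    unfolding p(1) q(1) coord_vvec by auto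
  have nest: "coord (vvec n p) i \<noteq> 0 \<Longrightarrow> coord (vvec n q) i = coord (vvec n p) i" for i
    unfolding p(1) q(1) coord_vvec using p(2) q(2) le by (auto simp: of_bool_def split: if_splits)
  have step_sign: "step_sign r = 1 \<or> step_sign r = - 1" for r by (simp add: step_sign_def)
  have "step_sign (min r r') * (coord (vvec n p) (place r) + coord (vvec n p) (place r')) \<ge> 0 \<and>
      step_sign (min r r') * (coord (vvec n q) (place r) + coord (vvec n q) (place r')) \<ge> 0"
    if "r \<in> {1..n}" "r' \<in> {1..n}" for r r'
  proof -
    have "step_sign (min r r') * ((\<alpha> * coord (vvec n p) (place r) + \<beta> * coord (vvec n q) (place r)) +
       (\<alpha> * coord (vvec n p) (place r') + \<beta> * coord (vvec n q) (place r'))) \<ge> 0"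
      using x that unfolding chamber_of_iff by (simp add: lookup_add)
    from sign_split[OF assms(4,5) step_sign vals(1) vals(1) vals(2) vals(2) nest nest this]
    show ?thesis by blast
  qed
  then show "vvec n p \<in> chamber_of n S" "vvec n q \<in> chamber_of n S"
    unfolding chamber_of_iff using vvec_in_Wgl pq by auto
qed

text \<open>
  The absolute values of the entries of \<open>v(p)\<close> are zeros and ones. In the chamber they decrease along the
  walk, so the ones are those of the first \<open>level p\<close> steps, and \<open>v(p)\<close> has the coordinates of the generator at that
  level.
\<close>
lemma vvec_in_orthant_iff:
  assumes "p \<in> Estar n" shows "vvec n p \<in> orthant \<longleftrightarrow> npos (level p) = fst p"
proof
  have l: "level p \<in> {1..n}" using assms by (auto simp: Estar_def level_def)
  assume "npos (level p) = fst p"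
  then have "vvec n p = level_ray n S (level p)"
    by (simp add: level_ray_eq nneg_def level_def)
  then show "vvec n p \<in> orthant" using e_in_orthant[OF l] by simp
next
  assume x: "vvec n p \<in> orthant"
  obtain a b where p: "p = (a, b)" "1 \<le> a + b" "a + b \<le> n" using assms by (auto simp: Estar_def)
  have l: "a + b \<in> {1..n}" using p by simp
  let ?x = "vvec n p"
  have gap: "\<And>l. l \<in> {1..n} \<Longrightarrow> gap l ?x \<ge> 0" using x unfolding orthant_def by blast
  let ?J = "{1..a} \<union> {n - b + 1..n}"
  have J: "?J \<subseteq> {1..n}" using p by auto
  have "card ?J = card {1..a} + card {n - b + 1..n}" using p by (intro card_Un_disjoint) auto
  then have cardJ: "card ?J = a + b" using p by simp
  have abs01: "\<bar>coord ?x j\<bar> = of_bool (j \<in> ?J)" if "j \<in> {1..n}" for j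
    unfolding p(1) coord_vvec using that p(3) by auto
  have ht01: "height r ?x = of_bool (place r \<in> ?J)" if r: "r \<in> {1..n}" for r
  proof -
    have "height r ?x = \<bar>height r ?x\<bar>" using height_nonneg[OF gap] r by simp
    also have "\<dots> = \<bar>coord ?x (place r)\<bar>" using r by (simp add: height_def step_sign_def)
    finally show ?thesis using abs01[OF place_in[OF r]] by simp
  qed
  define A where "A = {r \<in> {1..n}. place r \<in> ?J}"
  have "place ` A = ?J"
  proof (intro equalityI subsetI)
    fix j assume j: "j \<in> ?J"
    then obtain r where "r \<in> {1..n}" "j = place r" using J place_surj by blast
    then show "j \<in> place ` A" using j unfolding A_def by blast
  qed (auto simp: A_def)
  moreover have "inj_on place A" using inj_on_place by (rule inj_on_subset) (auto simp: A_def)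
  ultimately have cardA: "card A = a + b" using cardJ card_image by metis
  have down: "r' \<in> A" if "r \<in> A" "1 \<le> r'" "r' \<le> r" for r r'
  proof -
    have r: "r \<in> {1..n}" "r' \<in> {1..n}" using that by (auto simp: A_def)
    have "height r' ?x \<ge> height r ?x" using height_antimono[of ?x r' r] gap that by auto
    moreover have "place r \<in> ?J" using that(1) by (simp add: A_def)
    ultimately have "place r' \<in> ?J"
      unfolding ht01[OF r(1)] ht01[OF r(2)] of_bool_less_eq_iff by blast
    then show ?thesis using r by (simp add: A_def)
  qed
  have finA: "finite A" by (simp add: A_def)
  \<comment> \<open>A set of positive numbers that is closed downwards is an initial segment of its own cardinality.\<close>
  have A: "r \<in> A \<longleftrightarrow> r \<le> a + b" if r: "r \<in> {1..n}" for r
  proof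
    assume "r \<in> A"
    then have "{1..r} \<subseteq> A" using down by auto
    then have "card {1..r} \<le> card A" using finA by (rule card_mono[rotated])
    then show "r \<le> a + b" using cardA by simp
  next
    assume le: "r \<le> a + b"
    show "r \<in> A"
    proof (rule ccontr)
      assume "r \<notin> A"
      then have "r' < r" if "r' \<in> A" for r' using down[OF that, of r] r by (meson atLeastAtMost_iff not_less)
      then have "A \<subseteq> {1..<r}" unfolding A_def by auto
      then have "card A \<le> card {1..<r}" by (intro card_mono) auto
      then show False using cardA le r by auto
    qed
  qed
  have htx: "height r ?x = of_bool (r \<le> a + b)" if "r \<in> {1..n}" for r
  proof -
    have "place r \<in> ?J \<longleftrightarrow> r \<le> a + b" using A[OF that] that unfolding A_def by blast
    then show ?thesis unfolding ht01[OF that] by (rule arg_cong)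
  qed
  have "?x = level_ray n S (a + b)"
  proof (rule eqI_T)
    show "?x \<in> hgl n" using vvec_in_hgl[OF assms] .
    show "level_ray n S (a + b) \<in> hgl n" using level_ray_in_hgl[OF l] .
    fix k assume k: "k \<in> {1..n}"
    show "gap k ?x = gap k (level_ray n S (a + b))"
    proof (cases "k = n")
      case True
      then show ?thesis using k l by (simp add: gap_def height_def[of "Suc n"] htx height_level_ray)
    next
      case False
      then show ?thesis using k l by (simp add: gap_def htx height_level_ray)
    qed
  qed
  then have "sigv n (vvec n p) = sigv n (vvec n (npos (a + b), nneg (a + b)))"
    by (simp add: level_ray_eq)
  then have "sig p = sig (npos (a + b), nneg (a + b))"
    using sigv_vvec[OF assms] sigv_vvec[OF level_in_Estar[OF l]] by simp
  then show "npos (level p) = fst p" using npos_nneg[of "a + b"] p by (simp add: sig_def level_def)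
qed

lemma extreme_ray_vvec_iff:
  assumes "p \<in> Estar n" shows "extreme_ray (ray (vvec n p)) orthant \<longleftrightarrow> vvec n p \<in> orthant"
proof
  assume "extreme_ray (ray (vvec n p)) orthant"
  then show "vvec n p \<in> orthant" using ray_self unfolding extreme_ray_def face_of_def by blast
next
  assume "vvec n p \<in> orthant"
  then have "npos (level p) = fst p" using vvec_in_orthant_iff assms by simp
  then have "vvec n p = level_ray n S (level p)"
    by (simp add: level_ray_eq nneg_def level_def)
  moreover have "level p \<in> {1..n}" using assms by (auto simp: Estar_def level_def)
  moreover have "slice (\<lambda>x. 0) = orthant" unfolding slice_def by simp
  ultimately show "extreme_ray (ray (vvec n p)) orthant"
    using extreme_ray_e[of "\<lambda>x. 0" "level p"] by (simp add: linear_zero)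
qed

lemma slice_eq: "orthant \<inter> hsl n = slice (sigv n)"
  unfolding slice_def orthant_def hsl_def by blast

lemma level_ray_signature_iff:
  assumes "p \<in> Estar n"
  shows "sigv n (level_ray n S (level p)) = real_of_int (sig p) \<longleftrightarrow> vvec n p \<in> orthant"
proof -
  have l: "level p \<in> {1..n}" using assms by (auto simp: Estar_def level_def)
  have "sigv n (level_ray n S (level p)) = real_of_int (sig p) \<longleftrightarrow>
      int (npos (level p)) - int (nneg (level p)) = int (fst p) - int (snd p)"
    unfolding sigv_level_ray[OF l] level_sum_eq[OF l] sig_def of_int_eq_iff ..
  also have "\<dots> \<longleftrightarrow> npos (level p) = fst p"
    using npos_nneg[of "level p"] l by (auto simp: level_def)
  finally show ?thesis using vvec_in_orthant_iff[OF assms] by simp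
qed

lemma conic_slice: "linear \<phi> \<Longrightarrow> conic (slice \<phi>)"
  using convex_cone_slice by (simp add: convex_cone_def)

text \<open>
  Since \<open>v(i, i)\<close> has signature zero, it lies on the hyperplane anyway, and only membership in the chamber is
  at stake.
\<close>
lemma null_ray:
  assumes "1 \<le> i" "i \<le> n div 2"
  shows "ray (vvec n (i, i)) \<subseteq> orthant \<inter> hsl n \<longleftrightarrow> vvec n (i, i) \<in> orthant"
    and "null_level n (char_vec S) (2 * i) \<longleftrightarrow> vvec n (i, i) \<in> orthant"
proof -
  have E: "(i, i) \<in> Estar n" using assms by (auto simp: Estar_def)
  have "sigv n (vvec n (i, i)) = 0" using sigv_vvec[OF E] by (simp add: sig_def)
  then show "ray (vvec n (i, i)) \<subseteq> orthant \<inter> hsl n \<longleftrightarrow> vvec n (i, i) \<in> orthant"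
    unfolding slice_eq ray_subset_conic[OF conic_slice[OF linear_sigv]] unfolding slice_def by blast
  have l: "2 * i \<in> {1..n}" using assms by auto
  have "null_level n (char_vec S) (2 * i) \<longleftrightarrow> int (npos (2 * i)) - int (nneg (2 * i)) = 0"
    using l by (simp add: null_level_def level_sum_eq)
  also have "\<dots> \<longleftrightarrow> npos (2 * i) = i" using npos_nneg[of "2 * i"] l by auto
  finally show "null_level n (char_vec S) (2 * i) \<longleftrightarrow> vvec n (i, i) \<in> orthant"
    using vvec_in_orthant_iff[OF E] by (simp add: level_def mult_2)
qed

text \<open>
  The coefficients of \<open>v(p, q)\<close> are chosen to make its signature zero, and they are positive.
\<close>
lemma edge_ray:
  assumes "(p, q) \<in> BB n"
  shows "ray (vvec2 n p q) \<subseteq> orthant \<inter> hsl n \<longleftrightarrow> vvec n p \<in> orthant \<and> vvec n q \<in> orthant"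
proof -
  have pq: "p \<in> Estar n" "q \<in> Estar n" "p < q" "sig p * sig q < 0" using assms by (auto simp: BB_def)
  have pos: "real_of_int \<bar>sig q\<bar> > 0" "real_of_int \<bar>sig p\<bar> > 0" using pq(4) by auto
  have "\<bar>sig q\<bar> * sig p + \<bar>sig p\<bar> * sig q = 0" using pq(4) by (auto simp: mult_less_0_iff)
  then have "real_of_int (\<bar>sig q\<bar> * sig p + \<bar>sig p\<bar> * sig q) = 0" by simp
  then have "sigv n (vvec2 n p q) = 0"
    unfolding vvec2_def
    by (simp only: linear_add[OF linear_sigv] linear_scale[OF linear_sigv] sigv_vvec[OF pq(1)] sigv_vvec[OF pq(2)]) simp
  then have "ray (vvec2 n p q) \<subseteq> orthant \<inter> hsl n \<longleftrightarrow> vvec2 n p q \<in> orthant"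
    unfolding slice_eq ray_subset_conic[OF conic_slice[OF linear_sigv]] unfolding slice_def by blast
  also have "\<dots> \<longleftrightarrow> vvec n p \<in> orthant \<and> vvec n q \<in> orthant"
  proof
    assume "vvec2 n p q \<in> orthant"
    then show "vvec n p \<in> orthant \<and> vvec n q \<in> orthant"
      using vvec_split[OF pq(1-3) pos] unfolding vvec2_def chamber_of_eq_orthant by blast
  next
    assume "vvec n p \<in> orthant \<and> vvec n q \<in> orthant"
    then show "vvec2 n p q \<in> orthant" unfolding vvec2_def using pos convex_cone_orthant
      by (intro convex_cone_add convex_cone_scaleR) auto
  qed
  finally show ?thesis .
qed

end

section \<open>Points with distinct nonzero absolute values\<close>

text \<open>
  For a generic point of a chamber this is the inverse of \<open>place\<close>, expressed through the point alone.
\<close>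
definition magnitude_rank :: "nat \<Rightarrow> vec0 \<Rightarrow> nat \<Rightarrow> nat" where
  "magnitude_rank n x j = card {i \<in> {1..n}. \<bar>coord x j\<bar> \<le> \<bar>coord x i\<bar>}"

definition generic :: "nat \<Rightarrow> vec0 \<Rightarrow> bool" where
  "generic n x \<longleftrightarrow> inj_on (\<lambda>i. \<bar>coord x i\<bar>) {1..n} \<and> (\<forall>i\<in>{1..n}. coord x i \<noteq> 0)"

context sign_pattern begin

lemma abs_coord_place:
  assumes "x \<in> orthant" "r \<in> {1..n}" shows "\<bar>coord x (place r)\<bar> = height r x"
proof -
  have "height r x \<ge> 0" using height_nonneg[of x r] assms unfolding orthant_def by auto
  then show ?thesis using assms(2) by (auto simp: coord_place step_sign_def)
qed

lemma height_strict_antimono: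
  assumes gap: "\<And>l. l \<in> {1..n} \<Longrightarrow> gap l x > 0" and r: "1 \<le> r" "r < r'" "r \<le> n"
  shows "height r' x < height r x"
proof -
  have "height r' x \<le> height (Suc r) x" using height_antimono[of x "Suc r" r'] gap r by (simp add: less_imp_le)
  also have "\<dots> < height r x" using gap[of r] r by (simp add: gap_def)
  finally show ?thesis .
qed

text \<open>
  The heights are the absolute values in weakly decreasing order; they are distinct and nonzero exactly when
  all gaps are positive.
\<close>
lemma gap_pos_iff_generic:
  assumes x: "x \<in> orthant" shows "(\<forall>l\<in>{1..n}. gap l x > 0) \<longleftrightarrow> generic n x"
proof
  assume "\<forall>l\<in>{1..n}. gap l x > 0"
  then have gap: "\<And>l. l \<in> {1..n} \<Longrightarrow> gap l x > 0" by blast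
  have pos: "height r x > 0" if "r \<in> {1..n}" for r
    using height_strict_antimono[OF gap, of r "Suc n"] that by (simp add: height_def[of "Suc n"])
  show "generic n x" unfolding generic_def
  proof (intro conjI ballI inj_onI)
    fix i j assume ij: "i \<in> {1..n}" "j \<in> {1..n}" "\<bar>coord x i\<bar> = \<bar>coord x j\<bar>"
    then obtain r r' where r: "r \<in> {1..n}" "i = place r" "r' \<in> {1..n}" "j = place r'"
      by (metis place_surj)
    then have "height r x = height r' x" using ij abs_coord_place[OF x] by simp
    then have "r = r'"
      using height_strict_antimono[OF gap, of r r'] height_strict_antimono[OF gap, of r' r] r
      by (metis atLeastAtMost_iff less_irrefl linorder_neqE_nat)
    then show "i = j" using r by simp
  next
    fix i assume "i \<in> {1..n}"
    then obtain r where "r \<in> {1..n}" "i = place r" by (rule place_surj)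
    then show "coord x i \<noteq> 0" using pos[of r] abs_coord_place[OF x, of r] by auto
  qed
next
  assume g: "generic n x"
  show "\<forall>l\<in>{1..n}. gap l x > 0"
  proof
    fix l assume l: "l \<in> {1..n}"
    have "gap l x \<ge> 0" using x l unfolding orthant_def by blast
    moreover have "gap l x \<noteq> 0"
    proof (cases "l = n")
      case True
      then show ?thesis using g place_in[OF l] abs_coord_place[OF x l]
        by (auto simp: gap_def height_def[of "Suc n"] generic_def)
    next
      case False
      then have l1: "Suc l \<in> {1..n}" using l by simp
      have "place l \<noteq> place (Suc l)" using inj_on_place l l1 by (metis inj_on_contraD n_not_Suc_n)
      then have "height l x \<noteq> height (Suc l) x"
        using g place_in[OF l] place_in[OF l1] abs_coord_place[OF x l] abs_coord_place[OF x l1]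
        unfolding generic_def inj_on_def by metis
      then show ?thesis by (simp add: gap_def)
    qed
    ultimately show "gap l x > 0" by simp
  qed
qed

lemma magnitude_rank_place:
  assumes x: "x \<in> orthant" and g: "generic n x" and r: "r \<in> {1..n}"
  shows "magnitude_rank n x (place r) = r"
proof -
  have gap: "\<And>l. l \<in> {1..n} \<Longrightarrow> gap l x > 0" using gap_pos_iff_generic[OF x] g by blast
  have iff: "height r x \<le> height r' x \<longleftrightarrow> r' \<le> r" if "r' \<in> {1..n}" for r'
    using height_strict_antimono[OF gap, of r r'] height_antimono[of x r' r] gap r that
    by (metis atLeastAtMost_iff leI less_imp_le not_le)
  have "{i \<in> {1..n}. \<bar>coord x (place r)\<bar> \<le> \<bar>coord x i\<bar>} = place ` {1..r}"
  proof (intro equalityI subsetI)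
    fix i assume i: "i \<in> {i \<in> {1..n}. \<bar>coord x (place r)\<bar> \<le> \<bar>coord x i\<bar>}"
    then obtain r' where r': "r' \<in> {1..n}" "i = place r'" using place_surj by blast
    then have "r' \<le> r" using i iff[OF r'(1)] abs_coord_place[OF x r] abs_coord_place[OF x r'(1)] by simp
    then show "i \<in> place ` {1..r}" using r' by simp
  next
    fix i assume "i \<in> place ` {1..r}"
    then obtain r' where r': "r' \<in> {1..n}" "r' \<le> r" "i = place r'" using r by auto
    then show "i \<in> {i \<in> {1..n}. \<bar>coord x (place r)\<bar> \<le> \<bar>coord x i\<bar>}"
      using iff[OF r'(1)] abs_coord_place[OF x r] abs_coord_place[OF x r'(1)] place_in[OF r'(1)] by simp
  qed
  moreover have "inj_on place {1..r}" using inj_on_place by (rule inj_on_subset) (use r in auto)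
  ultimately show ?thesis by (simp add: magnitude_rank_def card_image)
qed

text \<open>
  A generic point determines the sign sequence of the chamber that contains it, which gives injectivity
  of \<open>S \<mapsto> C(S)\<close> and disjointness of the cells.
\<close>
lemma S_eq_ranks:
  assumes x: "x \<in> orthant" and g: "generic n x"
  shows "S = (\<lambda>j. n + 1 - magnitude_rank n x j) ` {j \<in> {1..n}. coord x j > 0}"
proof -
  have sign: "coord x (place r) > 0 \<longleftrightarrow> n + 1 - r \<in> S" if r: "r \<in> {1..n}" for r
  proof -
    have "coord x (place r) \<noteq> 0" using g place_in[OF r] by (simp add: generic_def)
    then have "height r x > 0" using abs_coord_place[OF x r] by (metis zero_less_abs_iff)
    moreover have "up r \<longleftrightarrow> n + 1 - r \<in> S" using r by (simp add: up_def Suc_diff_le)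
    ultimately show ?thesis unfolding coord_place[OF r] step_sign_def by simp
  qed
  show ?thesis
  proof (intro equalityI subsetI)
    fix a assume a: "a \<in> S"
    define r where "r = n + 1 - a"
    have "1 \<le> a" "a \<le> n" using a S_sub by auto
    then have r: "r \<in> {1..n}" "n + 1 - r = a" by (auto simp: r_def)
    then have "coord x (place r) > 0" using sign a by simp
    then show "a \<in> (\<lambda>j. n + 1 - magnitude_rank n x j) ` {j \<in> {1..n}. coord x j > 0}"
      using r place_in[OF r(1)] magnitude_rank_place[OF x g r(1)] by (intro image_eqI[of _ _ "place r"]) auto
  next
    fix a assume "a \<in> (\<lambda>j. n + 1 - magnitude_rank n x j) ` {j \<in> {1..n}. coord x j > 0}"
    then obtain j where j: "j \<in> {1..n}" "coord x j > 0" "a = n + 1 - magnitude_rank n x j" by blast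
    obtain r where r: "r \<in> {1..n}" "j = place r" using j(1) by (rule place_surj)
    then show "a \<in> S" using j sign[OF r(1)] magnitude_rank_place[OF x g r(1)] by simp
  qed
qed

end

lemma sign_pattern_unique:
  assumes "S \<subseteq> {1..n}" "S' \<subseteq> {1..n}" "generic n x" "x \<in> chamber_of n S" "x \<in> chamber_of n S'"
  shows "S = S'"
proof -
  interpret A: sign_pattern n S by unfold_locales fact
  interpret B: sign_pattern n S' by unfold_locales fact
  show ?thesis using A.S_eq_ranks B.S_eq_ranks assms
    unfolding A.chamber_of_eq_orthant[symmetric] B.chamber_of_eq_orthant[symmetric] by metis
qed

text \<open>
  Take the \<open>S\<close> that records at which ranks the positive entries occur. Counting the entries that are
  at least as large in absolute value as \<open>x\<^sub>j\<close> shows \<open>place (rk j) = j\<close>: among them, the positive ones are the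
  first \<open>j\<close> entries if \<open>x\<^sub>j > 0\<close>, and the negative ones are the last \<open>n + 1 - j\<close> entries if \<open>x\<^sub>j < 0\<close>.
\<close>
lemma generic_in_chamber:
  assumes W: "x \<in> Wgl n" and g: "generic n x"
  obtains S where "S \<subseteq> {1..n}" "x \<in> chamber_of n S"
proof -
  define rk where "rk = magnitude_rank n x"
  have strict: "coord x i > coord x j" if "1 \<le> i" "i < j" "j \<le> n" for i j
  proof -
    have "Suc i \<le> j" using that by simp
    then have "j \<le> n \<Longrightarrow> coord x i \<ge> coord x j"
    proof (induction j rule: dec_induct)
      case base
      then show ?case using W that(1) by (simp add: Wgl_def)
    next
      case (step m)
      then have "coord x m \<ge> coord x (Suc m)" using W by (simp add: Wgl_def)
      then show ?case using step by simp
    qed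
    moreover have "\<bar>coord x i\<bar> \<noteq> \<bar>coord x j\<bar>"
      using g that unfolding generic_def inj_on_def by (metis atLeastAtMost_iff less_imp_le less_irrefl order_trans)
    ultimately show ?thesis using that by fastforce
  qed
  have less_iff: "coord x i < coord x j \<longleftrightarrow> j < i" if "i \<in> {1..n}" "j \<in> {1..n}" for i j
    using strict[of i j] strict[of j i] that by (cases i j rule: linorder_cases) auto
  have rk_le: "rk i \<le> rk j \<longleftrightarrow> \<bar>coord x j\<bar> \<le> \<bar>coord x i\<bar>" if ij: "i \<in> {1..n}" "j \<in> {1..n}" for i j
  proof
    assume le: "rk i \<le> rk j"
    show "\<bar>coord x j\<bar> \<le> \<bar>coord x i\<bar>"
    proof (rule ccontr)
      assume c: "\<not> ?thesis"
      then have "{k \<in> {1..n}. \<bar>coord x j\<bar> \<le> \<bar>coord x k\<bar>} \<subset> {k \<in> {1..n}. \<bar>coord x i\<bar> \<le> \<bar>coord x k\<bar>}"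
        using ij by force
      then have "rk j < rk i" unfolding rk_def magnitude_rank_def by (intro psubset_card_mono) auto
      then show False using le by simp
    qed
  qed (auto simp: rk_def magnitude_rank_def intro!: card_mono)
  have rk_in: "rk j \<in> {1..n}" if j: "j \<in> {1..n}" for j
  proof -
    have "{j} \<subseteq> {i \<in> {1..n}. \<bar>coord x j\<bar> \<le> \<bar>coord x i\<bar>}" using j by auto
    then have "card {j} \<le> rk j" unfolding rk_def magnitude_rank_def by (intro card_mono) auto
    moreover have "rk j \<le> card {1..n}" unfolding rk_def magnitude_rank_def by (intro card_mono) auto
    ultimately show ?thesis by simp
  qed
  have rk_inj: "inj_on rk {1..n}"
  proof (rule inj_onI)
    fix i j assume ij: "i \<in> {1..n}" "j \<in> {1..n}" "rk i = rk j"
    then have "\<bar>coord x i\<bar> = \<bar>coord x j\<bar>" using rk_le[of i j] rk_le[of j i] by simp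
    then show "i = j" using g ij unfolding generic_def inj_on_def by blast
  qed
  define S where "S = (\<lambda>j. n + 1 - rk j) ` {j \<in> {1..n}. coord x j > 0}"
  have S: "S \<subseteq> {1..n}"
  proof
    fix a assume "a \<in> S"
    then obtain j where "j \<in> {1..n}" "a = n + 1 - rk j" by (auto simp: S_def)
    then show "a \<in> {1..n}" using rk_in[of j] by auto
  qed
  interpret sign_pattern n S by unfold_locales fact
  have up_rk: "up (rk j) \<longleftrightarrow> coord x j > 0" if j: "j \<in> {1..n}" for j
  proof -
    have "n - rk j + 1 = n + 1 - rk i \<longleftrightarrow> i = j" if i: "i \<in> {1..n}" for i
    proof -
      have "n - rk j + 1 = n + 1 - rk i \<longleftrightarrow> rk i = rk j" using rk_in[OF i] rk_in[OF j] by auto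
      then show ?thesis using rk_inj i j by (meson inj_on_def)
    qed
    moreover have "up (rk j) \<longleftrightarrow> (\<exists>i\<in>{1..n}. coord x i > 0 \<and> n - rk j + 1 = n + 1 - rk i)"
      unfolding up_def unfolding S_def by blast
    ultimately show ?thesis using j by metis
  qed
  have npos_rk: "npos (rk j) = card {i \<in> {1..n}. coord x i > 0 \<and> \<bar>coord x j\<bar> \<le> \<bar>coord x i\<bar>}"
    if j: "j \<in> {1..n}" for j
  proof -
    let ?A = "{i \<in> {1..n}. coord x i > 0 \<and> \<bar>coord x j\<bar> \<le> \<bar>coord x i\<bar>}"
    have le: "n - rk j + 1 \<le> n + 1 - rk i \<longleftrightarrow> \<bar>coord x j\<bar> \<le> \<bar>coord x i\<bar>" if i: "i \<in> {1..n}" for i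
      using rk_in[OF i] rk_in[OF j] rk_le[OF i j] by auto
    have "S \<inter> {n - rk j + 1..} = (\<lambda>i. n + 1 - rk i) ` ?A"
    proof (intro equalityI subsetI)
      fix a assume "a \<in> S \<inter> {n - rk j + 1..}"
      then obtain i where "i \<in> {1..n}" "coord x i > 0" "a = n + 1 - rk i" "n - rk j + 1 \<le> a"
        unfolding S_def by blast
      then show "a \<in> (\<lambda>i. n + 1 - rk i) ` ?A" using le by blast
    next
      fix a assume "a \<in> (\<lambda>i. n + 1 - rk i) ` ?A"
      then obtain i where "i \<in> {1..n}" "coord x i > 0" "a = n + 1 - rk i" "\<bar>coord x j\<bar> \<le> \<bar>coord x i\<bar>"
        by blast
      then show "a \<in> S \<inter> {n - rk j + 1..}" using le unfolding S_def by blast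
    qed
    moreover have "inj_on (\<lambda>i. n + 1 - rk i) ?A"
    proof (rule inj_onI)
      fix i k assume ik: "i \<in> ?A" "k \<in> ?A" "n + 1 - rk i = n + 1 - rk k"
      then have "i \<in> {1..n}" "k \<in> {1..n}" by auto
      then have "rk i = rk k" using ik(3) rk_in[of i] rk_in[of k] by auto
      then show "i = k" using rk_inj \<open>i \<in> {1..n}\<close> \<open>k \<in> {1..n}\<close> by (metis inj_on_def)
    qed
    ultimately show ?thesis unfolding npos_def by (simp add: card_image)
  qed
  have place_rk: "place (rk j) = j" if j: "j \<in> {1..n}" for j
  proof (cases "coord x j > 0")
    case True
    have "{i \<in> {1..n}. coord x i > 0 \<and> \<bar>coord x j\<bar> \<le> \<bar>coord x i\<bar>} = {1..j}"
    proof (intro set_eqI iffI)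
      fix i assume "i \<in> {i \<in> {1..n}. coord x i > 0 \<and> \<bar>coord x j\<bar> \<le> \<bar>coord x i\<bar>}"
      then show "i \<in> {1..j}" using less_iff[of i j] j True by auto
    next
      fix i assume "i \<in> {1..j}"
      then show "i \<in> {i \<in> {1..n}. coord x i > 0 \<and> \<bar>coord x j\<bar> \<le> \<bar>coord x i\<bar>}"
        using less_iff[of i j] j True by auto
    qed
    then show ?thesis using True up_rk[OF j] npos_rk[OF j] by (simp add: place_def)
  next
    case False
    then have neg: "coord x j < 0" using g j by (auto simp: generic_def not_less order.order_iff_strict)
    let ?A = "{i \<in> {1..n}. coord x i > 0 \<and> \<bar>coord x j\<bar> \<le> \<bar>coord x i\<bar>}"
    have "{i \<in> {1..n}. \<bar>coord x j\<bar> \<le> \<bar>coord x i\<bar>} = ?A \<union> {j..n}"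
    proof (intro set_eqI iffI)
      fix i assume i: "i \<in> {i \<in> {1..n}. \<bar>coord x j\<bar> \<le> \<bar>coord x i\<bar>}"
      then show "i \<in> ?A \<union> {j..n}" using less_iff[of j i] j neg by (cases "coord x i > 0") auto
    next
      fix i assume "i \<in> ?A \<union> {j..n}"
      then show "i \<in> {i \<in> {1..n}. \<bar>coord x j\<bar> \<le> \<bar>coord x i\<bar>}"
        using less_iff[of j i] j neg by auto
    qed
    moreover have "?A \<inter> {j..n} = {}" using less_iff[of j] j neg by force
    ultimately have "rk j = npos (rk j) + card {j..n}"
      unfolding npos_rk[OF j] by (simp add: rk_def magnitude_rank_def card_Un_disjoint)
    then have "nneg (rk j) = n + 1 - j" by (simp add: nneg_def)
    then show ?thesis using False up_rk[OF j] j by (simp add: place_def)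
  qed
  have height_rk: "height (rk j) x = \<bar>coord x j\<bar>" if j: "j \<in> {1..n}" for j
    using rk_in[OF j] up_rk[OF j] place_rk[OF j] by (simp add: height_def step_sign_def)
  have inv: "rk (place r) = r" if "r \<in> {1..n}" for r
    using place_rk[OF place_in[OF that]] rk_in[OF place_in[OF that]] inj_on_place that by (meson inj_onD)
  have "gap l x \<ge> 0" if l: "l \<in> {1..n}" for l
  proof (cases "l = n")
    case True
    then have "gap l x = height (rk (place l)) x" using inv[OF l] by (simp add: gap_def height_def[of "Suc n"])
    then show ?thesis using height_rk[OF place_in[OF l]] by simp
  next
    case False
    then have l1: "l + 1 \<in> {1..n}" using l by simp
    have "\<bar>coord x (place (l + 1))\<bar> \<le> \<bar>coord x (place l)\<bar>"
      using rk_le[OF place_in[OF l] place_in[OF l1]] inv[OF l] inv[OF l1] by simp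
    then show ?thesis
      using height_rk[OF place_in[OF l]] height_rk[OF place_in[OF l1]] inv[OF l] inv[OF l1] by (simp add: gap_def)
  qed
  then have "x \<in> orthant" using W unfolding orthant_def Wgl_def by blast
  then show ?thesis using that S chamber_of_eq_orthant by blast
qed

section \<open>Topology of open cones and their closures\<close>

lemma bounded_linear_coord: "bounded_linear (\<lambda>x. coord x i)"
proof (rule bounded_linear_intro[where K = 1])
  fix x :: vec0
  have n: "norm x = (\<Sum>k\<in>Poly_Mapping.keys x. \<bar>coord x k\<bar>)"
    by (simp add: norm_poly_mapping_def dist_poly_mapping_def)
  show "norm (coord x i) \<le> norm x * 1"
  proof (cases "i \<in> Poly_Mapping.keys x")
    case True
    then have "\<bar>coord x i\<bar> \<le> (\<Sum>k\<in>Poly_Mapping.keys x. \<bar>coord x k\<bar>)"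
      by (intro member_le_sum) auto
    then show ?thesis by (simp add: n)
  next
    case False
    then show ?thesis by (simp add: in_keys_iff)
  qed
qed (simp_all add: lookup_add)

lemmas continuous_on_coord [continuous_intros] =
  bounded_linear.continuous_on[OF bounded_linear_coord]

lemma closed_hgl: "closed (hgl n)"
proof -
  have "hgl n = (\<Inter>i\<in>- {1..n}. {x. coord x i = 0})" by (auto simp: hgl_iff)
  moreover have "closed {x. coord x i = 0}" for i
    by (intro closed_Collect_eq continuous_on_coord continuous_on_id continuous_on_const)
  ultimately show ?thesis by (metis (no_types, lifting) closed_INT)
qed

lemma continuous_on_sigv: "continuous_on A (sigv n)"
  unfolding sigv_def by (intro continuous_intros)

lemma closed_hsl: "closed (hsl n)"
proof -
  have "hsl n = hgl n \<inter> {x. sigv n x = 0}" by (auto simp: hsl_def)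
  moreover have "closed {x. sigv n x = 0}"
    by (intro closed_Collect_eq continuous_on_sigv continuous_on_const)
  ultimately show ?thesis using closed_hgl by auto
qed

lemma subspace_hsl: "subspace (hsl n)"
  using subspace_hgl linear_sigv
  by (auto simp: hsl_def subspace_def linear_0 linear_add linear_scale)

text \<open>
  A point of the closed cone is the limit of its translates by ever smaller multiples of a point of the
  open cone.
\<close>
lemma closure_open_cone:
  fixes f :: "'i \<Rightarrow> vec0 \<Rightarrow> real"
  assumes V: "closed V" "subspace V" and f: "\<And>i. i \<in> I \<Longrightarrow> linear (f i) \<and> continuous_on UNIV (f i)"
    and ne: "{x \<in> V. \<forall>i\<in>I. f i x > 0} \<noteq> {}"
  shows "closure {x \<in> V. \<forall>i\<in>I. f i x > 0} = {x \<in> V. \<forall>i\<in>I. f i x \<ge> 0}"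
proof (rule antisym)
  have "{x \<in> V. \<forall>i\<in>I. f i x \<ge> 0} = V \<inter> (\<Inter>i\<in>I. {x. 0 \<le> f i x})" by auto
  moreover have "closed {x. 0 \<le> f i x}" if "i \<in> I" for i
    using f[OF that] by (intro closed_Collect_le continuous_on_const) blast
  ultimately have "closed {x \<in> V. \<forall>i\<in>I. f i x \<ge> 0}" using V by (auto intro!: closed_INT)
  then show "closure {x \<in> V. \<forall>i\<in>I. f i x > 0} \<subseteq> {x \<in> V. \<forall>i\<in>I. f i x \<ge> 0}"
    by (intro closure_minimal) (auto intro: less_imp_le)
  obtain y where y: "y \<in> V" "\<And>i. i \<in> I \<Longrightarrow> f i y > 0" using ne by blast
  show "{x \<in> V. \<forall>i\<in>I. f i x \<ge> 0} \<subseteq> closure {x \<in> V. \<forall>i\<in>I. f i x > 0}"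
  proof
    fix x assume x: "x \<in> {x \<in> V. \<forall>i\<in>I. f i x \<ge> 0}"
    define z where "z k = x + inverse (real (Suc k)) *\<^sub>R y" for k
    have "z k \<in> {x \<in> V. \<forall>i\<in>I. f i x > 0}" for k
    proof -
      have "z k \<in> V" using x y V by (simp add: z_def subspace_add subspace_scale)
      moreover have "f i (z k) > 0" if i: "i \<in> I" for i
      proof -
        have "f i (z k) = f i x + inverse (real (Suc k)) * f i y"
          using f[OF i] by (simp add: z_def linear_add linear_scale)
        moreover have "f i x \<ge> 0" using x i by blast
        moreover have "inverse (real (Suc k)) * f i y > 0" using y(2)[OF i] by simp
        ultimately show ?thesis by linarith
      qed
      ultimately show ?thesis by blast
    qed
    moreover have "z \<longlonglongrightarrow> x + 0 *\<^sub>R y" unfolding z_def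
      by (intro tendsto_intros LIMSEQ_inverse_real_of_nat)
    ultimately show "x \<in> closure {x \<in> V. \<forall>i\<in>I. f i x > 0}"
      unfolding closure_sequential by (intro exI[of _ z]) simp
  qed
qed

text \<open>
  If two neighbouring entries of \<open>x\<close> agree, a small move in the direction that lowers the first
  and raises the second stays in the hyperplane and leaves the Weyl chamber.
\<close>
lemma interior_Wsl:
  "top_of_set (hsl n) interior_of (Wsl n) =
    {x \<in> hsl n. \<forall>i\<in>{1..<n}. coord x i > coord x (i + 1)}" (is "_ = ?R")
proof (rule interior_of_unique)
  show "?R \<subseteq> Wsl n" by (auto simp: Wsl_def Wgl_def hsl_def intro: less_imp_le)
  have "?R = hsl n \<inter> (\<Inter>i\<in>{1..<n}. {x. coord x (i + 1) < coord x i})" by auto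
  moreover have "open {x. coord x (i + 1) < coord x i}" for i
    by (intro open_Collect_less continuous_on_coord continuous_on_id)
  ultimately show "openin (top_of_set (hsl n)) ?R"
    by (metis (no_types, lifting) finite_atLeastLessThan openin_open_Int open_INT)
  fix T' assume T': "T' \<subseteq> Wsl n" "openin (top_of_set (hsl n)) T'"
  then obtain U where U: "open U" "T' = hsl n \<inter> U" by (auto simp: openin_open)
  show "T' \<subseteq> ?R"
  proof
    fix x assume x: "x \<in> T'"
    have "coord x i > coord x (i + 1)" if i: "i \<in> {1..<n}" for i
    proof (rule ccontr)
      assume "\<not> ?thesis"
      then have eq: "coord x i \<le> coord x (i + 1)" by simp
      define d :: vec0 where "d = Poly_Mapping.single (i + 1) 1 - Poly_Mapping.single i 1"
      have cd: "coord d k = of_bool (k = i + 1) - of_bool (k = i)" for k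
        by (simp add: d_def lookup_minus lookup_single when_def)
      have dV: "d \<in> hsl n"
        using i by (auto simp: hsl_def hgl_iff cd sigv_def sum_subtractf of_bool_def)
      obtain e where e: "e > 0" "ball x e \<subseteq> U" using U x by (meson IntD2 open_contains_ball)
      define N where "N = norm d + 1"
      define c where "c = e / N / 2"
      have N: "N > 0" unfolding N_def by (smt (verit) norm_ge_zero)
      have c: "c > 0" using e N by (simp add: c_def)
      have "c * norm d \<le> c * N" using c by (intro mult_left_mono) (auto simp: N_def)
      also have "\<dots> = e / 2" using N by (simp add: c_def)
      also have "\<dots> < e" using e by simp
      finally have "x + c *\<^sub>R d \<in> ball x e" using c by (simp add: dist_norm)
      moreover have "x + c *\<^sub>R d \<in> hsl n"
        using x U dV subspace_hsl by (simp add: subspace_add subspace_scale)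
      ultimately have "x + c *\<^sub>R d \<in> Wsl n" using U e T' by auto
      then have "coord (x + c *\<^sub>R d) i \<ge> coord (x + c *\<^sub>R d) (i + 1)"
        using i by (simp add: Wsl_def Wgl_def)
      then show False using eq c by (simp add: lookup_add cd)
    qed
    then show "x \<in> ?R" using x U by blast
  qed
qed

text \<open>
  Relative openness in a set \<open>V\<close> that need not be open itself is what the cells in the hyperplane require.
\<close>
lemma components_disjoint_open_connected:
  fixes Q :: "'s \<Rightarrow> 'a::topological_space set"
  assumes R: "R = (\<Union>s\<in>P. Q s)" and op: "\<And>s. s \<in> P \<Longrightarrow> openin (top_of_set V) (Q s)"
    and conn: "\<And>s. s \<in> P \<Longrightarrow> connected (Q s)"
    and disj: "\<And>s t. s \<in> P \<Longrightarrow> t \<in> P \<Longrightarrow> s \<noteq> t \<Longrightarrow> Q s \<inter> Q t = {}"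
  shows "components R = Q ` {s \<in> P. Q s \<noteq> {}}"
proof -
  have comp: "connected_component_set R x = Q s" if s: "s \<in> P" "x \<in> Q s" for s x
  proof (rule connected_component_unique)
    show "x \<in> Q s" "connected (Q s)" using s conn by auto
    show "Q s \<subseteq> R" using R s by blast
    fix K assume K: "x \<in> K" "K \<subseteq> R" "connected K"
    show "K \<subseteq> Q s"
    proof (rule ccontr)
      assume c: "\<not> K \<subseteq> Q s"
      let ?A = "Q s" and ?B = "\<Union>t\<in>P - {s}. Q t"
      have "openin (top_of_set V) ?B" using op by blast
      then obtain A B where AB: "open A" "open B" "?A = V \<inter> A" "?B = V \<inter> B"
        using op[OF s(1)] by (auto simp: openin_open)
      have "R \<subseteq> V" using R op by (auto dest!: openin_imp_subset)
      then have KV: "K \<subseteq> V" using K by blast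
      have "?A \<inter> ?B = {}" using disj s by blast
      then have "A \<inter> B \<inter> K = {}" using AB KV by blast
      moreover have "K \<subseteq> A \<union> B" using K(2) R AB by blast
      moreover have "A \<inter> K \<noteq> {}" using K(1) s AB by blast
      moreover have "B \<inter> K \<noteq> {}" using c K(2) R AB by blast
      ultimately show False using connectedD[OF K(3) AB(1,2)] by blast
    qed
  qed
  show ?thesis
  proof (intro equalityI subsetI)
    fix C assume "C \<in> components R"
    then obtain x where "x \<in> R" "C = connected_component_set R x" by (auto simp: components_def)
    then show "C \<in> Q ` {s \<in> P. Q s \<noteq> {}}" using comp R by blast
  next
    fix C assume "C \<in> Q ` {s \<in> P. Q s \<noteq> {}}"
    then obtain s x where "s \<in> P" "x \<in> Q s" "C = Q s" by blast
    then show "C \<in> components R" unfolding components_def using comp[of s x] R by blast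
  qed
qed

section \<open>The chambers of the special linear geometry\<close>

context sign_pattern begin

text \<open>
  The interior, relative to the hyperplane, of the section of the chamber.
\<close>
definition cell :: "vec0 set" where
  "cell = {x \<in> hsl n. \<forall>l\<in>{1..n}. gap l x > 0}"

text \<open>
  At a point of the cell the positive gaps weight the level sums to total zero, and the first level sum is
  \<open>\<plusminus>1\<close>, so both signs occur. Conversely, start from all gaps equal to one and enlarge
  the gap at a positive or at a negative level until the total vanishes.
\<close>
lemma cell_nonempty_iff:
  assumes "n \<ge> 1"
  shows "cell \<noteq> {} \<longleftrightarrow> {l. positive_level n (char_vec S) l} \<noteq> {} \<and> {l. negative_level n (char_vec S) l} \<noteq> {}"
proof -
  define \<sigma> where "\<sigma> l = sigv n (level_ray n S l)" for l
  have \<sigma>: "\<sigma> l = real_of_int (level_sum n (char_vec S) l)" if "l \<in> {1..n}" for l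
    unfolding \<sigma>_def using that by (rule sigv_level_ray)
  have pos: "{l. positive_level n (char_vec S) l} = {l \<in> {1..n}. \<sigma> l > 0}"
    by (rule Collect_cong) (auto simp: positive_level_def \<sigma>)
  have neg: "{l. negative_level n (char_vec S) l} = {l \<in> {1..n}. \<sigma> l < 0}"
    by (rule Collect_cong) (auto simp: negative_level_def \<sigma>)
  have sum: "sigv n x = (\<Sum>l=1..n. gap l x * \<sigma> l)" if "x \<in> hgl n" for x
    using linear_on_V[OF linear_sigv that] by (simp add: \<sigma>_def)
  show ?thesis unfolding pos neg
  proof
    assume "cell \<noteq> {}"
    then obtain x where x: "x \<in> hsl n" "\<And>l. l \<in> {1..n} \<Longrightarrow> gap l x > 0" by (auto simp: cell_def)
    have 0: "(\<Sum>l=1..n. gap l x * \<sigma> l) = 0" using sum[of x] x(1) unfolding hsl_def by force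
    have one: "1 \<in> {1..n}" using assms by simp
    have "npos 1 + nneg 1 = 1" using npos_nneg[of 1] assms by simp
    then have "int (npos 1) - int (nneg 1) \<noteq> 0" by presburger
    then have s1: "\<sigma> 1 \<noteq> 0" using level_sum_eq[OF one] sigv_level_ray[OF one] by (simp add: \<sigma>_def)
    have "{l \<in> {1..n}. \<sigma> l > 0} \<noteq> {}"
    proof
      assume "{l \<in> {1..n}. \<sigma> l > 0} = {}"
      then have le: "\<forall>l\<in>{1..n}. \<sigma> l \<le> 0" by (auto simp: not_less)
      have "gap 1 x * \<sigma> 1 < 0" using le one s1 x(2)[OF one]
        by (metis less_eq_real_def mult_pos_neg)
      then have "(\<Sum>l=1..n. gap l x * \<sigma> l) < (\<Sum>l=1..n. 0)"
        using le x(2) one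
        by (intro sum_strict_mono_ex1) (auto intro!: mult_nonneg_nonpos intro: less_imp_le)
      then show False using 0 by simp
    qed
    moreover have "{l \<in> {1..n}. \<sigma> l < 0} \<noteq> {}"
    proof
      assume "{l \<in> {1..n}. \<sigma> l < 0} = {}"
      then have le: "\<forall>l\<in>{1..n}. \<sigma> l \<ge> 0" by (auto simp: not_less)
      have "gap 1 x * \<sigma> 1 > 0" using le one s1 x(2)[OF one]
        by (metis less_eq_real_def mult_pos_pos)
      then have "(\<Sum>l=1..n. 0) < (\<Sum>l=1..n. gap l x * \<sigma> l)"
        using le x(2) one
        by (intro sum_strict_mono_ex1) (auto intro!: mult_nonneg_nonneg intro: less_imp_le)
      then show False using 0 by simp
    qed
    ultimately show "{l \<in> {1..n}. \<sigma> l > 0} \<noteq> {} \<and> {l \<in> {1..n}. \<sigma> l < 0} \<noteq> {}" ..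
  next
    assume "{l \<in> {1..n}. \<sigma> l > 0} \<noteq> {} \<and> {l \<in> {1..n}. \<sigma> l < 0} \<noteq> {}"
    then obtain i j where ij: "i \<in> {1..n}" "\<sigma> i > 0" "j \<in> {1..n}" "\<sigma> j < 0" by auto
    define M where "M = (\<Sum>l=1..n. \<sigma> l)"
    define u where "u = (\<Sum>l=1..n. level_ray n S l)"
    define c where "c = max 0 (- M) / \<sigma> i"
    define d where "d = max 0 M / - \<sigma> j"
    define x where "x = u + (c *\<^sub>R level_ray n S i + d *\<^sub>R level_ray n S j)"
    have cd: "c \<ge> 0" "d \<ge> 0" using ij unfolding c_def d_def by (auto intro!: divide_nonneg_neg)
    have "u \<in> hgl n" unfolding u_def by (intro subspace_sum subspace_hgl level_ray_in_hgl)
    then have xV: "x \<in> hgl n" unfolding x_def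
      by (intro subspace_add subspace_scale subspace_hgl level_ray_in_hgl ij)
    have "sigv n u = M" by (simp add: u_def M_def \<sigma>_def linear_sum[OF linear_sigv])
    then have "sigv n x = M + (c * \<sigma> i + d * \<sigma> j)"
      by (simp add: x_def \<sigma>_def linear_add[OF linear_sigv] linear_scale[OF linear_sigv])
    also have "\<dots> = 0" using ij by (simp add: c_def d_def max_def)
    finally have "x \<in> hsl n" using xV by (simp add: hsl_def)
    moreover have "gap l x > 0" if l: "l \<in> {1..n}" for l
    proof -
      have "gap l u = (\<Sum>k=1..n. of_bool (l = k))"
        unfolding u_def using l by (simp only: linear_sum[OF linear_gap]) (intro sum.cong; simp add: dual)
      also have "\<dots> = 1" using l by (simp add: of_bool_def)
      finally show ?thesis using cd l ij by (simp add: x_def T_lin dual)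
    qed
    ultimately show "cell \<noteq> {}" by (auto simp: cell_def)
  qed
qed

end

lemma weight_coord_nonzero:
  assumes "n \<ge> 2" "i \<in> {1..n}" shows "\<exists>y\<in>hsl n. coord y i \<noteq> 0"
proof -
  obtain k where k: "k \<in> {1..n}" "k \<noteq> i"
    using assms by (metis atLeastAtMost_iff le_refl one_le_numeral order_trans Suc_1 not_less_eq_eq)
  define d :: vec0 where "d = Poly_Mapping.single i 1 - Poly_Mapping.single k 1"
  have cd: "coord d j = of_bool (j = i) - of_bool (j = k)" for j
    by (simp add: d_def lookup_minus lookup_single when_def)
  have "d \<in> hsl n"
    using assms k by (auto simp: hsl_def hgl_iff cd sigv_def sum_subtractf of_bool_def)
  moreover have "coord d i \<noteq> 0" using k by (simp add: cd)
  ultimately show ?thesis by blast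
qed

lemma weight_sum_nonzero:
  assumes "n \<ge> 3" "i \<in> {1..n}" "j \<in> {1..n}" "i \<noteq> j" shows "\<exists>y\<in>hsl n. coord y i + coord y j \<noteq> 0"
proof -
  have "\<not> {1..n} \<subseteq> {i, j}"
  proof
    assume "{1..n} \<subseteq> {i, j}"
    then have "card {1..n} \<le> card {i, j}" by (intro card_mono) auto
    then show False using assms by simp
  qed
  then obtain k where k: "k \<in> {1..n}" "k \<noteq> i" "k \<noteq> j" by blast
  define d :: vec0 where "d = Poly_Mapping.single i 1 - Poly_Mapping.single k 1"
  have cd: "coord d j = of_bool (j = i) - of_bool (j = k)" for j
    by (simp add: d_def lookup_minus lookup_single when_def)
  have "d \<in> hsl n"
    using assms k by (auto simp: hsl_def hgl_iff cd sigv_def sum_subtractf of_bool_def)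
  moreover have "coord d i + coord d j \<noteq> 0" using k assms by (simp add: cd)
  ultimately show ?thesis by blast
qed

text \<open>
  For \<open>n \<ge> 3\<close> no weight vanishes identically on the hyperplane, so all of them count. Off their zeros the
  equality \<open>\<bar>x\<^sub>i\<bar> = \<bar>x\<^sub>j\<bar>\<close> with \<open>i \<noteq> j\<close> would mean \<open>x\<^sub>i = x\<^sub>j\<close>, which is excluded in the interior of the Weyl chamber.
\<close>
lemma regular_points_sl:
  assumes "n \<ge> 3"
  shows "regular_points (hsl n) (Wsl n) (weights n) = {x \<in> Wsl n. generic n x}"
proof (intro set_eqI iffI)
  fix x assume x: "x \<in> regular_points (hsl n) (Wsl n) (weights n)"
  then have V: "x \<in> hsl n" and dec: "\<And>i. i \<in> {1..<n} \<Longrightarrow> coord x i > coord x (i + 1)"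
    and reg: "\<And>f. f \<in> weights n \<Longrightarrow> \<exists>y\<in>hsl n. f y \<noteq> 0 \<Longrightarrow> f x \<noteq> 0"
    unfolding regular_points_def interior_Wsl by auto
  have W: "x \<in> Wsl n" using V dec by (auto simp: Wsl_def Wgl_def hsl_def intro: less_imp_le)
  have c0: "coord x i \<noteq> 0" if i: "i \<in> {1..n}" for i
    using i assms weight_coord_nonzero[of n i] by (intro reg) (auto simp: weights_def)
  have s0: "coord x i + coord x j \<noteq> 0" if ij: "i \<in> {1..n}" "j \<in> {1..n}" "i < j" for i j
    using ij assms weight_sum_nonzero[of n i j] by (intro reg[of "\<lambda>x. coord x i + coord x j"]) (auto simp: weights_def)
  have strict: "coord x j < coord x i" if ij: "1 \<le> i" "i < j" "j \<le> n" for i j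
  proof -
    have "Suc i \<le> j" using ij by simp
    then show ?thesis using ij(3)
    proof (induction j rule: dec_induct)
      case base
      then show ?case using dec[of i] ij(1) by simp
    next
      case (step m)
      then show ?case using dec[of m] ij(1) by simp
    qed
  qed
  have "i = j" if ij: "i \<in> {1..n}" "j \<in> {1..n}" "\<bar>coord x i\<bar> = \<bar>coord x j\<bar>" for i j
    using s0[of i j] s0[of j i] strict[of i j] strict[of j i] ij
    by (cases i j rule: linorder_cases) (auto simp: abs_eq_iff)
  then show "x \<in> {x \<in> Wsl n. generic n x}" using W c0 by (auto simp: generic_def inj_on_def)
next
  fix x assume "x \<in> {x \<in> Wsl n. generic n x}"
  then have W: "x \<in> Wsl n" and g: "generic n x" by auto
  have ne: "\<bar>coord x i\<bar> \<noteq> \<bar>coord x j\<bar>" if "i \<in> {1..n}" "j \<in> {1..n}" "i \<noteq> j" for i j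
    using g that unfolding generic_def inj_on_def by blast
  have "coord x i > coord x (i + 1)" if i: "i \<in> {1..<n}" for i
  proof -
    have "coord x i \<ge> coord x (i + 1)" using W i by (simp add: Wsl_def Wgl_def)
    moreover have "coord x i \<noteq> coord x (i + 1)" using ne[of i "i + 1"] i by auto
    ultimately show ?thesis by simp
  qed
  moreover have "x \<in> hsl n" using W by (simp add: Wsl_def)
  moreover have "f x \<noteq> 0" if "f \<in> weights n" for f
  proof -
    have "coord x i + coord x j \<noteq> 0" if "1 \<le> i" "i < j" "j \<le> n" for i j
      using ne[of i j] that by auto
    then show ?thesis using that g by (auto simp: weights_def generic_def)
  qed
  ultimately show "x \<in> regular_points (hsl n) (Wsl n) (weights n)"
    unfolding regular_points_def interior_Wsl by blast
qed

lemma convex_open_cone: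
  assumes "subspace V" "\<And>i. i \<in> I \<Longrightarrow> linear (f i :: vec0 \<Rightarrow> real)"
  shows "convex {x \<in> V. \<forall>i\<in>I. f i x > 0}"
proof -
  have "convex {x. f i x > 0}" if "i \<in> I" for i
  proof -
    have "{x. f i x > 0} = f i -` {0<..}" by auto
    then show ?thesis using assms(2)[OF that] by (simp add: convex_linear_vimage)
  qed
  then have "convex (V \<inter> (\<Inter>i\<in>I. {x. f i x > 0}))"
    using subspace_imp_convex[OF assms(1)] by (intro convex_Int convex_INT) auto
  moreover have "V \<inter> (\<Inter>i\<in>I. {x. f i x > 0}) = {x \<in> V. \<forall>i\<in>I. f i x > 0}" by auto
  ultimately show ?thesis by simp
qed

context sign_pattern begin

lemma continuous_on_gap: "continuous_on A (gap l)"
  unfolding gap_def height_def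
  by (cases "l \<le> n"; cases "l + 1 \<le> n") (auto intro!: continuous_intros)

lemma openin_cell: "openin (top_of_set (hsl n)) cell"
proof -
  have "cell = hsl n \<inter> (\<Inter>l\<in>{1..n}. {x. 0 < gap l x})" by (auto simp: cell_def)
  moreover have "open {x. 0 < gap l x}" for l
    by (intro open_Collect_less continuous_on_const continuous_on_gap)
  ultimately show ?thesis
    by (metis (no_types, lifting) finite_atLeastAtMost openin_open_Int open_INT)
qed

lemma convex_cell: "convex cell"
  unfolding cell_def by (intro convex_open_cone subspace_hsl linear_gap)

lemma cell_subset: "cell \<subseteq> orthant \<inter> hsl n"
  unfolding cell_def orthant_def hsl_def by (auto intro: less_imp_le)

lemma closure_cell: "cell \<noteq> {} \<Longrightarrow> closure cell = chamber_of n S \<inter> hsl n"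
proof -
  assume "cell \<noteq> {}"
  then have "closure cell = {x \<in> hsl n. \<forall>l\<in>{1..n}. gap l x \<ge> 0}"
    unfolding cell_def using linear_gap continuous_on_gap
    by (intro closure_open_cone closed_hsl subspace_hsl) auto
  also have "\<dots> = chamber_of n S \<inter> hsl n"
    unfolding chamber_of_eq_orthant orthant_def hsl_def by blast
  finally show ?thesis .
qed

lemma cell_eq: "cell = {x \<in> Wsl n. generic n x \<and> x \<in> chamber_of n S}"
proof -
  have "cell = {x \<in> orthant \<inter> hsl n. generic n x}"
    using cell_subset gap_pos_iff_generic unfolding cell_def by blast
  moreover have "orthant \<subseteq> Wgl n" using chamber_of_eq_orthant chamber_of_iff by blast
  ultimately show ?thesis unfolding chamber_of_eq_orthant Wsl_def by blast
qed

end

definition balanced :: "nat \<Rightarrow> nat set \<Rightarrow> bool" where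
  "balanced n S \<longleftrightarrow> S \<subseteq> {1..n} \<and> {l. positive_level n (char_vec S) l} \<noteq> {} \<and> {l. negative_level n (char_vec S) l} \<noteq> {}"

text \<open>
  A point of the cell of \<open>S\<close> is generic and lies in both chambers.
\<close>
lemma chamber_slice_unique:
  assumes "n \<ge> 1" "balanced n S" "S' \<subseteq> {1..n}" "chamber_of n S \<inter> hsl n = chamber_of n S' \<inter> hsl n"
  shows "S = S'"
proof -
  have S: "S \<subseteq> {1..n}" using assms(2) by (simp add: balanced_def)
  interpret sign_pattern n S by unfold_locales fact
  obtain x where "x \<in> cell" using cell_nonempty_iff[OF assms(1)] assms(2) by (auto simp: balanced_def)
  then have x: "x \<in> hsl n" "generic n x" "x \<in> chamber_of n S" by (auto simp: cell_eq Wsl_def)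
  then have "x \<in> chamber_of n S'" using assms(4) by blast
  then show ?thesis using sign_pattern_unique S assms(3) x by blast
qed

lemma sl_chambers_eq:
  assumes n: "n \<ge> 3"
  shows "sl_chambers n = (\<lambda>S. chamber_of n S \<inter> hsl n) ` {S. balanced n S}"
proof -
  let ?Q = "\<lambda>S. sign_pattern.cell n S"
  have sp: "sign_pattern n S" if "S \<subseteq> {1..n}" for S using that by unfold_locales
  have R: "regular_points (hsl n) (Wsl n) (weights n) = (\<Union>S\<in>Pow {1..n}. ?Q S)"
  proof (intro equalityI subsetI)
    fix x assume "x \<in> regular_points (hsl n) (Wsl n) (weights n)"
    then have x: "x \<in> Wsl n" "generic n x" using regular_points_sl[OF n] by auto
    then obtain S where S: "S \<subseteq> {1..n}" "x \<in> chamber_of n S"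
      using generic_in_chamber by (auto simp: Wsl_def)
    then have "x \<in> ?Q S" using x sign_pattern.cell_eq[OF sp[OF S(1)]] by blast
    then show "x \<in> (\<Union>S\<in>Pow {1..n}. ?Q S)" using S by blast
  next
    fix x assume "x \<in> (\<Union>S\<in>Pow {1..n}. ?Q S)"
    then show "x \<in> regular_points (hsl n) (Wsl n) (weights n)"
      using sign_pattern.cell_eq[OF sp] unfolding regular_points_sl[OF n] by blast
  qed
  have nonempty: "?Q S \<noteq> {} \<longleftrightarrow> balanced n S" if "S \<subseteq> {1..n}" for S
    using sign_pattern.cell_nonempty_iff[OF sp[OF that]] n that by (simp add: balanced_def)
  have "components (regular_points (hsl n) (Wsl n) (weights n)) = ?Q ` {S \<in> Pow {1..n}. ?Q S \<noteq> {}}"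
  proof (rule components_disjoint_open_connected[OF R, of "hsl n"])
    fix S assume "S \<in> Pow {1..n}"
    then have S: "S \<subseteq> {1..n}" by simp
    show "openin (top_of_set (hsl n)) (?Q S)" by (rule sign_pattern.openin_cell[OF sp[OF S]])
    show "connected (?Q S)" by (rule convex_connected[OF sign_pattern.convex_cell[OF sp[OF S]]])
    fix S' assume "S' \<in> Pow {1..n}" "S \<noteq> S'"
    then show "?Q S \<inter> ?Q S' = {}"
      using sign_pattern_unique S sign_pattern.cell_eq[OF sp] by blast
  qed
  also have "{S \<in> Pow {1..n}. ?Q S \<noteq> {}} = {S. balanced n S}"
    using nonempty by (auto simp: balanced_def)
  finally have "sl_chambers n = (\<lambda>S. closure (?Q S)) ` {S. balanced n S}"
    by (simp add: sl_chambers_def chambers_def image_image)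
  also have "\<dots> = (\<lambda>S. chamber_of n S \<inter> hsl n) ` {S. balanced n S}"
  proof (rule image_cong[OF refl])
    fix S assume "S \<in> {S. balanced n S}"
    then have "S \<subseteq> {1..n}" "?Q S \<noteq> {}" using nonempty by (auto simp: balanced_def)
    then show "closure (?Q S) = chamber_of n S \<inter> hsl n"
      using sign_pattern.closure_cell[OF sp] by blast
  qed
  finally show "sl_chambers n = (\<lambda>S. chamber_of n S \<inter> hsl n) ` {S. balanced n S}" .
qed

section \<open>Counting lattice walks with one positive level\<close>

text \<open>
  The number of times at which the walk given by \<open>S\<close>, started at height \<open>h\<close>, is positive. The starting
  height is needed for the recursion on the first step, which is decided by \<open>n \<in> S\<close>.
\<close>
definition pos_count :: "nat \<Rightarrow> int \<Rightarrow> nat set \<Rightarrow> nat" where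
  "pos_count n h S = card {i \<in> {1..n}. h + level_sum n (char_vec S) i > 0}"

lemma card_shift:
  "card {i \<in> {1..Suc n}. P i} = of_bool (P 1) + card {i \<in> {1..n}. P (Suc i)}"
proof -
  have "{i \<in> {1..Suc n}. P i} = {i \<in> {1}. P i} \<union> Suc ` {i \<in> {1..n}. P (Suc i)}"
  proof (intro set_eqI iffI)
    fix i assume i: "i \<in> {i \<in> {1..Suc n}. P i}"
    then show "i \<in> {i \<in> {1}. P i} \<union> Suc ` {i \<in> {1..n}. P (Suc i)}"
      by (cases i; cases "i = 1") auto
  qed auto
  moreover have "card ({i \<in> {1}. P i} \<union> Suc ` {i \<in> {1..n}. P (Suc i)}) =
      card {i \<in> {1}. P i} + card (Suc ` {i \<in> {1..n}. P (Suc i)})"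
    by (intro card_Un_disjoint) auto
  moreover have "card {i \<in> {1::nat}. P i} = of_bool (P 1)"
  proof -
    have "{i \<in> {1::nat}. P i} = (if P 1 then {1} else {})" by auto
    then show ?thesis by simp
  qed
  moreover have "card (Suc ` {i \<in> {1..n}. P (Suc i)}) = card {i \<in> {1..n}. P (Suc i)}"
    by (intro card_image) simp
  ultimately show ?thesis by simp
qed

lemma level_sum_Suc:
  assumes "i \<le> n" shows "level_sum (Suc n) s (Suc i) = s (Suc n) + level_sum n s i"
proof -
  have "{Suc n - Suc i + 1..Suc n} = insert (Suc n) {n - i + 1..n}" using assms by auto
  then show ?thesis by (simp add: level_sum_def)
qed

lemma pos_count_0: "pos_count 0 h S = 0"
  by (simp add: pos_count_def)

lemma pos_count_Suc:
  "pos_count (Suc n) h S = of_bool (h + char_vec S (Suc n) > 0) + pos_count n (h + char_vec S (Suc n)) S"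
proof -
  have "level_sum (Suc n) (char_vec S) 1 = char_vec S (Suc n)"
    using level_sum_Suc[of 0 n "char_vec S"] by (simp add: level_sum_def)
  moreover have "{i \<in> {1..n}. h + level_sum (Suc n) (char_vec S) (Suc i) > 0} =
      {i \<in> {1..n}. h + char_vec S (Suc n) + level_sum n (char_vec S) i > 0}"
    by (intro Collect_cong) (auto simp: level_sum_Suc)
  ultimately show ?thesis unfolding pos_count_def card_shift by simp
qed

lemma pos_count_insert: "pos_count n h (insert (Suc n) S) = pos_count n h S"
proof -
  have "level_sum n (char_vec (insert (Suc n) S)) i = level_sum n (char_vec S) i" for i
    unfolding level_sum_def by (intro sum.cong) (auto simp: char_vec_def)
  then show ?thesis by (simp add: pos_count_def)
qed

definition walks :: "nat \<Rightarrow> nat \<Rightarrow> int \<Rightarrow> nat" where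
  "walks k n h = card {S \<in> Pow {1..n}. pos_count n h S = k}"

lemma walks_0: "walks k 0 h = of_bool (k = 0)"
proof -
  have "{S \<in> Pow {1..0}. pos_count 0 h S = k} = (if k = 0 then {{}} else {})"
    by (auto simp: pos_count_0)
  then show ?thesis by (simp add: walks_def)
qed

lemma walks_Suc:
  "walks k (Suc n) h =
     card {S \<in> Pow {1..n}. of_bool (h + 1 > 0) + pos_count n (h + 1) S = k} +
     card {S \<in> Pow {1..n}. of_bool (h - 1 > 0) + pos_count n (h - 1) S = k}"
proof -
  let ?U = "{S \<in> Pow {1..n}. of_bool (h + 1 > 0) + pos_count n (h + 1) S = k}"
  let ?D = "{S \<in> Pow {1..n}. of_bool (h - 1 > 0) + pos_count n (h - 1) S = k}"
  have up: "pos_count (Suc n) h (insert (Suc n) S) = of_bool (h + 1 > 0) + pos_count n (h + 1) S" for S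
    by (simp add: pos_count_Suc pos_count_insert char_vec_def)
  have down: "pos_count (Suc n) h S = of_bool (h - 1 > 0) + pos_count n (h - 1) S" if "S \<subseteq> {1..n}" for S
  proof -
    have "Suc n \<notin> S" using that by auto
    then show ?thesis by (simp add: pos_count_Suc char_vec_def)
  qed
  have Pow: "Pow {1..Suc n} = Pow {1..n} \<union> insert (Suc n) ` Pow {1..n}"
    by (metis Pow_insert atLeastAtMostSuc_conv le_add1 plus_1_eq_Suc)
  have "{S \<in> Pow {1..Suc n}. pos_count (Suc n) h S = k} = insert (Suc n) ` ?U \<union> ?D"
    unfolding Pow using up down by auto
  moreover have "card (insert (Suc n) ` ?U \<union> ?D) = card (insert (Suc n) ` ?U) + card ?D"
    by (intro card_Un_disjoint) auto
  moreover have "card (insert (Suc n) ` ?U) = card ?U"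
  proof (intro card_image inj_onI)
    fix A B assume AB: "A \<in> ?U" "B \<in> ?U" "insert (Suc n) A = insert (Suc n) B"
    then have "Suc n \<notin> A" "Suc n \<notin> B" by auto
    then show "A = B" using AB(3) by (simp add: insert_ident)
  qed
  ultimately show ?thesis by (simp add: walks_def)
qed

lemma walks_zero_Suc:
  "walks 0 (Suc n) h = (if h + 1 > 0 then 0 else walks 0 n (h + 1)) + (if h - 1 > 0 then 0 else walks 0 n (h - 1))"
  unfolding walks_Suc by (simp add: walks_def)

lemma walks_one_Suc:
  "walks 1 (Suc n) h = (if h + 1 > 0 then walks 0 n (h + 1) else walks 1 n (h + 1)) +
     (if h - 1 > 0 then walks 0 n (h - 1) else walks 1 n (h - 1))"
  unfolding walks_Suc by (simp add: walks_def)

text \<open>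
  Heights are at most zero here, and \<open>d\<close> is the depth of the starting point below zero.
\<close>
definition nonpos_walks :: "nat \<Rightarrow> nat \<Rightarrow> nat" where
  "nonpos_walks n d = walks 0 n (- int d)"

definition single_pos_walks :: "nat \<Rightarrow> nat \<Rightarrow> nat" where
  "single_pos_walks n d = walks 1 n (- int d)"

lemma nonpos_walks_rec:
  "nonpos_walks 0 d = 1"
  "nonpos_walks (Suc n) 0 = nonpos_walks n 1"
  "nonpos_walks (Suc n) (Suc d) = nonpos_walks n d + nonpos_walks n (d + 2)"
  by (simp_all add: nonpos_walks_def walks_0 walks_zero_Suc)

lemma single_pos_walks_rec:
  "single_pos_walks 0 d = 0"
  "single_pos_walks (Suc 0) 0 = 1"
  "single_pos_walks (Suc (Suc n)) 0 = single_pos_walks (Suc n) 1 + nonpos_walks n 0"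
  "single_pos_walks (Suc n) (Suc d) = single_pos_walks n d + single_pos_walks n (d + 2)"
  by (simp_all add: single_pos_walks_def nonpos_walks_def walks_0 walks_zero_Suc
      walks_one_Suc[unfolded One_nat_def])

text \<open>
  Cut such a walk at its first arrival at height zero. This suggests that walks from depth \<open>d\<close> which are positive
  exactly once correspond to walks, one step shorter, which are never positive and do reach zero; the
  latter are counted by a difference. Once guessed, the identity follows from the recursions.
\<close>
lemma single_pos_walks_eq:
  "single_pos_walks (Suc m) 0 = nonpos_walks m 0"
  "single_pos_walks (Suc m) (Suc d) + nonpos_walks m d = nonpos_walks m (Suc d)"
proof (induction m arbitrary: d)
  case 0
  show "single_pos_walks (Suc 0) 0 = nonpos_walks 0 0"
    by (simp add: single_pos_walks_rec nonpos_walks_rec)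
  show "single_pos_walks (Suc 0) (Suc d) + nonpos_walks 0 d = nonpos_walks 0 (Suc d)" for d
    by (simp add: single_pos_walks_rec nonpos_walks_rec)
next
  case (Suc m)
  show "single_pos_walks (Suc (Suc m)) 0 = nonpos_walks (Suc m) 0"
    using Suc.IH(2)[of 0] by (simp add: single_pos_walks_rec(3) nonpos_walks_rec)
  show "single_pos_walks (Suc (Suc m)) (Suc d) + nonpos_walks (Suc m) d = nonpos_walks (Suc m) (Suc d)" for d
    using Suc.IH(1) Suc.IH(2)[of "d - 1"] Suc.IH(2)[of "d + 1"]
    by (cases d) (simp_all add: single_pos_walks_rec(4)[of "Suc m"] nonpos_walks_rec(2,3))
qed

text \<open>
  Integer arguments keep the sums below free of boundary cases.
\<close>
definition int_binomial :: "nat \<Rightarrow> int \<Rightarrow> nat" where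
  "int_binomial m w = (if w < 0 then 0 else m choose nat w)"

lemma int_binomial_Suc: "int_binomial (Suc m) w = int_binomial m w + int_binomial m (w - 1)"
proof (cases "w \<le> 0")
  case False
  then obtain k where "w = int (Suc k)" by (metis not_le pos_int_cases gr0_implies_Suc of_nat_0_less_iff)
  then show ?thesis by (simp add: int_binomial_def nat_add_distrib)
qed (auto simp: int_binomial_def)

text \<open>
  The reflection principle gives this sum of \<open>d + 1\<close> consecutive binomial coefficients around the middle; the
  proof checks that it satisfies the recursion, by Pascal's rule.
\<close>
lemma nonpos_walks_eq:
  "nonpos_walks m d = (\<Sum>w = (int m - int d) div 2..(int m + int d) div 2. int_binomial m w)"
proof (induction m arbitrary: d)
  case 0
  have "(\<Sum>w = (int 0 - int d) div 2..(int 0 + int d) div 2. int_binomial 0 w) = (\<Sum>w\<in>{0}. int_binomial 0 w)"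
    by (intro sum.mono_neutral_right) (auto simp: int_binomial_def)
  then show ?case by (simp add: nonpos_walks_rec int_binomial_def)
next
  case (Suc m)
  show ?case
  proof (cases d)
    case 0
    define A where "A = (int m + 1) div 2"
    have A: "(int (Suc m) - int d) div 2 = A" "(int (Suc m) + int d) div 2 = A"
      "(int m - int 1) div 2 = A - 1" "(int m + int 1) div 2 = A"
      using 0 by (simp_all add: A_def)
    have "{A - 1..A} = {A - 1, A}" by auto
    then have "nonpos_walks (Suc m) d = int_binomial m (A - 1) + int_binomial m A"
      unfolding 0 nonpos_walks_rec Suc.IH A by simp
    then show ?thesis unfolding A by (simp add: int_binomial_Suc)
  next
    case (Suc e)
    define A where "A = (int m - int e) div 2"
    define B where "B = (int m + int e) div 2 + 1"
    have A: "(int (Suc m) - int d) div 2 = A" "(int m - int (e + 2)) div 2 = A - 1"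
      using Suc by (simp_all add: A_def)
    have B: "(int (Suc m) + int d) div 2 = B" "(int m + int (e + 2)) div 2 = B" "(int m + int e) div 2 = B - 1"
      using Suc by (simp_all add: B_def)
    have AB: "A \<le> B" by (simp add: A_def B_def)
    have split: "{A - 1..B} = insert (A - 1) {A..B}" "{A - 1..B - 1} = insert (A - 1) {A..B - 1}"
      using AB by auto
    have shift: "(\<Sum>w = A..B. int_binomial m (w - 1)) = (\<Sum>w = A - 1..B - 1. int_binomial m w)"
      by (rule sum.reindex_bij_witness[of _ "\<lambda>w. w + 1" "\<lambda>w. w - 1"]) auto
    have "nonpos_walks (Suc m) d = (\<Sum>w = A..B - 1. int_binomial m w) + (\<Sum>w = A - 1..B. int_binomial m w)"
      unfolding Suc nonpos_walks_rec Suc.IH B A_def[symmetric] A ..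
    also have "\<dots> = (\<Sum>w = A - 1..B - 1. int_binomial m w) + (\<Sum>w = A..B. int_binomial m w)"
      unfolding split by simp
    also have "\<dots> = (\<Sum>w = A..B. int_binomial (Suc m) w)"
      unfolding int_binomial_Suc sum.distrib shift by simp
    finally show ?thesis unfolding A B .
  qed
qed

lemma nonpos_walks_central: "nonpos_walks m 0 = m choose (m div 2)"
proof -
  have "nat (int m div 2) = m div 2" by (simp add: nat_div_distrib)
  then show ?thesis by (simp add: nonpos_walks_eq int_binomial_def)
qed

lemma card_single_pos:
  assumes "n \<ge> 1" shows "card {S \<in> Pow {1..n}. pos_count n 0 S = 1} = (n - 1) choose ((n - 1) div 2)"
proof -
  obtain m where "n = Suc m" using assms by (cases n) auto
  then show ?thesis using single_pos_walks_eq(1)[of m] nonpos_walks_central[of m]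
    by (simp add: single_pos_walks_def walks_def)
qed

text \<open>
  Odd levels are never null, so a walk of length \<open>n\<close> has at least \<open>\<lceil>n / 2\<rceil>\<close> levels that are not null.
\<close>
lemma level_sum_parity: "i \<le> n \<Longrightarrow> even (level_sum n (char_vec S) i) \<longleftrightarrow> even i"
proof (induction i arbitrary: n)
  case 0
  then show ?case by (simp add: level_sum_def)
next
  case (Suc i)
  then obtain m where m: "n = Suc m" by (cases n) auto
  have "odd (char_vec S (Suc m))" by (simp add: char_vec_def)
  then show ?case using Suc m level_sum_Suc[of i m "char_vec S"] by simp
qed

lemma level_sum_uminus: "level_sum n (char_vec (- S)) i = - level_sum n (char_vec S) i"
  by (simp add: level_sum_def sum_negf[symmetric] char_vec_def if_distrib[of uminus]) (intro sum.cong; auto)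

lemma level_sum_Diff: "level_sum n (char_vec ({1..n} - S)) i = - level_sum n (char_vec S) i"
  unfolding level_sum_def sum_negf[symmetric] by (intro sum.cong) (auto simp: char_vec_def)

lemma card_positive: "card {i. positive_level n (char_vec S) i} = pos_count n 0 S"
  unfolding pos_count_def positive_level_def by (rule arg_cong[of _ _ card]) auto

lemma card_negative: "card {i. negative_level n (char_vec S) i} = pos_count n 0 (- S)"
  unfolding pos_count_def negative_level_def level_sum_uminus by (rule arg_cong[of _ _ card]) auto

lemma odd_levels_nonnull:
  assumes "odd i" "i \<le> n"
  shows "positive_level n (char_vec S) i \<or> negative_level n (char_vec S) i"
proof -
  have "level_sum n (char_vec S) i \<noteq> 0" using level_sum_parity[OF assms(2), of S] assms(1) by auto
  then show ?thesis using assms unfolding positive_level_def negative_level_def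
    by (metis linorder_neqE odd_pos Suc_leI One_nat_def)
qed

lemma pos_count_numeral:
  "pos_count (numeral k) h S = of_bool (h + char_vec S (numeral k) > 0) +
     pos_count (pred_numeral k) (h + char_vec S (numeral k)) S"
  unfolding numeral_eq_Suc by (rule pos_count_Suc)

lemma single_pos_single_neg_3:
  assumes "S \<subseteq> {1..3}" shows "pos_count 3 0 S = 1 \<and> pos_count 3 0 (- S) = 1 \<longleftrightarrow> S = {3} \<or> S = {1, 2}"
proof -
  have S: "S \<subseteq> {1, 2, 3}"
    using assms by fastforce
  have "pos_count 3 0 S = 1 \<and> pos_count 3 0 (- S) = 1 \<longleftrightarrow>
    (3 \<in> S \<and> 2 \<notin> S \<and> 1 \<notin> S) \<or> (3 \<notin> S \<and> 2 \<in> S \<and> 1 \<in> S)"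
    by (cases "1 \<in> S"; cases "2 \<in> S"; cases "3 \<in> S")
      (simp_all add: pos_count_numeral pos_count_Suc pos_count_0 char_vec_def)
  moreover have "S = {3} \<longleftrightarrow> 3 \<in> S \<and> 2 \<notin> S \<and> 1 \<notin> S" "S = {1, 2} \<longleftrightarrow> 3 \<notin> S \<and> 2 \<in> S \<and> 1 \<in> S"
    using S by auto
  ultimately show ?thesis by simp
qed

lemma single_pos_single_neg_4:
  assumes "S \<subseteq> {1..4}" shows "pos_count 4 0 S = 1 \<and> pos_count 4 0 (- S) = 1 \<longleftrightarrow> S = {1, 4} \<or> S = {2, 3}"
proof -
  have S: "S \<subseteq> {1, 2, 3, 4}"
    using assms by fastforce
  have "pos_count 4 0 S = 1 \<and> pos_count 4 0 (- S) = 1 \<longleftrightarrow>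
    (4 \<in> S \<and> 3 \<notin> S \<and> 2 \<notin> S \<and> 1 \<in> S) \<or> (4 \<notin> S \<and> 3 \<in> S \<and> 2 \<in> S \<and> 1 \<notin> S)"
    by (cases "1 \<in> S"; cases "2 \<in> S"; cases "3 \<in> S"; cases "4 \<in> S")
      (simp_all add: pos_count_numeral pos_count_Suc pos_count_0 char_vec_def)
  moreover have "S = {1, 4} \<longleftrightarrow> 4 \<in> S \<and> 3 \<notin> S \<and> 2 \<notin> S \<and> 1 \<in> S"
      "S = {2, 3} \<longleftrightarrow> 4 \<notin> S \<and> 3 \<in> S \<and> 2 \<in> S \<and> 1 \<notin> S"
    using S by auto
  ultimately show ?thesis by simp
qed

text \<open>
  The times \<open>1\<close>, \<open>3\<close>, \<open>5\<close> are not null, so from \<open>n = 5\<close> on one of the two counts exceeds one.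
\<close>
lemma card_single_pos_single_neg:
  assumes "n \<ge> 3"
  shows "card {S \<in> Pow {1..n}. pos_count n 0 S = 1 \<and> pos_count n 0 (- S) = 1} =
    2 * of_bool (n = 3) + 2 * of_bool (n = 4)"
proof -
  consider "n = 3" | "n = 4" | "n \<ge> 5" using assms by linarith
  then show ?thesis
  proof cases
    case 1
    have "{S \<in> Pow {1..3}. pos_count 3 0 S = 1 \<and> pos_count 3 0 (- S) = 1} = {{3}, {1, 2::nat}}"
    proof (intro set_eqI)
      fix S :: "nat set"
      have "S = {3} \<or> S = {1, 2} \<Longrightarrow> S \<subseteq> {1..3}" by force
      then show "S \<in> {S \<in> Pow {1..3}. pos_count 3 0 S = 1 \<and> pos_count 3 0 (- S) = 1} \<longleftrightarrow> S \<in> {{3}, {1, 2}}"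
        using single_pos_single_neg_3[of S] unfolding mem_Collect_eq Pow_iff insert_iff empty_iff by metis
    qed
    then show ?thesis using 1 by (simp add: doubleton_eq_iff insert_eq_iff)
  next
    case 2
    have "{S \<in> Pow {1..4}. pos_count 4 0 S = 1 \<and> pos_count 4 0 (- S) = 1} = {{1, 4}, {2, 3::nat}}"
    proof (intro set_eqI)
      fix S :: "nat set"
      have "S = {1, 4} \<or> S = {2, 3} \<Longrightarrow> S \<subseteq> {1..4}" by force
      then show "S \<in> {S \<in> Pow {1..4}. pos_count 4 0 S = 1 \<and> pos_count 4 0 (- S) = 1} \<longleftrightarrow> S \<in> {{1, 4}, {2, 3}}"
        using single_pos_single_neg_4[of S] unfolding mem_Collect_eq Pow_iff insert_iff empty_iff by metis
    qed
    then show ?thesis using 2 by (simp add: doubleton_eq_iff)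
  next
    case 3
    have "\<not> (pos_count n 0 S = 1 \<and> pos_count n 0 (- S) = 1)" for S
    proof
      assume a: "pos_count n 0 S = 1 \<and> pos_count n 0 (- S) = 1"
      let ?P = "{i. positive_level n (char_vec S) i}" and ?N = "{i. negative_level n (char_vec S) i}"
      have "{1, 3, 5} \<subseteq> ?P \<union> ?N" using odd_levels_nonnull[of _ n S] 3 by auto
      moreover have fin: "finite ?P" "finite ?N" by (simp_all add: positive_level_def negative_level_def)
      ultimately have "card {1, 3, 5 :: nat} \<le> card (?P \<union> ?N)" by (intro card_mono) auto
      also have "\<dots> \<le> card ?P + card ?N" by (rule card_Un_le)
      finally show False using a by (simp add: card_positive card_negative)
    qed
    then show ?thesis using 3 by simp
  qed
qed

text \<open>
  Inclusion and exclusion for the walks that are positive once and those that are negative once, which are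
  exchanged by complementation. Neither count can be zero when the other one is one, because the
  levels \<open>1\<close> and \<open>3\<close> are not null.
\<close>
lemma card_min_one:
  assumes n: "n \<ge> 3"
  shows "card {S \<in> Pow {1..n}.
      min (card {i. positive_level n (char_vec S) i}) (card {i. negative_level n (char_vec S) i}) = 1} +
    2 * of_bool (n = 3) + 2 * of_bool (n = 4) = 2 * ((n - 1) choose ((n - 1) div 2))"
proof -
  define X where "X = {S \<in> Pow {1..n}. pos_count n 0 S = 1}"
  define Y where "Y = {S \<in> Pow {1..n}. pos_count n 0 (- S) = 1}"
  have fin: "finite X" "finite Y" by (simp_all add: X_def Y_def)
  have compl: "pos_count n 0 ({1..n} - S) = pos_count n 0 (- S)" for S
    unfolding pos_count_def level_sum_uminus level_sum_Diff by simp
  have compl': "pos_count n 0 (- ({1..n} - S)) = pos_count n 0 S" for S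
    unfolding pos_count_def level_sum_uminus level_sum_Diff by simp
  have "bij_betw (\<lambda>S. {1..n} - S) X Y"
  proof (rule bij_betw_byWitness[where f' = "\<lambda>S. {1..n} - S"])
    show "(\<lambda>S. {1..n} - S) ` X \<subseteq> Y"
    proof (rule image_subsetI)
      fix S assume "S \<in> X"
      then show "{1..n} - S \<in> Y" unfolding X_def Y_def using compl'[of S] by simp
    qed
    show "(\<lambda>S. {1..n} - S) ` Y \<subseteq> X"
    proof (rule image_subsetI)
      fix S assume "S \<in> Y"
      then show "{1..n} - S \<in> X" unfolding X_def Y_def using compl[of S] by simp
    qed
  qed (auto simp: X_def Y_def)
  then have "card Y = card X" by (simp add: bij_betw_same_card)
  moreover have "card X = (n - 1) choose ((n - 1) div 2)" using card_single_pos n by (simp add: X_def)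
  moreover have "card (X \<union> Y) + card (X \<inter> Y) = card X + card Y" using card_Un_Int fin by metis
  moreover have "X \<inter> Y = {S \<in> Pow {1..n}. pos_count n 0 S = 1 \<and> pos_count n 0 (- S) = 1}"
    by (auto simp: X_def Y_def)
  moreover have "X \<union> Y = {S \<in> Pow {1..n}.
     min (card {i. positive_level n (char_vec S) i}) (card {i. negative_level n (char_vec S) i}) = 1}"
  proof -
    have "min (pos_count n 0 S) (pos_count n 0 (- S)) = 1 \<longleftrightarrow> pos_count n 0 S = 1 \<or> pos_count n 0 (- S) = 1" for S
    proof -
      let ?P = "{i. positive_level n (char_vec S) i}" and ?N = "{i. negative_level n (char_vec S) i}"
      have fin: "finite ?P" "finite ?N" by (simp_all add: positive_level_def negative_level_def)
      have sub: "{1, 3} \<subseteq> ?P \<union> ?N" using odd_levels_nonnull[of _ n S] n by auto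
      have "card ?N > 0" if "card ?P = 1"
      proof (rule ccontr)
        assume "\<not> card ?N > 0"
        then have "?N = {}" using fin by simp
        then have "card {1, 3::nat} \<le> card ?P" using sub fin by (intro card_mono) auto
        then show False using that by simp
      qed
      moreover have "card ?P > 0" if "card ?N = 1"
      proof (rule ccontr)
        assume "\<not> card ?P > 0"
        then have "?P = {}" using fin by simp
        then have "card {1, 3::nat} \<le> card ?N" using sub fin by (intro card_mono) auto
        then show False using that by simp
      qed
      ultimately show ?thesis by (auto simp: card_positive card_negative min_def)
    qed
    then show ?thesis by (auto simp: X_def Y_def card_positive card_negative)
  qed
  ultimately show ?thesis using card_single_pos_single_neg[OF n] by simp
qed

section \<open>The number of simplicial chambers\<close>

text \<open>
  In ranks one and two a weight can vanish identically on the hyperplane, so the description by cells does not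
  apply. The set of regular points is then a single open cone: the origin, or an open half-line.
\<close>
lemma sl_chambers_small:
  assumes n: "n = 1 \<or> n = 2"
  obtains K where "sl_chambers n = {K}" "simplicial n K"
proof -
  define T where "T i x = coord x i - coord x (i + 1)" for i x
  define e :: "nat \<Rightarrow> vec0" where
    "e i = (1 / 2) *\<^sub>R (Poly_Mapping.single 1 1 - Poly_Mapping.single 2 1)" for i
  have ce: "coord (e i) j = (of_bool (j = 1) - of_bool (j = 2)) / 2" for i j
    by (simp add: e_def lookup_minus lookup_single when_def)
  have lin: "linear (T i)" for i unfolding T_def by (intro linear_compose_sub linear_coord)
  interpret simplicial_cone "hsl n" "{1..<n}" e T
  proof (rule simplicial_cone.intro)
    show "subspace (hsl n)" by (rule subspace_hsl)
    show "e i \<in> hsl n" if "i \<in> {1..<n}" for i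
    proof -
      have "n = 2" using that n by auto
      then show ?thesis by (auto simp: hsl_def hgl_iff sigv_def ce eval_nat_numeral)
    qed
    show "T i (e j) = of_bool (i = j)" if "i \<in> {1..<n}" "j \<in> {1..<n}" for i j
    proof -
      have "i = 1" "j = 1" using that n by auto
      then show ?thesis by (simp add: T_def ce)
    qed
    fix x assume x: "x \<in> hsl n"
    show "x = (\<Sum>i = 1..<n. T i x *\<^sub>R e i)"
    proof (rule poly_mapping_eqI)
      fix j
      have out: "coord x j = 0" if "j \<notin> {1..n}" using x that by (auto simp: hsl_def hgl_iff)
      have 0: "(\<Sum>i = 1..n. coord x i) = 0" using x by (simp add: hsl_def sigv_def)
      show "coord x j = coord (\<Sum>i = 1..<n. T i x *\<^sub>R e i) j"
      proof (cases "n = 1")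
        case True
        then show ?thesis using out 0 by (cases "j = 1") auto
      next
        case False
        then have n2: "n = 2" using n by simp
        then have "coord x 1 + coord x 2 = 0" using 0 by (simp add: eval_nat_numeral)
        then have x2: "coord x 2 = - coord x 1" by simp
        have "{1..<n} = {1::nat}" using n2 by auto
        then have "coord (\<Sum>i = 1..<n. T i x *\<^sub>R e i) j = T 1 x * coord (e 1) j"
          by (simp add: coord_sum)
        also have "T 1 x = 2 * coord x 1" unfolding T_def using x2 by (simp add: eval_nat_numeral)
        finally have rhs: "coord (\<Sum>i = 1..<n. T i x *\<^sub>R e i) j = coord x 1 * (of_bool (j = 1) - of_bool (j = 2))"
          by (simp add: ce)
        show ?thesis
        proof (cases "j \<in> {1..n}")
          case True
          then have "j = 1 \<or> j = 2" using n2 by auto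
          then show ?thesis unfolding rhs using x2 by auto
        next
          case False
          then have "j \<noteq> 1" "j \<noteq> 2" using n2 by auto
          then show ?thesis unfolding rhs using out[OF False] by simp
        qed
      qed
    qed
  qed (use lin in auto)
  have R: "regular_points (hsl n) (Wsl n) (weights n) = {x \<in> hsl n. \<forall>i\<in>{1..<n}. T i x > 0}"
  proof -
    have "f x \<noteq> 0" if f: "f \<in> weights n" "y \<in> hsl n" "f y \<noteq> 0"
      and x: "x \<in> hsl n" "\<forall>i\<in>{1..<n}. T i x > 0" for f x y
    proof (cases "n = 1")
      case True
      then have "coord y 1 = 0" using f(2) by (simp add: hsl_def sigv_def)
      then show ?thesis using f True by (auto simp: weights_def)
    next
      case False
      then have n2: "n = 2" using n by simp
      have "coord y 1 + coord y 2 = 0" "coord x 1 + coord x 2 = 0"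
        using f(2) x(1) unfolding n2 by (simp_all add: hsl_def sigv_def eval_nat_numeral)
      moreover have "coord x 1 > coord x 2" using x(2) n2 by (simp add: T_def eval_nat_numeral)
      moreover from f(1) have "f = (\<lambda>x. coord x 1) \<or> f = (\<lambda>x. coord x 2) \<or> f = (\<lambda>x. coord x 1 + coord x 2)"
      proof -
        have "i = 1 \<or> i = 2" if "1 \<le> i" "i \<le> 2" for i :: nat using that by linarith
        moreover have "i = 1 \<and> j = 2" if "1 \<le> i" "i < j" "j \<le> 2" for i j :: nat using that by linarith
        ultimately show ?thesis using f(1) unfolding n2 weights_def by blast
      qed
      ultimately show ?thesis using f(3) by auto
    qed
    then show ?thesis unfolding regular_points_def interior_Wsl by (auto simp: T_def)
  qed
  define s where "s = (\<Sum>i = 1..<n. e i)"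
  have "s \<in> hsl n" unfolding s_def by (intro subspace_sum subspace_hsl eV)
  moreover have "T i s > 0" if i: "i \<in> {1..<n}" for i
  proof -
    have "T i s = (\<Sum>j = 1..<n. of_bool (i = j))"
      unfolding s_def linear_sum[OF lin] using i by (intro sum.cong) (simp_all only: dual)
    then show ?thesis using i by (simp add: of_bool_def)
  qed
  ultimately have ne: "{x \<in> hsl n. \<forall>i\<in>{1..<n}. T i x > 0} \<noteq> {}" by blast
  have "components {x \<in> hsl n. \<forall>i\<in>{1..<n}. T i x > 0} = {{x \<in> hsl n. \<forall>i\<in>{1..<n}. T i x > 0}}"
    unfolding components_eq_sing_iff using ne subspace_hsl lin
    by (intro conjI convex_connected convex_open_cone)
  moreover have "closure {x \<in> hsl n. \<forall>i\<in>{1..<n}. T i x > 0} = orthant"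
    unfolding orthant_def using ne
    by (intro closure_open_cone closed_hsl subspace_hsl conjI lin)
      (auto simp: T_def intro!: continuous_intros)
  ultimately have "sl_chambers n = {orthant}"
    by (simp add: sl_chambers_def chambers_def R)
  moreover have "simplicial n orthant" by (rule simplicial_orthant) simp
  ultimately show ?thesis by (rule that)
qed

lemma num_simplicial_small: assumes "n = 1 \<or> n = 2" shows "num_simplicial n = 1"
proof -
  obtain K where K: "sl_chambers n = {K}" "simplicial n K" using sl_chambers_small[OF assms] .
  then have "{L \<in> sl_chambers n. simplicial n L} = {K}" by auto
  then show ?thesis by (simp add: num_simplicial_def)
qed

context sign_pattern begin

lemma level_card:
  "card {l \<in> {1..n}. sigv n (level_ray n S l) > 0} = card {i. positive_level n (char_vec S) i}"
  "card {l \<in> {1..n}. sigv n (level_ray n S l) < 0} = card {i. negative_level n (char_vec S) i}"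
  "card {l \<in> {1..n}. sigv n (level_ray n S l) = 0} = card {i. null_level n (char_vec S) i}"
  by (intro arg_cong[of _ _ card] Collect_cong;
      auto simp: positive_level_def negative_level_def null_level_def sigv_level_ray)+

lemma card_extreme_rays:
  "card {F. extreme_ray F (chamber_of n S \<inter> hsl n)} =
     card {i. positive_level n (char_vec S) i} * card {i. negative_level n (char_vec S) i} +
     card {i. null_level n (char_vec S) i}"
  unfolding chamber_of_eq_orthant slice_eq card_extreme_rays_slice[OF linear_sigv] level_card ..

lemma simplicial_chamber_iff:
  assumes "balanced n S"
  shows "simplicial n (chamber_of n S \<inter> hsl n) \<longleftrightarrow>
    min (card {i. positive_level n (char_vec S) i}) (card {i. negative_level n (char_vec S) i}) = 1"
proof -
  obtain i j where i: "positive_level n (char_vec S) i" and j: "negative_level n (char_vec S) j"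
    using assms unfolding balanced_def by blast
  have ij: "i \<in> {1..n}" "j \<in> {1..n}"
    using i j by (simp_all add: positive_level_def negative_level_def)
  have "sigv n (level_ray n S i) > 0" "sigv n (level_ray n S j) < 0"
    using i j unfolding sigv_level_ray[OF ij(1)] sigv_level_ray[OF ij(2)]
    by (simp_all add: positive_level_def negative_level_def)
  from simplicial_slice_iff[OF linear_sigv ij(1) this(1) ij(2) this(2)]
  show ?thesis unfolding chamber_of_eq_orthant slice_eq level_card by simp
qed

end

lemma num_simplicial_eq:
  assumes n: "n \<ge> 3"
  shows "num_simplicial n = card {S \<in> Pow {1..n}.
    min (card {i. positive_level n (char_vec S) i}) (card {i. negative_level n (char_vec S) i}) = 1}"
proof -
  let ?m = "\<lambda>S. min (card {i. positive_level n (char_vec S) i}) (card {i. negative_level n (char_vec S) i})"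
  let ?f = "\<lambda>S. chamber_of n S \<inter> hsl n"
  have sp: "sign_pattern n S" if "balanced n S" for S
    using that by unfold_locales (simp add: balanced_def)
  have A: "{S \<in> Pow {1..n}. ?m S = 1} = {S. balanced n S \<and> ?m S = 1}"
  proof -
    have "A \<noteq> {} \<and> B \<noteq> {}" if "min (card A) (card B) = 1" for A B :: "nat set"
      using that by (auto simp: min_def split: if_splits)
    then show ?thesis unfolding balanced_def by blast
  qed
  have "{K \<in> sl_chambers n. simplicial n K} = ?f ` {S. balanced n S \<and> ?m S = 1}"
    unfolding sl_chambers_eq[OF n] using sign_pattern.simplicial_chamber_iff[OF sp] by blast
  moreover have "inj_on ?f {S. balanced n S \<and> ?m S = 1}"
  proof (rule inj_onI)
    fix S S' assume "S \<in> {S. balanced n S \<and> ?m S = 1}" "S' \<in> {S. balanced n S \<and> ?m S = 1}" "?f S = ?f S'"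
    then show "S = S'" using chamber_slice_unique[of n S S'] n by (auto simp: balanced_def)
  qed
  ultimately show ?thesis unfolding num_simplicial_def A by (simp add: card_image)
qed

lemma num_simplicial_formula:
  assumes "n \<ge> 1"
  shows "int (num_simplicial n) = 2 * int ((n - 1) choose ((n - 1) div 2))
    - of_bool (n = 1) - of_bool (n = 2) - 2 * of_bool (n = 3) - 2 * of_bool (n = 4)"
proof (cases "n \<ge> 3")
  case True
  have "int (num_simplicial n + 2 * of_bool (n = 3) + 2 * of_bool (n = 4)) =
      int (2 * ((n - 1) choose ((n - 1) div 2)))"
    unfolding num_simplicial_eq[OF True] card_min_one[OF True] ..
  then show ?thesis using True by (simp add: of_bool_def split: if_splits)
next
  case False
  then have n: "n = 1 \<or> n = 2" using assms by linarith
  then show ?thesis using num_simplicial_small[OF n] by auto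
qed

section \<open>The generating function\<close>

text \<open>
  The power series of \<open>1 / sqrt (1 - 4x\<^sup>2)\<close>.
\<close>
definition central_fps :: "real fps" where
  "central_fps = Abs_fps (\<lambda>n. if even n then real (n choose (n div 2)) else 0)"

lemma central_binomial_Suc:
  "Suc k * ((2 * Suc k) choose Suc k) = 2 * (2 * k + 1) * ((2 * k) choose k)"
proof -
  define M where "M = (2 * k + 1) choose k"
  define C where "C = (2 * k) choose k"
  have dbl: "2 * Suc k = Suc (2 * k + 1)" by simp
  have "Suc k * ((2 * Suc k) choose Suc k) = Suc (2 * k + 1) * M"
    unfolding M_def dbl by (rule Suc_times_binomial)
  also have "\<dots> = 2 * (Suc k * M)" by (simp add: algebra_simps)
  also have "M = Suc (2 * k) choose Suc k"
    unfolding M_def using binomial_symmetric[of k "2 * k + 1"] by simp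
  then have "Suc k * M = Suc (2 * k) * C" unfolding C_def using Suc_times_binomial[of k "2 * k"] by simp
  finally show ?thesis unfolding C_def[symmetric] by (simp add: algebra_simps)
qed

lemma central_fps_deriv:
  "fps_deriv central_fps * (1 - 4 * fps_X ^ 2) = 4 * fps_X * central_fps"
proof (rule fps_ext)
  fix n
  let ?c = "\<lambda>n. central_fps $ n"
  have L: "(fps_deriv central_fps * (1 - 4 * fps_X ^ 2)) $ n =
      real (n + 1) * ?c (n + 1) - (if n < 2 then 0 else 4 * (real (n - 1) * ?c (n - 1)))"
  proof -
    have eq: "fps_deriv central_fps * (1 - 4 * fps_X ^ 2) =
        fps_deriv central_fps - fps_const 4 * (fps_deriv central_fps * fps_X ^ 2)"
      by (simp add: algebra_simps numeral_fps_const)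
    show ?thesis
    proof (cases "n < 2")
      case True
      then show ?thesis unfolding eq by (simp add: fps_X_power_mult_right_nth)
    next
      case False
      then obtain k where "n = Suc (Suc k)" by (metis add_2_eq_Suc le_Suc_ex not_less)
      then show ?thesis unfolding eq by (simp add: fps_X_power_mult_right_nth)
    qed
  qed
  have R: "(4 * fps_X * central_fps) $ n = (if n = 0 then 0 else 4 * ?c (n - 1))"
    by (simp add: numeral_fps_const mult.assoc)
  consider "even n" | "n = 1" | k where "n = 2 * Suc k + 1"
  proof (cases "even n")
    case False
    then obtain m where "n = 2 * m + 1" by (rule oddE)
    then show ?thesis using that(2,3) by (cases m) auto
  qed (use that in blast)
  then show "(fps_deriv central_fps * (1 - 4 * fps_X ^ 2)) $ n = (4 * fps_X * central_fps) $ n"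
  proof cases
    case 1
    then show ?thesis unfolding L R by (auto simp: central_fps_def)
  next
    case 2
    then show ?thesis unfolding L R by (simp add: central_fps_def)
  next
    case (3 k)
    define A where "A = (2 * Suc (Suc k)) choose Suc (Suc k)"
    define B where "B = (2 * Suc k) choose Suc k"
    have c: "?c (n + 1) = real A" "?c (n - 1) = real B"
      unfolding 3 central_fps_def A_def B_def by simp_all
    have "Suc (Suc k) * A = 2 * (2 * Suc k + 1) * B"
      unfolding A_def B_def by (rule central_binomial_Suc)
    then have "real (Suc (Suc k) * A) = real (2 * (2 * Suc k + 1) * B)" by (rule arg_cong)
    then have "real (n + 1) * real A = 4 * real n * real B" unfolding 3 by (simp add: algebra_simps)
    moreover have "n \<ge> 2" "real (n - 1) = real n - 1" using 3 by simp_all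
    ultimately show ?thesis unfolding L R c by (simp add: algebra_simps)
  qed
qed

text \<open>
  By the differential equation the left-hand side has derivative zero.
\<close>
lemma central_fps_square: "central_fps ^ 2 * (1 - 4 * fps_X ^ 2) = 1"
proof -
  let ?E = "central_fps ^ 2 * (1 - 4 * fps_X ^ 2)"
  have d: "fps_deriv (1 - 4 * fps_X ^ 2 :: real fps) = - (8 * fps_X)"
    by (simp add: fps_deriv_power numeral_fps_const)
  have "fps_deriv ?E = 2 * central_fps * (fps_deriv central_fps * (1 - 4 * fps_X ^ 2)) +
      central_fps ^ 2 * fps_deriv (1 - 4 * fps_X ^ 2)"
    by (simp add: power2_eq_square algebra_simps)
  also have "\<dots> = 0" unfolding central_fps_deriv d by (simp add: power2_eq_square)
  finally have "?E = fps_const (?E $ 0)" by (rule fps_deriv_eq_0_iff[THEN iffD1])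
  also have "?E $ 0 = 1" by (simp add: central_fps_def power2_eq_square)
  finally show ?thesis by simp
qed

lemma sqrt_fps: "fps_radical root 2 (1 - 4 * fps_X ^ 2) = central_fps * (1 - 4 * fps_X ^ 2)"
proof -
  let ?r = "central_fps * (1 - 4 * fps_X ^ 2)"
  have "?r ^ 2 = (central_fps ^ 2 * (1 - 4 * fps_X ^ 2)) * (1 - 4 * fps_X ^ 2)"
    by (simp add: power2_eq_square)
  then have "?r ^ Suc 1 = 1 - 4 * fps_X ^ 2" by (simp add: central_fps_square flip: numeral_2_eq_2)
  then show ?thesis
    using radical_unique[of root 1 "1 - 4 * fps_X ^ 2" ?r] by (simp add: central_fps_def numeral_2_eq_2)
qed

text \<open>
  The series with coefficients \<open>2 binomial (n - 1) \<lfloor>(n - 1) / 2\<rfloor>\<close> agrees with \<open>(1 + 2x) / sqrt (1 - 4x\<^sup>2)\<close> from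
  degree one on: in odd degrees because the binomial coefficient is central, in even degrees because two equal
  ones add up to a central one. The polynomial corrects the coefficients up to degree four.
\<close>
lemma simplicial_gf_eq:
  "simplicial_gf = (1 + 2 * fps_X) * central_fps
     - (1 + 2 * fps_X + fps_X ^ 2 + 2 * fps_X ^ 3 + 2 * fps_X ^ 4)"
proof (rule fps_ext)
  fix n
  let ?c = "\<lambda>n. central_fps $ n"
  have R: "((1 + 2 * fps_X) * central_fps
     - (1 + 2 * fps_X + fps_X ^ 2 + 2 * fps_X ^ 3 + 2 * fps_X ^ 4)) $ n =
     ?c n + (if n = 0 then 0 else 2 * ?c (n - 1))
     - (of_bool (n = 0) + 2 * of_bool (n = 1) + of_bool (n = 2) + 2 * of_bool (n = 3) + 2 * of_bool (n = 4))"
    by (simp add: numeral_fps_const distrib_right mult.assoc fps_X_power_nth)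
  show "simplicial_gf $ n = ((1 + 2 * fps_X) * central_fps
     - (1 + 2 * fps_X + fps_X ^ 2 + 2 * fps_X ^ 3 + 2 * fps_X ^ 4)) $ n"
  proof (cases "n \<ge> 2")
    case False
    then have "n = 0 \<or> n = 1" by linarith
    then show ?thesis unfolding R by (auto simp: simplicial_gf_def central_fps_def)
  next
    case True
    have "?c n + 2 * ?c (n - 1) = 2 * real ((n - 1) choose ((n - 1) div 2))"
    proof (cases "even n")
      case True
      then obtain m where m: "n = 2 * m" by (rule evenE)
      then obtain k where k: "n = 2 * Suc k" using \<open>n \<ge> 2\<close> by (cases m) auto
      have "(2 * k + 1) choose k = Suc (2 * k) choose Suc k"
        using binomial_symmetric[of k "2 * k + 1"] by simp
      then have "(2 * Suc k) choose Suc k = 2 * ((2 * k + 1) choose k)" by simp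
      then show ?thesis using k by (simp add: central_fps_def)
    next
      case False
      then show ?thesis using True by (simp add: central_fps_def)
    qed
    moreover have "real_of_int (int (num_simplicial n)) = real_of_int (2 * int ((n - 1) choose ((n - 1) div 2))
       - of_bool (n = 1) - of_bool (n = 2) - 2 * of_bool (n = 3) - 2 * of_bool (n = 4))"
      using num_simplicial_formula[of n] True by simp
    ultimately show ?thesis unfolding R using True by (simp add: simplicial_gf_def)
  qed
qed

lemma simplicial_gf_closed_form:
  "simplicial_gf = (4 * fps_X ^ 5 + 2 * fps_X ^ 4 + 3 * fps_X ^ 2
     + fps_radical root 2 (1 - 4 * fps_X ^ 2) - 1) / (1 - 2 * fps_X)"
proof -
  have ne: "(1 - 2 * fps_X :: real fps) \<noteq> 0"
  proof
    assume "(1 - 2 * fps_X :: real fps) = 0"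
    then have "(1 - 2 * fps_X :: real fps) $ 0 = 0" by simp
    then show False by simp
  qed
  have "simplicial_gf * (1 - 2 * fps_X) =
      4 * fps_X ^ 5 + 2 * fps_X ^ 4 + 3 * fps_X ^ 2 + fps_radical root 2 (1 - 4 * fps_X ^ 2) - 1"
    unfolding simplicial_gf_eq sqrt_fps by algebra
  then show ?thesis using nonzero_mult_div_cancel_right[OF ne, of simplicial_gf] by simp
qed

theorem theorem3p11:
  shows
    "(\<forall>n\<ge>1. int (num_simplicial n) =
        2 * int ((n - 1) choose ((n - 1) div 2))
        - of_bool (n = 1) - of_bool (n = 2) - 2 * of_bool (n = 3) - 2 * of_bool (n = 4))
   \<and> (simplicial_gf =
        (4 * fps_X ^ 5 + 2 * fps_X ^ 4 + 3 * fps_X ^ 2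
          + fps_radical root 2 (1 - 4 * fps_X ^ 2) - 1) / (1 - 2 * fps_X))
   \<and> (\<forall>n S C s lpos lneg lnull e.
        n \<ge> 3 \<and> C \<in> gl_chambers n
        \<and> S \<subseteq> {1..n} \<and> C = chamber_of n S \<and> s = char_vec S
        \<and> C \<inter> hsl n \<in> sl_chambers n
        \<and> lpos = card {i. positive_level n s i}
        \<and> lneg = card {i. negative_level n s i}
        \<and> lnull = card {i. null_level n s i}
        \<and> e = level_ray n S
        \<longrightarrow>
          (\<forall>i. 1 \<le> i \<and> i \<le> n div 2 \<longrightarrow>
             (ray (vvec n (i, i)) \<subseteq> C \<inter> hsl n \<longleftrightarrow> extreme_ray (ray (vvec n (i, i))) C)
           \<and> (extreme_ray (ray (vvec n (i, i))) C \<longleftrightarrow> null_level n s (2 * i)))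
        \<and> (\<forall>p\<^sub>1 p\<^sub>2. (p\<^sub>1, p\<^sub>2) \<in> BB n \<longrightarrow>
             (ray (vvec2 n p\<^sub>1 p\<^sub>2) \<subseteq> C \<inter> hsl n \<longleftrightarrow>
                extreme_ray (ray (vvec n p\<^sub>1)) C \<and> extreme_ray (ray (vvec n p\<^sub>2)) C)
           \<and> (extreme_ray (ray (vvec n p\<^sub>1)) C \<and> extreme_ray (ray (vvec n p\<^sub>2)) C \<longleftrightarrow>
                sigv n (e (level p\<^sub>1)) = real_of_int (sig p\<^sub>1)
              \<and> sigv n (e (level p\<^sub>2)) = real_of_int (sig p\<^sub>2)))
        \<and> card {F. extreme_ray F (C \<inter> hsl n)} = lpos * lneg + lnull
        \<and> (simplicial n (C \<inter> hsl n) \<longleftrightarrow> min lpos lneg = 1))"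
proof (intro conjI allI impI)
  show "int (num_simplicial n) = 2 * int ((n - 1) choose ((n - 1) div 2))
      - of_bool (n = 1) - of_bool (n = 2) - 2 * of_bool (n = 3) - 2 * of_bool (n = 4)" if "n \<ge> 1" for n
    by (rule num_simplicial_formula[OF that])
  show "simplicial_gf = (4 * fps_X ^ 5 + 2 * fps_X ^ 4 + 3 * fps_X ^ 2
     + fps_radical root 2 (1 - 4 * fps_X ^ 2) - 1) / (1 - 2 * fps_X)"
    by (rule simplicial_gf_closed_form)
next
  fix n S C s lpos lneg lnull e
  assume "n \<ge> 3 \<and> C \<in> gl_chambers n
        \<and> S \<subseteq> {1..n} \<and> C = chamber_of n S \<and> s = char_vec S
        \<and> C \<inter> hsl n \<in> sl_chambers n
        \<and> lpos = card {i. positive_level n s i}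
        \<and> lneg = card {i. negative_level n s i}
        \<and> lnull = card {i. null_level n s i}
        \<and> e = level_ray n S"
  then have n: "n \<ge> 3" and S: "S \<subseteq> {1..n}" and C: "C = chamber_of n S" and s: "s = char_vec S"
    and Csl: "C \<inter> hsl n \<in> sl_chambers n"
    and l: "lpos = card {i. positive_level n s i}" "lneg = card {i. negative_level n s i}"
      "lnull = card {i. null_level n s i}" and e: "e = level_ray n S"
    by blast+
  have sl: "chamber_of n S \<inter> hsl n \<in> sl_chambers n" using Csl unfolding C .
  interpret sign_pattern n S by unfold_locales fact
  \<comment> \<open>The section is the closure of the cell of some \<open>S'\<close>, which equals \<open>S\<close> by uniqueness.\<close>
  have bal: "balanced n S"
  proof -
    obtain S' where S': "balanced n S'" "chamber_of n S \<inter> hsl n = chamber_of n S' \<inter> hsl n"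
      using sl unfolding sl_chambers_eq[OF n] by blast
    then have "S' = S" using chamber_slice_unique[of n S' S] n S by simp
    then show ?thesis using S' by simp
  qed
  show "card {F. extreme_ray F (C \<inter> hsl n)} = lpos * lneg + lnull"
    unfolding C l s by (rule card_extreme_rays)
  show "simplicial n (C \<inter> hsl n) \<longleftrightarrow> min lpos lneg = 1"
    unfolding C l s by (rule simplicial_chamber_iff[OF bal])
  {
    fix i assume i: "1 \<le> i \<and> i \<le> n div 2"
    then have E: "(i, i) \<in> Estar n" by (auto simp: Estar_def)
    show "ray (vvec n (i, i)) \<subseteq> C \<inter> hsl n \<longleftrightarrow> extreme_ray (ray (vvec n (i, i))) C"
      "extreme_ray (ray (vvec n (i, i))) C \<longleftrightarrow> null_level n s (2 * i)"
      unfolding C s chamber_of_eq_orthant extreme_ray_vvec_iff[OF E] using null_ray[of i] i by blast+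
  next
    fix p\<^sub>1 p\<^sub>2 assume B: "(p\<^sub>1, p\<^sub>2) \<in> BB n"
    then have E: "p\<^sub>1 \<in> Estar n" "p\<^sub>2 \<in> Estar n" by (auto simp: BB_def)
    show "ray (vvec2 n p\<^sub>1 p\<^sub>2) \<subseteq> C \<inter> hsl n \<longleftrightarrow>
        extreme_ray (ray (vvec n p\<^sub>1)) C \<and> extreme_ray (ray (vvec n p\<^sub>2)) C"
      unfolding C chamber_of_eq_orthant extreme_ray_vvec_iff[OF E(1)] extreme_ray_vvec_iff[OF E(2)]
      by (rule edge_ray[OF B])
    show "extreme_ray (ray (vvec n p\<^sub>1)) C \<and> extreme_ray (ray (vvec n p\<^sub>2)) C \<longleftrightarrow>
        sigv n (e (level p\<^sub>1)) = real_of_int (sig p\<^sub>1) \<and> sigv n (e (level p\<^sub>2)) = real_of_int (sig p\<^sub>2)"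
      unfolding C e chamber_of_eq_orthant extreme_ray_vvec_iff[OF E(1)] extreme_ray_vvec_iff[OF E(2)]
        level_ray_signature_iff[OF E(1)] level_ray_signature_iff[OF E(2)] ..
  }
qed

end
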